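(* Let $(R,\mathfrak m,\mathsf k)$ be a Noetherian local ring, $A=G_{\mathfrak m}(R)$, and let $M$ be a finitely generated $R$-module with a minimal free resolution $\mathbb F_\bullet$. Let $\mathbb F_\bullet^*$ be the associated complex of graded free $A$-modules defined in the context. Then $G_{\mathfrak m}(M)$ has a pure resolution over $A$ if and only if $\mathbb F_\bullet^*$ is a minimal $A$-free resolution of $G_{\mathfrak m}(M)$.
   Context: For a finitely generated $R$-module $L$, $G_{\mathfrak m}(L)=\bigoplus_{i\ge0}\mathfrak m^iL/\mathfrak m^{i+1}L$, a graded module over $A=G_{\mathfrak m}(R)=\bigoplus_{i\ge 0}\mathfrak m^i/\mathfrak m^{i+1}$. The $n$-twist of a graded module $L$ is $L(n)$ with $L(n)_j=L_{n+j}$. Initial form of a map: for a nonzero $R$-linear map $\phi:R^m\to R^n$ given by a matrix $(a_{ij})$, let $\nu(\phi)=s$ be the largest integer with all $a_{ij}\in\mathfrak m^s$ (i.e. the $\mathfrak m$-adic order of $\phi$ as an element of the free module $R^{mn}$). Its initial form is the matrix $\phi^*=(a_{ij}+\mathfrak m^{s+1})$ with entries in $\mathfrak m^s/\mathfrak m^{s+1}=A_s$; it is regarded as a degree $0$ graded map $G_{\mathfrak m}(R^m)(-s-j)\to G_{\mathfrak m}(R^n)(-j)$ for any $j\in\mathbb Z$. The complex $\mathbb F_\bullet^*$: if $\mathbb F_\bullet:\ \cdots\to F_p\xrightarrow{\phi_p}\cdots\to F_1\xrightarrow{\phi_1}F_0\to0$ is a minimal free resolution of $M$, with $s_i=\nu(\phi_i)$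 and $\delta_i=\sum_{j=1}^i s_j$ ($\delta_0=0$), then $$\mathbb F_\bullet^*:\ \cdots\to G_{\mathfrak m}(F_p)(-\delta_p)\xrightarrow{\phi_p^*}\cdots\to G_{\mathfrak m}(F_1)(-\delta_1)\xrightarrow{\phi_1^*}G_{\mathfrak m}(F_0)\to0 .$$ (If $F_i=0$ for $i>p$, the complex $\mathbb F_\bullet^*$ is likewise zero in positions $i>p$.) The augmentation $\epsilon:G_{\mathfrak m}(F_0)\to G_{\mathfrak m}(M)$ is the surjection induced by $F_0\to M$. A finitely generated graded $A$-module has a pure resolution (is pure) if in its minimal graded free resolution, for each homological degree $i$, the graded Betti number $\beta_{i,j}$ is nonzero for at most one $j$. *)

theory Defs
  imports "HOL-Algebra.Algebra"
begin

section \<open>Modules over a commutative ring\<close>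

definition noetherian_local_ring :: "('a, 'm) ring_scheme \<Rightarrow> 'a set \<Rightarrow> bool" where
  "noetherian_local_ring R I \<longleftrightarrow>
     cring R \<and> noetherian_ring R \<and> maximalideal I R \<and> (\<forall>J. maximalideal J R \<longrightarrow> J = I)"

definition submodule_span ::
  "('a, 'm) ring_scheme \<Rightarrow> ('a, 'b, 'n) module_scheme \<Rightarrow> 'b set \<Rightarrow> 'b set" where
  "submodule_span R M S = \<Inter>{N. submodule N R M \<and> S \<subseteq> N}"

definition fin_gen_module ::
  "('a, 'm) ring_scheme \<Rightarrow> ('a, 'b, 'n) module_scheme \<Rightarrow> bool" where
  "fin_gen_module R M \<longleftrightarrow>
     module R M \<and> (\<exists>S. finite S \<and> S \<subseteq> carrier M \<and> submodule_span R M S = carrier M)"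

definition module_hom ::
  "('a, 'm) ring_scheme \<Rightarrow> ('a, 'b, 'n) module_scheme \<Rightarrow> ('a, 'c, 'o) module_scheme \<Rightarrow>
     ('b \<Rightarrow> 'c) set" where
  "module_hom R M N =
     {f \<in> carrier M \<rightarrow> carrier N.
        (\<forall>x\<in>carrier M. \<forall>y\<in>carrier M. f (x \<oplus>\<^bsub>M\<^esub> y) = f x \<oplus>\<^bsub>N\<^esub> f y) \<and>
        (\<forall>r\<in>carrier R. \<forall>x\<in>carrier M. f (r \<odot>\<^bsub>M\<^esub> x) = r \<odot>\<^bsub>N\<^esub> f x)}"

text \<open>The ring as a module over itself; the fields \<open>mult\<close> and \<open>one\<close> that a module record
  inherits from the ring record play no role in any module.\<close>

definition self_module :: "('a, 'm) ring_scheme \<Rightarrow> ('a, 'a) module" where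
  "self_module R =
     \<lparr>carrier = carrier R, monoid.mult = monoid.mult R, one = \<one>\<^bsub>R\<^esub>,
      ring.zero = \<zero>\<^bsub>R\<^esub>, add = add R, smult = monoid.mult R\<rparr>"

text \<open>The module \<open>R\<^sup>n\<close> of column vectors indexed by \<open>{..<n}\<close>; vectors are extensional
  functions, so that each is represented once.\<close>

definition free_module :: "('a, 'm) ring_scheme \<Rightarrow> nat \<Rightarrow> ('a, nat \<Rightarrow> 'a) module" where
  "free_module R n =
     \<lparr>carrier = {..<n} \<rightarrow>\<^sub>E carrier R, monoid.mult = undefined, one = undefined,
      ring.zero = (\<lambda>k\<in>{..<n}. \<zero>\<^bsub>R\<^esub>),
      add = (\<lambda>x y. \<lambda>k\<in>{..<n}. x k \<oplus>\<^bsub>R\<^esub> y k),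
      smult = (\<lambda>r x. \<lambda>k\<in>{..<n}. r \<otimes>\<^bsub>R\<^esub> x k)\<rparr>"

text \<open>The map \<open>R\<^sup>m \<rightarrow> R\<^sup>n\<close> given by an \<open>n \<times> m\<close> matrix.\<close>

definition matrix_map ::
  "('a, 'm) ring_scheme \<Rightarrow> nat \<Rightarrow> nat \<Rightarrow> (nat \<Rightarrow> nat \<Rightarrow> 'a) \<Rightarrow> (nat \<Rightarrow> 'a) \<Rightarrow> nat \<Rightarrow> 'a" where
  "matrix_map R n m a x = (\<lambda>i\<in>{..<n}. \<Oplus>\<^bsub>R\<^esub>j\<in>{..<m}. a i j \<otimes>\<^bsub>R\<^esub> x j)"

definition ideal_smult ::
  "('a, 'm) ring_scheme \<Rightarrow> 'a set \<Rightarrow> ('a, 'b, 'n) module_scheme \<Rightarrow> 'b set" where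
  "ideal_smult R I M = submodule_span R M {r \<odot>\<^bsub>M\<^esub> x | r x. r \<in> I \<and> x \<in> carrier M}"

primrec ideal_power :: "('a, 'm) ring_scheme \<Rightarrow> 'a set \<Rightarrow> nat \<Rightarrow> 'a set" where
  "ideal_power R I 0 = carrier R"
| "ideal_power R I (Suc i) = ideal_prod R I (ideal_power R I i)"

text \<open>Exactness of \<open>\<cdots> \<rightarrow> P\<^sub>2 \<rightarrow> P\<^sub>1 \<rightarrow> P\<^sub>0 \<rightarrow> L \<rightarrow> 0\<close>, where \<open>d p\<close> is the map from \<open>P p\<close> to
  \<open>P (p - 1)\<close> for \<open>p \<ge> 1\<close> (the value \<open>d 0\<close> is not used) and \<open>e\<close> is the augmentation.\<close>

definition resolution ::
  "('a, 'm) ring_scheme \<Rightarrow> ('a, 'b, 'n) module_scheme \<Rightarrow> (nat \<Rightarrow> ('a, 'c, 'o) module_scheme) \<Rightarrow>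
     (nat \<Rightarrow> 'c \<Rightarrow> 'c) \<Rightarrow> ('c \<Rightarrow> 'b) \<Rightarrow> bool" where
  "resolution R L P d e \<longleftrightarrow>
     (\<forall>p. d (Suc p) \<in> module_hom R (P (Suc p)) (P p)) \<and>
     e \<in> module_hom R (P 0) L \<and>
     e ` carrier (P 0) = carrier L \<and>
     a_kernel (P 0) L e = d 1 ` carrier (P 1) \<and>
     (\<forall>p. a_kernel (P (Suc p)) (P p) (d (Suc p)) = d (Suc (Suc p)) ` carrier (P (Suc (Suc p))))"

text \<open>A minimal free resolution of \<open>M\<close> over a local ring with maximal ideal \<open>I\<close>; the \<open>p\<close>-th
  module is \<open>R\<^bsup>n p\<^esup>\<close> and the differentials are given by matrices.\<close>

definition minimal_free_resolution ::
  "('a, 'm) ring_scheme \<Rightarrow> 'a set \<Rightarrow> ('a, 'b, 'n) module_scheme \<Rightarrow> (nat \<Rightarrow> nat) \<Rightarrow>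
     (nat \<Rightarrow> nat \<Rightarrow> nat \<Rightarrow> 'a) \<Rightarrow> ((nat \<Rightarrow> 'a) \<Rightarrow> 'b) \<Rightarrow> bool" where
  "minimal_free_resolution R I M n \<phi> e \<longleftrightarrow>
     (\<forall>p. \<forall>i<n p. \<forall>j<n (Suc p). \<phi> (Suc p) i j \<in> carrier R) \<and>
     resolution R M (\<lambda>p. free_module R (n p))
       (\<lambda>p. matrix_map R (n (p - 1)) (n p) (\<phi> p)) e \<and>
     (\<forall>p. matrix_map R (n p) (n (Suc p)) (\<phi> (Suc p)) ` carrier (free_module R (n (Suc p)))
            \<subseteq> ideal_smult R I (free_module R (n p)))"



section \<open>Graded modules\<close>

record 'a graded_ring = "'a ring" +
  ring_grade :: "int \<Rightarrow> 'a set"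

record ('a, 'b) graded_module = "('a, 'b) module" +
  grade :: "int \<Rightarrow> 'b set"

definition twist ::
  "('a, 'b, 'n) graded_module_scheme \<Rightarrow> int \<Rightarrow> ('a, 'b, 'n) graded_module_scheme" where
  "twist L n = L\<lparr>grade := (\<lambda>j. grade L (n + j))\<rparr>"

definition graded_hom ::
  "('a, 'm) ring_scheme \<Rightarrow> ('a, 'b, 'n) graded_module_scheme \<Rightarrow>
     ('a, 'c, 'o) graded_module_scheme \<Rightarrow> ('b \<Rightarrow> 'c) set" where
  "graded_hom A L N = {f \<in> module_hom A L N. \<forall>j. f ` grade L j \<subseteq> grade N j}"

text \<open>The graded module \<open>A(-d 0) \<oplus> \<cdots> \<oplus> A(-d (n - 1))\<close>.\<close>

definition graded_free ::
  "('a, 'm) graded_ring_scheme \<Rightarrow> nat \<Rightarrow> (nat \<Rightarrow> int) \<Rightarrow> ('a, nat \<Rightarrow> 'a) graded_module" where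
  "graded_free A n d =
     module.extend (free_module A n)
       \<lparr>grade = (\<lambda>j. \<Pi>\<^sub>E k\<in>{..<n}. ring_grade A (j - d k))\<rparr>"

definition is_graded_free ::
  "('a, 'm) graded_ring_scheme \<Rightarrow> ('a, 'b, 'n) graded_module_scheme \<Rightarrow> bool" where
  "is_graded_free A P \<longleftrightarrow>
     module A P \<and>
     (\<exists>n d f. f \<in> graded_hom A (graded_free A n d) P \<and>
        bij_betw f (carrier (graded_free A n d)) (carrier P) \<and>
        (\<forall>j. f ` grade (graded_free A n d) j = grade P j))"

definition irrelevant_ideal :: "('a, 'm) graded_ring_scheme \<Rightarrow> 'a set" where
  "irrelevant_ideal A = Idl\<^bsub>A\<^esub> (\<Union>j\<in>{0<..}. ring_grade A j)"

text \<open>Meant for a nonnegatively graded ring whose component of degree zero is a field; there the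
  minimality of a graded free resolution means that the images of the differentials lie in the
  multiples of the free modules by the irrelevant ideal.\<close>

definition minimal_graded_free_resolution ::
  "('a, 'm) graded_ring_scheme \<Rightarrow> ('a, 'b, 'n) graded_module_scheme \<Rightarrow>
     (nat \<Rightarrow> ('a, 'c, 'o) graded_module_scheme) \<Rightarrow> (nat \<Rightarrow> 'c \<Rightarrow> 'c) \<Rightarrow> ('c \<Rightarrow> 'b) \<Rightarrow> bool" where
  "minimal_graded_free_resolution A L P d e \<longleftrightarrow>
     (\<forall>p. is_graded_free A (P p)) \<and>
     (\<forall>p. d (Suc p) \<in> graded_hom A (P (Suc p)) (P p)) \<and>
     e \<in> graded_hom A (P 0) L \<and>
     resolution A L P d e \<and>
     (\<forall>p. d (Suc p) ` carrier (P (Suc p)) \<subseteq> ideal_smult A (irrelevant_ideal A) (P p))"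

text \<open>The number of basis elements of degree \<open>j\<close> in the \<open>p\<close>-th term, when that term is
  \<open>A(-b p 0) \<oplus> \<cdots> \<oplus> A(-b p (n p - 1))\<close>.\<close>

definition graded_betti :: "(nat \<Rightarrow> nat) \<Rightarrow> (nat \<Rightarrow> nat \<Rightarrow> int) \<Rightarrow> nat \<Rightarrow> int \<Rightarrow> nat" where
  "graded_betti n b p j = card {k. k < n p \<and> b p k = j}"

text \<open>Every finitely generated graded free module is isomorphic to some \<^const>\<open>graded_free\<close>, and
  minimal graded free resolutions are unique up to isomorphism, so it suffices to ask for one
  minimal graded free resolution with terms of this form.\<close>

definition has_pure_resolution ::
  "('a, 'm) graded_ring_scheme \<Rightarrow> ('a, 'b, 'n) graded_module_scheme \<Rightarrow> bool" where
  "has_pure_resolution A L \<longleftrightarrow>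
     (\<exists>n b d e.
        minimal_graded_free_resolution A L (\<lambda>p. graded_free A (n p) (b p)) d e \<and>
        (\<forall>p. \<exists>\<^sub>\<le>\<^sub>1 j. graded_betti n b p j \<noteq> 0))"


section \<open>Associated graded rings and modules\<close>

text \<open>The submodule \<open>I\<^sup>i L\<close>.\<close>

definition filtration ::
  "('a, 'm) ring_scheme \<Rightarrow> 'a set \<Rightarrow> ('a, 'b, 'n) module_scheme \<Rightarrow> nat \<Rightarrow> 'b set" where
  "filtration R I L i = ideal_smult R (ideal_power R I i) L"

text \<open>The quotient \<open>I\<^sup>i L / I\<^bsup>i+1\<^esup> L\<close>, as a set of cosets.\<close>

definition gr_component ::
  "('a, 'm) ring_scheme \<Rightarrow> 'a set \<Rightarrow> ('a, 'b, 'n) module_scheme \<Rightarrow> nat \<Rightarrow> 'b set set" where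
  "gr_component R I L i =
     (\<lambda>x. filtration R I L (Suc i) +>\<^bsub>L\<^esub> x) ` filtration R I L i"

text \<open>The product, modulo a submodule \<open>H\<close> of \<open>L\<close>, of a coset \<open>C\<close> of scalars and a coset \<open>D\<close> of
  module elements; compare \<^const>\<open>rcoset_mult\<close>.\<close>

definition coset_smult ::
  "('a, 'b, 'n) module_scheme \<Rightarrow> 'b set \<Rightarrow> 'a set \<Rightarrow> 'b set \<Rightarrow> 'b set" where
  "coset_smult L H C D = (\<Union>r\<in>C. \<Union>x\<in>D. H +>\<^bsub>L\<^esub> (r \<odot>\<^bsub>L\<^esub> x))"

text \<open>The elements of the direct sum are the sequences of cosets with finitely many nonzero terms.
  The product of a sequence of scalar cosets and a sequence of module cosets is the Cauchy product;
  its term of index \<open>i\<close> is a sum in the quotient group \<open>L / I\<^bsup>i+1\<^esup> L\<close>, which \<^const>\<open>A_FactGroup\<close>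
  writes multiplicatively.\<close>

definition gr_module ::
  "('a, 'm) ring_scheme \<Rightarrow> 'a set \<Rightarrow> ('a, 'b, 'n) module_scheme \<Rightarrow>
     (nat \<Rightarrow> 'a set, nat \<Rightarrow> 'b set) graded_module" where
  "gr_module R I L =
     (let H = (\<lambda>i. filtration R I L (Suc i));
          S = {f. (\<forall>i. f i \<in> gr_component R I L i) \<and> finite {i. f i \<noteq> H i}}
      in \<lparr>carrier = S, monoid.mult = undefined, one = undefined,
          ring.zero = H,
          add = (\<lambda>f g i. f i <+>\<^bsub>L\<^esub> g i),
          smult = (\<lambda>a f i. \<Otimes>\<^bsub>L A_Mod H i\<^esub>k\<in>{..i}. coset_smult L (H i) (a k) (f (i - k))),
          grade = (\<lambda>j. {f \<in> S. \<forall>i. int i \<noteq> j \<longrightarrow> f i = H i})\<rparr>)"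

text \<open>The homogeneous element of degree \<open>s\<close> that is the class of \<open>x \<in> I\<^sup>s L\<close>.\<close>

definition gr_class ::
  "('a, 'm) ring_scheme \<Rightarrow> 'a set \<Rightarrow> ('a, 'b, 'n) module_scheme \<Rightarrow> nat \<Rightarrow> 'b \<Rightarrow> nat \<Rightarrow> 'b set" where
  "gr_class R I L s x =
     (\<lambda>i. if i = s then filtration R I L (Suc i) +>\<^bsub>L\<^esub> x else filtration R I L (Suc i))"

definition gr_ring ::
  "('a, 'm) ring_scheme \<Rightarrow> 'a set \<Rightarrow> (nat \<Rightarrow> 'a set) graded_ring" where
  "gr_ring R I =
     (let G = gr_module R I (self_module R)
      in \<lparr>carrier = carrier G, monoid.mult = smult G, one = gr_class R I (self_module R) 0 \<one>\<^bsub>R\<^esub>,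
          ring.zero = ring.zero G, add = add G, ring_grade = grade G\<rparr>)"

text \<open>The map of associated graded modules induced by a linear map \<open>f\<close> into \<open>N\<close>.\<close>

definition gr_map ::
  "('a, 'm) ring_scheme \<Rightarrow> 'a set \<Rightarrow> ('a, 'c, 'n) module_scheme \<Rightarrow> ('b \<Rightarrow> 'c) \<Rightarrow>
     (nat \<Rightarrow> 'b set) \<Rightarrow> nat \<Rightarrow> 'c set" where
  "gr_map R I N f u = (\<lambda>i. \<Union>x\<in>u i. filtration R I N (Suc i) +>\<^bsub>N\<^esub> f x)"


section \<open>Initial forms and the complex of initial forms\<close>

text \<open>The order of an \<open>n \<times> m\<close> matrix; it is only meaningful for a nonzero matrix. In a minimal
  free resolution a differential can only be zero if its source is zero, and then all later terms
  vanish too, so that the unspecified value has no effect below.\<close>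

definition matrix_order ::
  "('a, 'm) ring_scheme \<Rightarrow> 'a set \<Rightarrow> nat \<Rightarrow> nat \<Rightarrow> (nat \<Rightarrow> nat \<Rightarrow> 'a) \<Rightarrow> nat" where
  "matrix_order R I n m a = (GREATEST s. \<forall>i<n. \<forall>j<m. a i j \<in> ideal_power R I s)"

definition initial_form ::
  "('a, 'm) ring_scheme \<Rightarrow> 'a set \<Rightarrow> nat \<Rightarrow> nat \<Rightarrow> (nat \<Rightarrow> nat \<Rightarrow> 'a) \<Rightarrow>
     nat \<Rightarrow> nat \<Rightarrow> nat \<Rightarrow> 'a set" where
  "initial_form R I n m a =
     (\<lambda>i j. gr_class R I (self_module R) (matrix_order R I n m a) (a i j))"

text \<open>A coset of \<open>I\<^bsup>i+1\<^esup>R\<^sup>n\<close> in \<open>I\<^sup>iR\<^sup>n\<close> is a product of \<open>n\<close> cosets of \<open>I\<^bsup>i+1\<^esup>\<close> in \<open>I\<^sup>i\<close>. The next two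
  functions are the resulting mutually inverse isomorphisms between the associated graded module of
  \<open>R\<^sup>n\<close> and \<open>A\<^sup>n\<close>, where \<open>A\<close> is the associated graded ring.\<close>

definition gr_coords :: "nat \<Rightarrow> (nat \<Rightarrow> (nat \<Rightarrow> 'a) set) \<Rightarrow> nat \<Rightarrow> nat \<Rightarrow> 'a set" where
  "gr_coords n u = (\<lambda>k\<in>{..<n}. \<lambda>i. (\<lambda>x. x k) ` u i)"

definition gr_of_coords :: "nat \<Rightarrow> (nat \<Rightarrow> nat \<Rightarrow> 'a set) \<Rightarrow> nat \<Rightarrow> (nat \<Rightarrow> 'a) set" where
  "gr_of_coords n v = (\<lambda>i. \<Pi>\<^sub>E k\<in>{..<n}. v k i)"

text \<open>The initial form of a matrix, regarded as a map from the associated graded module of \<open>R\<^sup>m\<close> to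
  that of \<open>R\<^sup>n\<close>.\<close>

definition initial_form_map ::
  "('a, 'm) ring_scheme \<Rightarrow> 'a set \<Rightarrow> nat \<Rightarrow> nat \<Rightarrow> (nat \<Rightarrow> nat \<Rightarrow> 'a) \<Rightarrow>
     (nat \<Rightarrow> (nat \<Rightarrow> 'a) set) \<Rightarrow> nat \<Rightarrow> (nat \<Rightarrow> 'a) set" where
  "initial_form_map R I n m a u =
     gr_of_coords n (matrix_map (gr_ring R I) n m (initial_form R I n m a) (gr_coords m u))"

definition initial_shift ::
  "('a, 'm) ring_scheme \<Rightarrow> 'a set \<Rightarrow> (nat \<Rightarrow> nat) \<Rightarrow> (nat \<Rightarrow> nat \<Rightarrow> nat \<Rightarrow> 'a) \<Rightarrow> nat \<Rightarrow> nat" where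
  "initial_shift R I n \<phi> p = (\<Sum>i=1..p. matrix_order R I (n (i - 1)) (n i) (\<phi> i))"

definition initial_complex ::
  "('a, 'm) ring_scheme \<Rightarrow> 'a set \<Rightarrow> (nat \<Rightarrow> nat) \<Rightarrow> (nat \<Rightarrow> nat \<Rightarrow> nat \<Rightarrow> 'a) \<Rightarrow>
     nat \<Rightarrow> (nat \<Rightarrow> 'a set, nat \<Rightarrow> (nat \<Rightarrow> 'a) set) graded_module" where
  "initial_complex R I n \<phi> p =
     twist (gr_module R I (free_module R (n p))) (- int (initial_shift R I n \<phi> p))"

definition initial_complex_map ::
  "('a, 'm) ring_scheme \<Rightarrow> 'a set \<Rightarrow> (nat \<Rightarrow> nat) \<Rightarrow> (nat \<Rightarrow> nat \<Rightarrow> nat \<Rightarrow> 'a) \<Rightarrow>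
     nat \<Rightarrow> (nat \<Rightarrow> (nat \<Rightarrow> 'a) set) \<Rightarrow> nat \<Rightarrow> (nat \<Rightarrow> 'a) set" where
  "initial_complex_map R I n \<phi> p = initial_form_map R I (n (p - 1)) (n p) (\<phi> p)"

end

theory Submission
  imports Defs
begin

text \<open>If the complex of initial forms is a resolution, it is pure, since its \<open>p\<close>-th term is
  generated in the single degree \<open>initial_shift R I n \<phi> p\<close>.

  Conversely, let \<open>P\<close> be a pure resolution of the associated graded module of \<open>M\<close>. Graded
  isomorphisms from \<open>P\<close> to the complex of initial forms are built degree by degree. Let \<open>Z\<close> be the
  image of the next differential of the given resolution, a submodule of \<open>R\<^sup>l\<close>. The kernel reached so
  far consists of the initial forms of elements of \<open>Z\<close>, and purity says that it is generated in one
  degree \<open>s\<close>. Hence \<open>Z \<inter> I\<^bsup>s+i\<^esup>R\<^sup>l\<close> lies in \<open>I\<^sup>iZ + I\<^bsup>s+i+j\<^esup>R\<^sup>l\<close> for all \<open>j\<close>, hence in \<open>I\<^sup>iZ\<close> by Krull's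
  intersection theorem. So \<open>s\<close> is the order of the next differential \<open>f\<close>, and \<open>f\<close> is strict: it maps
  \<open>I\<^sup>iR\<^sup>m\<close> onto \<open>Z \<inter> I\<^bsup>s+i\<^esup>R\<^sup>l\<close>. A strict map induces an exact sequence of associated graded modules, and
  minimality on both sides makes the two covers of the kernel isomorphic in degree \<open>0\<close>, hence
  isomorphic.\<close>

section \<open>Submodules and spans\<close>

text \<open>The obstacle is that passing to associated graded modules is not exact. A submodule Z of
  L carries two filtrations, the induced one Z \<inter> I^i L and its own I^i Z. The kernel of a
  graded map is described by the first, while the image of the map induced by the next differential
  is controlled by the second. The Artin-Rees lemma bounds the gap between them; generation of the
  initial module in a single degree closes it up to a shift. The passage from approximation of every
  order to membership is then Krull's theorem for the submodules I^i Z. Minimality means that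
  neither of the two covers of a kernel kills a nonzero vector of its generating degree. Since the
  generators of both covers lie in one common degree, lifts between them can be chosen with entries
  in the degree 0 component of A, and injectivity has to be tested there only. This takes the place
  of the uniqueness of minimal graded resolutions. A delicate point is that degrees and orders carry
  no information about terms of rank 0. Such terms are treated separately, and the equations between
  degrees are claimed only for terms with a basis element.\<close>

lemma submodule_Inter:
  assumes "module R M" "\<And>N. N \<in> \<N> \<Longrightarrow> submodule N R M" "\<N> \<noteq> {}"
  shows "submodule (\<Inter>\<N>) R M"
proof -
  interpret module R M by fact
  show ?thesis
    using assms(2,3) by (intro submoduleI) (auto dest: submoduleE(1,3,4,5) intro: subgroup.one_closed[OF submodule.axioms(1), of _ R M, simplified])
qed

lemma submodule_zero:
  assumes "module R M" "submodule N R M"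
  shows "\<zero>\<^bsub>M\<^esub> \<in> N"
  using subgroup.one_closed[OF submodule.axioms(1)[OF assms(2)]] by simp

lemma submodule_additive:
  assumes "module R M" "submodule N R M"
  shows "additive_subgroup N M"
  using submodule.axioms(1)[OF assms(2)] by (rule additive_subgroupI)

lemma submodule_abelian_subgroup:
  assumes "module R M" "submodule N R M"
  shows "abelian_subgroup N M"
  using assms(1) submodule.axioms(1)[OF assms(2)]
  by (intro abelian_subgroupI3 submodule_additive[OF assms]) (simp add: module_def)

lemma submodule_minus:
  assumes "module R M" "submodule N R M" "x \<in> N" "y \<in> N"
  shows "x \<ominus>\<^bsub>M\<^esub> y \<in> N"
  using assms module.submoduleE(3,5)[OF assms(1,2)] by (simp add: a_minus_def)

lemma submodule_finsum:
  assumes "module R M" "submodule N R M" "finite A" "\<And>a. a \<in> A \<Longrightarrow> f a \<in> N"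
  shows "finsum M f A \<in> N"
proof -
  interpret module R M by fact
  note E = submoduleE[OF assms(2)]
  from assms(3,4) show ?thesis
  proof (induction A)
    case empty
    then show ?case using submodule_zero[OF assms(1,2)] by simp
  next
    case (insert a A)
    then show ?case using E(1) by (subst finsum_insert) (auto intro!: E(5))
  qed
qed

lemma submodule_span_submodule:
  assumes "module R M" "S \<subseteq> carrier M"
  shows "submodule (submodule_span R M S) R M"
  unfolding submodule_span_def
  using assms module.carrier_is_submodule[OF assms(1)] by (intro submodule_Inter) auto

lemma submodule_span_superset: "S \<subseteq> submodule_span R M S"
  by (auto simp: submodule_span_def)

lemma submodule_span_least:
  "submodule N R M \<Longrightarrow> S \<subseteq> N \<Longrightarrow> submodule_span R M S \<subseteq> N"
  by (auto simp: submodule_span_def)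

lemma ideal_smult_submodule:
  assumes "module R M" "J \<subseteq> carrier R"
  shows "submodule (ideal_smult R J M) R M"
  unfolding ideal_smult_def using assms module.smult_closed[OF assms(1)]
  by (intro submodule_span_submodule) auto

lemma ideal_smultI: "r \<in> J \<Longrightarrow> x \<in> carrier M \<Longrightarrow> r \<odot>\<^bsub>M\<^esub> x \<in> ideal_smult R J M"
  unfolding ideal_smult_def by (rule subsetD[OF submodule_span_superset]) auto

lemma ideal_smult_least:
  assumes "submodule N R M" "\<And>r x. r \<in> J \<Longrightarrow> x \<in> carrier M \<Longrightarrow> r \<odot>\<^bsub>M\<^esub> x \<in> N"
  shows "ideal_smult R J M \<subseteq> N"
  unfolding ideal_smult_def using assms by (intro submodule_span_least) auto

lemma ideal_smult_mono: "J \<subseteq> K \<Longrightarrow> ideal_smult R J M \<subseteq> ideal_smult R K M"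
  unfolding ideal_smult_def submodule_span_def by blast

text \<open>The colon ideal of N at x. In \<open>nakayama\<close> it turns out to be the maximal
  ideal; in \<open>power_add_least\<close> and \<open>filt_add_least\<close> it reduces the
  containment of a power of I to a test on products.\<close>

lemma ideal_submodule:
  assumes "cring R" "ideal J R" "module R M" "x \<in> carrier M" "submodule N R M"
  shows "ideal {r \<in> carrier R. r \<odot>\<^bsub>M\<^esub> x \<in> N} R"
proof -
  interpret module R M by fact
  note E = submoduleE[OF assms(5)]
  show ?thesis
  proof (rule idealI, rule R.ring_axioms, rule additive_subgroup.a_subgroup, rule additive_subgroupI)
    show "subgroup {r \<in> carrier R. r \<odot>\<^bsub>M\<^esub> x \<in> N} (add_monoid R)"
      using assms(4) E by (intro R.add.subgroupI)
       (auto simp: smult_l_distr smult_l_minus intro!: exI[of _ "\<zero>\<^bsub>R\<^esub>"] submodule_zero[OF assms(3,5)])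
  next
    fix a y assume "a \<in> {r \<in> carrier R. r \<odot>\<^bsub>M\<^esub> x \<in> N}" "y \<in> carrier R"
    moreover from this have "y \<odot>\<^bsub>M\<^esub> (a \<odot>\<^bsub>M\<^esub> x) \<in> N" using E by auto
    ultimately show "y \<otimes>\<^bsub>R\<^esub> a \<in> {r \<in> carrier R. r \<odot>\<^bsub>M\<^esub> x \<in> N}" "a \<otimes>\<^bsub>R\<^esub> y \<in> {r \<in> carrier R. r \<odot>\<^bsub>M\<^esub> x \<in> N}"
      using assms(4) by (auto simp: smult_assoc1 R.m_comm[of a])
  qed
qed

subsection \<open>Homomorphisms\<close>

lemma module_homD:
  assumes "f \<in> module_hom R M N"
  shows "x \<in> carrier M \<Longrightarrow> f x \<in> carrier N"
    "x \<in> carrier M \<Longrightarrow> y \<in> carrier M \<Longrightarrow> f (x \<oplus>\<^bsub>M\<^esub> y) = f x \<oplus>\<^bsub>N\<^esub> f y"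
    "r \<in> carrier R \<Longrightarrow> x \<in> carrier M \<Longrightarrow> f (r \<odot>\<^bsub>M\<^esub> x) = r \<odot>\<^bsub>N\<^esub> f x"
  using assms by (auto simp: module_hom_def)

lemma module_homI:
  assumes "\<And>x. x \<in> carrier M \<Longrightarrow> f x \<in> carrier N"
    "\<And>x y. x \<in> carrier M \<Longrightarrow> y \<in> carrier M \<Longrightarrow> f (x \<oplus>\<^bsub>M\<^esub> y) = f x \<oplus>\<^bsub>N\<^esub> f y"
    "\<And>r x. r \<in> carrier R \<Longrightarrow> x \<in> carrier M \<Longrightarrow> f (r \<odot>\<^bsub>M\<^esub> x) = r \<odot>\<^bsub>N\<^esub> f x"
  shows "f \<in> module_hom R M N"
  using assms by (auto simp: module_hom_def)

lemma module_hom_comp: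
  assumes "f \<in> module_hom R M N" "g \<in> module_hom R N P"
  shows "g \<circ> f \<in> module_hom R M P"
  using module_homD[OF assms(1)] module_homD[OF assms(2)] by (intro module_homI) auto

lemma module_hom_group_hom:
  assumes "module R M" "module R N" "f \<in> module_hom R M N"
  shows "abelian_group_hom M N f"
  using assms unfolding module_def abelian_group_def abelian_group_axioms_def comm_group_def
  by (intro abelian_group_homI group_hom.intro)
    (auto simp: module_hom_def group_hom_axioms_def hom_def abelian_group_def abelian_group_axioms_def comm_group_def)

lemma module_hom_zero:
  assumes "module R M" "module R N" "f \<in> module_hom R M N"
  shows "f \<zero>\<^bsub>M\<^esub> = \<zero>\<^bsub>N\<^esub>"
  using abelian_group_hom.hom_zero[OF module_hom_group_hom[OF assms]] .

lemma module_hom_minus: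
  assumes "module R M" "module R N" "f \<in> module_hom R M N" "x \<in> carrier M" "y \<in> carrier M"
  shows "f (x \<ominus>\<^bsub>M\<^esub> y) = f x \<ominus>\<^bsub>N\<^esub> f y"
proof -
  interpret M: module R M by fact
  interpret abelian_group_hom M N f using module_hom_group_hom[OF assms(1-3)] .
  show ?thesis using assms(4,5) by (simp add: a_minus_def)
qed

lemma module_hom_finsum:
  assumes "module R M" "module R N" "f \<in> module_hom R M N" "finite A" "g \<in> A \<rightarrow> carrier M"
  shows "f (finsum M g A) = finsum N (f \<circ> g) A"
proof -
  interpret M: module R M by fact
  interpret N: module R N by fact
  note D = module_homD[OF assms(3)]
  from assms(4,5) show ?thesis
    by (induction A) (auto simp: module_hom_zero[OF assms(1-3)] D Pi_iff M.finsum_insert N.finsum_insert)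
qed

lemma module_hom_image_submodule:
  assumes "module R M" "module R N" "f \<in> module_hom R M N" "submodule H R M"
  shows "submodule (f ` H) R N"
proof -
  interpret M: module R M by fact
  interpret N: module R N by fact
  interpret abelian_group_hom M N f using module_hom_group_hom[OF assms(1-3)] .
  note D = module_homD[OF assms(3)] and E = M.submoduleE[OF assms(4)]
  show ?thesis
  proof (rule N.submoduleI)
    show "\<zero>\<^bsub>N\<^esub> \<in> f ` H" using submodule_zero[OF assms(1,4)] hom_zero by (metis imageI)
    show "f ` H \<subseteq> carrier N" using D(1) E(1) by auto
    fix a assume "a \<in> f ` H"
    then obtain x where x: "x \<in> H" "a = f x" by auto
    have "\<ominus>\<^bsub>N\<^esub> a = f (\<ominus>\<^bsub>M\<^esub> x)" using x E(1) by auto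
    then show "\<ominus>\<^bsub>N\<^esub> a \<in> f ` H" using x E(3) by auto
    { fix b assume "b \<in> f ` H"
      then obtain y where y: "y \<in> H" "b = f y" by auto
      have "a \<oplus>\<^bsub>N\<^esub> b = f (x \<oplus>\<^bsub>M\<^esub> y)" using x y E(1) by (simp add: D(2) subset_iff)
      then show "a \<oplus>\<^bsub>N\<^esub> b \<in> f ` H" using x y E(5) by auto }
    fix r assume "r \<in> carrier R"
    then have "r \<odot>\<^bsub>N\<^esub> a = f (r \<odot>\<^bsub>M\<^esub> x)" using x E(1) D(3) by (simp add: subset_iff)
    then show "r \<odot>\<^bsub>N\<^esub> a \<in> f ` H" using x E(4) \<open>r \<in> carrier R\<close> by auto
  qed
qed

lemma module_hom_vimage_submodule:
  assumes "module R M" "module R N" "f \<in> module_hom R M N" "submodule H R N"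
  shows "submodule {x \<in> carrier M. f x \<in> H} R M"
proof -
  interpret M: module R M by fact
  interpret N: module R N by fact
  interpret abelian_group_hom M N f using module_hom_group_hom[OF assms(1-3)] .
  note D = module_homD[OF assms(3)] and E = N.submoduleE[OF assms(4)]
  show ?thesis
    using D E submodule_zero[OF assms(2,4)] by (intro M.submoduleI) auto
qed

lemma ideal_smult_hom:
  assumes "module R M" "module R N" "f \<in> module_hom R M N" "J \<subseteq> carrier R"
  shows "f ` ideal_smult R J M \<subseteq> ideal_smult R J N"
proof -
  have "ideal_smult R J M \<subseteq> {x \<in> carrier M. f x \<in> ideal_smult R J N}"
    using assms module_homD[OF assms(3)] module.smult_closed[OF assms(1)]
    by (intro ideal_smult_least module_hom_vimage_submodule[OF assms(1-3)] ideal_smult_submodule[OF assms(2,4)])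
       (auto simp: subset_iff intro: ideal_smultI)
  then show ?thesis by auto
qed

text \<open>Through \<open>filt_hom_surj\<close> this makes every surjection strict of degree 0,
  which starts the comparison at the augmentation.\<close>

lemma ideal_smult_hom_surj:
  assumes "module R M" "module R N" "f \<in> module_hom R M N" "J \<subseteq> carrier R" "f ` carrier M = carrier N"
  shows "f ` ideal_smult R J M = ideal_smult R J N"
proof (rule antisym[OF ideal_smult_hom[OF assms(1-4)]], rule ideal_smult_least)
  show "submodule (f ` ideal_smult R J M) R N"
    by (intro module_hom_image_submodule[OF assms(1-3)] ideal_smult_submodule[OF assms(1,4)])
  fix r y assume "r \<in> J" "y \<in> carrier N"
  moreover from this obtain x where "x \<in> carrier M" "y = f x" using assms(5) by auto
  ultimately show "r \<odot>\<^bsub>N\<^esub> y \<in> f ` ideal_smult R J M"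
    using assms(4) module_homD(3)[OF assms(3), of r x] ideal_smultI[of r J x M R]
    by (metis imageI subsetD)
qed

subsection \<open>The ring as a module, and free modules\<close>

lemma self_module_simps [simp]:
  "carrier (self_module R) = carrier R" "smult (self_module R) = monoid.mult R"
  "\<zero>\<^bsub>self_module R\<^esub> = \<zero>\<^bsub>R\<^esub>" "add (self_module R) = add R"
  "monoid.mult (self_module R) = monoid.mult R" "one (self_module R) = \<one>\<^bsub>R\<^esub>"
  by (simp_all add: self_module_def)

lemma self_module_module:
  assumes "cring R"
  shows "module R (self_module R)"
proof -
  interpret cring R by fact
  show ?thesis
  proof (rule moduleI)
    show "abelian_group (self_module R)"
      by (rule abelian_groupI) (auto simp: a_ac intro: bexI[of _ "\<ominus>\<^bsub>R\<^esub> _"] l_neg)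
  qed (auto simp: l_distr r_distr m_assoc is_cring)
qed

lemma submodule_self_module_iff:
  assumes "cring R"
  shows "submodule J R (self_module R) \<longleftrightarrow> ideal J R"
proof -
  interpret cring R by fact
  interpret S: module R "self_module R" using self_module_module[OF assms] .
  \<comment> \<open>The negative is defined by a description over each record separately, so it is
    carried over by uniqueness of inverses.\<close>
  have inv: "\<ominus>\<^bsub>self_module R\<^esub> x = \<ominus>\<^bsub>R\<^esub> x" if "x \<in> carrier R" for x
    using that by (metis S.l_neg a_inv_closed self_module_simps(1,3,4) minus_equality S.a_inv_closed)
  show ?thesis
  proof
    assume J: "submodule J R (self_module R)"
    note E = S.submoduleE[OF J]
    show "ideal J R"
    proof (rule idealI, rule ring_axioms, rule add.subgroupI)
      show "J \<subseteq> carrier R" "J \<noteq> {}" using E by auto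
      show "\<ominus>\<^bsub>R\<^esub> a \<in> J" if "a \<in> J" for a
        using E(1) E(3)[of a] that inv[of a] by auto
      show "x \<otimes>\<^bsub>R\<^esub> a \<in> J" "a \<otimes>\<^bsub>R\<^esub> x \<in> J" if "a \<in> J" "x \<in> carrier R" for a x
        using E(1) E(4)[of x a] that by (auto simp: m_comm[of a] subset_iff)
    qed (use E in auto)
  next
    assume "ideal J R"
    then interpret J: ideal J R .
    show "submodule J R (self_module R)"
      by (rule S.submoduleI) (auto simp: inv J.I_l_closed J.Icarr)
  qed
qed

lemma free_module_simps [simp]:
  "carrier (free_module R n) = {..<n} \<rightarrow>\<^sub>E carrier R"
  "\<zero>\<^bsub>free_module R n\<^esub> = (\<lambda>k\<in>{..<n}. \<zero>\<^bsub>R\<^esub>)"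
  "x \<oplus>\<^bsub>free_module R n\<^esub> y = (\<lambda>k\<in>{..<n}. x k \<oplus>\<^bsub>R\<^esub> y k)"
  "r \<odot>\<^bsub>free_module R n\<^esub> x = (\<lambda>k\<in>{..<n}. r \<otimes>\<^bsub>R\<^esub> x k)"
  by (simp_all add: free_module_def)

lemma free_module_module:
  assumes "cring R"
  shows "module R (free_module R n)"
proof -
  interpret cring R by fact
  show ?thesis
  proof (rule moduleI)
    show "abelian_group (free_module R n)"
    proof (rule abelian_groupI)
      fix x assume "x \<in> carrier (free_module R n)"
      then show "\<exists>y\<in>carrier (free_module R n). y \<oplus>\<^bsub>free_module R n\<^esub> x = \<zero>\<^bsub>free_module R n\<^esub>"
        by (intro bexI[of _ "\<lambda>k\<in>{..<n}. \<ominus>\<^bsub>R\<^esub> x k"]) (auto simp: PiE_iff l_neg intro!: restrict_ext)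
    qed (auto simp: PiE_iff a_ac extensional_def fun_eq_iff)
  qed (auto simp: PiE_iff l_distr r_distr m_assoc is_cring extensional_def fun_eq_iff)
qed

lemma free_module_inv:
  assumes "cring R" "x \<in> carrier (free_module R n)" "k < n"
  shows "(\<ominus>\<^bsub>free_module R n\<^esub> x) k = \<ominus>\<^bsub>R\<^esub> x k"
proof -
  interpret cring R by fact
  interpret F: module R "free_module R n" using free_module_module[OF assms(1)] .
  have "(\<ominus>\<^bsub>free_module R n\<^esub> x \<oplus>\<^bsub>free_module R n\<^esub> x) k = \<zero>\<^bsub>R\<^esub>"
    using F.l_neg[OF assms(2)] assms(3) by simp
  then have "(\<ominus>\<^bsub>free_module R n\<^esub> x) k \<oplus>\<^bsub>R\<^esub> x k = \<zero>\<^bsub>R\<^esub>" using assms(3) by simp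
  moreover have "(\<ominus>\<^bsub>free_module R n\<^esub> x) k \<in> carrier R" using F.a_inv_closed[OF assms(2)] assms(3) by auto
  moreover have "x k \<in> carrier R" using assms(2,3) by auto
  ultimately show ?thesis by (simp add: minus_equality)
qed

lemma free_module_minus:
  assumes "cring R" "x \<in> carrier (free_module R n)" "y \<in> carrier (free_module R n)" "k < n"
  shows "(x \<ominus>\<^bsub>free_module R n\<^esub> y) k = x k \<ominus>\<^bsub>R\<^esub> y k"
  using assms by (simp add: a_minus_def free_module_inv)

definition unit_vec :: "('a, 'm) ring_scheme \<Rightarrow> nat \<Rightarrow> nat \<Rightarrow> nat \<Rightarrow> 'a" where
  "unit_vec R n k = (\<lambda>i\<in>{..<n}. if i = k then \<one>\<^bsub>R\<^esub> else \<zero>\<^bsub>R\<^esub>)"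

lemma unit_vec_closed [simp]: "cring R \<Longrightarrow> unit_vec R n k \<in> {..<n} \<rightarrow>\<^sub>E carrier R"
  by (auto simp: unit_vec_def cring_def ring_def monoid.one_closed abelian_group_def abelian_monoid.zero_closed)

lemma finsum_free_module:
  assumes "cring R" "finite A" "g \<in> A \<rightarrow> carrier (free_module R n)"
  shows "finsum (free_module R n) g A = (\<lambda>i\<in>{..<n}. \<Oplus>\<^bsub>R\<^esub>a\<in>A. g a i)"
proof -
  interpret cring R by fact
  interpret F: module R "free_module R n" using free_module_module[OF assms(1)] .
  from assms(2,3) show ?thesis
  proof (induction A)
    case (insert a A)
    have "g \<in> A \<rightarrow> carrier (free_module R n)" "g a \<in> carrier (free_module R n)" using insert.prems by auto
    then have "i < n \<Longrightarrow> (\<lambda>a. g a i) \<in> A \<rightarrow> carrier R" "i < n \<Longrightarrow> g a i \<in> carrier R" for i by auto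
    then show ?case using insert by (subst F.finsum_insert) (auto simp: fun_eq_iff finsum_insert)
  qed auto
qed

lemma free_module_expand:
  assumes "cring R" "x \<in> carrier (free_module R n)"
  shows "x = (\<Oplus>\<^bsub>free_module R n\<^esub>k\<in>{..<n}. x k \<odot>\<^bsub>free_module R n\<^esub> unit_vec R n k)"
proof -
  interpret cring R by fact
  interpret F: module R "free_module R n" using free_module_module[OF assms(1)] .
  have "(\<Oplus>\<^bsub>free_module R n\<^esub>k\<in>{..<n}. x k \<odot>\<^bsub>free_module R n\<^esub> unit_vec R n k)
     = (\<lambda>i\<in>{..<n}. \<Oplus>\<^bsub>R\<^esub>k\<in>{..<n}. (x k \<odot>\<^bsub>free_module R n\<^esub> unit_vec R n k) i)"
    by (rule finsum_free_module) (use assms in \<open>auto simp: unit_vec_def PiE_iff\<close>)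
  also have "\<dots> = x"
  proof
    fix i show "(\<lambda>i\<in>{..<n}. \<Oplus>\<^bsub>R\<^esub>k\<in>{..<n}. (x k \<odot>\<^bsub>free_module R n\<^esub> unit_vec R n k) i) i = x i"
    proof (cases "i < n")
      case True
      have "(\<Oplus>\<^bsub>R\<^esub>k\<in>{..<n}. (x k \<odot>\<^bsub>free_module R n\<^esub> unit_vec R n k) i) = (\<Oplus>\<^bsub>R\<^esub>k\<in>{..<n}. if i = k then x k else \<zero>\<^bsub>R\<^esub>)"
        using True assms(2) by (intro finsum_cong') (auto simp: unit_vec_def PiE_iff)
      also have "\<dots> = x i" using True assms(2) by (intro finsum_singleton) auto
      finally show ?thesis using True by simp
    next
      case False then show ?thesis using assms(2) by (auto simp: PiE_iff extensional_def)
    qed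
  qed
  finally show ?thesis by simp
qed

lemma free_module_hom_expand:
  assumes "cring R" "module R N" "f \<in> module_hom R (free_module R n) N" "x \<in> carrier (free_module R n)"
  shows "f x = (\<Oplus>\<^bsub>N\<^esub>k\<in>{..<n}. x k \<odot>\<^bsub>N\<^esub> f (unit_vec R n k))"
proof -
  interpret cring R by fact
  interpret F: module R "free_module R n" using free_module_module[OF assms(1)] .
  interpret N: module R N by fact
  have xk: "x k \<in> carrier R" if "k < n" for k using assms(4) that by auto
  have "f x = f (\<Oplus>\<^bsub>free_module R n\<^esub>k\<in>{..<n}. x k \<odot>\<^bsub>free_module R n\<^esub> unit_vec R n k)"
    using free_module_expand[OF assms(1,4)] by simp
  also have "\<dots> = (\<Oplus>\<^bsub>N\<^esub>k\<in>{..<n}. f (x k \<odot>\<^bsub>free_module R n\<^esub> unit_vec R n k))"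
    using xk assms(1) F.smult_closed[of "x _" "unit_vec R n _"]
    by (subst module_hom_finsum[OF F.module_axioms assms(2,3)]) (auto simp: comp_def simp del: free_module_simps(4))
  also have "\<dots> = (\<Oplus>\<^bsub>N\<^esub>k\<in>{..<n}. x k \<odot>\<^bsub>N\<^esub> f (unit_vec R n k))"
    using xk assms(1) module_homD[OF assms(3)] by (intro N.finsum_cong') (auto simp del: free_module_simps(4))
  finally show ?thesis .
qed

text \<open>The map given by the universal property of a free module: it sends the k-th unit vector
  to \<open>g k\<close>. It is used over R for matrices and over A for maps into associated graded
  modules.\<close>

definition lin_comb :: "('a, 'b, 'n) module_scheme \<Rightarrow> nat \<Rightarrow> (nat \<Rightarrow> 'b) \<Rightarrow> (nat \<Rightarrow> 'a) \<Rightarrow> 'b" where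
  "lin_comb N n g x = (\<Oplus>\<^bsub>N\<^esub>k\<in>{..<n}. x k \<odot>\<^bsub>N\<^esub> g k)"

lemma lin_comb_hom:
  assumes "cring R" "module R N" "\<And>k. k < n \<Longrightarrow> g k \<in> carrier N"
  shows "lin_comb N n g \<in> module_hom R (free_module R n) N"
proof -
  interpret cring R by fact
  interpret N: module R N by fact
  show ?thesis
  proof (rule module_homI)
    fix x y assume x: "x \<in> carrier (free_module R n)"
    have xk: "x k \<in> carrier R" if "k < n" for k using x that by auto
    show "lin_comb N n g x \<in> carrier N"
      unfolding lin_comb_def using xk assms(3) by (intro N.finsum_closed) auto
    { fix r assume "r \<in> carrier R"
      then show "lin_comb N n g (r \<odot>\<^bsub>free_module R n\<^esub> x) = r \<odot>\<^bsub>N\<^esub> lin_comb N n g x"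
        unfolding lin_comb_def using xk assms(3)
        by (subst N.finsum_smult_ldistr) (auto simp: N.smult_assoc1 intro!: N.finsum_cong') }
    assume y: "y \<in> carrier (free_module R n)"
    have yk: "y k \<in> carrier R" if "k < n" for k using y that by auto
    have "lin_comb N n g (x \<oplus>\<^bsub>free_module R n\<^esub> y) = (\<Oplus>\<^bsub>N\<^esub>k\<in>{..<n}. x k \<odot>\<^bsub>N\<^esub> g k \<oplus>\<^bsub>N\<^esub> y k \<odot>\<^bsub>N\<^esub> g k)"
      unfolding lin_comb_def using xk yk assms(3) by (intro N.finsum_cong') (auto simp: N.smult_l_distr)
    also have "\<dots> = lin_comb N n g x \<oplus>\<^bsub>N\<^esub> lin_comb N n g y"
      unfolding lin_comb_def using xk yk assms(3) by (intro N.finsum_addf) auto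
    finally show "lin_comb N n g (x \<oplus>\<^bsub>free_module R n\<^esub> y) = lin_comb N n g x \<oplus>\<^bsub>N\<^esub> lin_comb N n g y" .
  qed
qed

lemma lin_comb_unit_vec:
  assumes "cring R" "module R N" "\<And>k. k < n \<Longrightarrow> g k \<in> carrier N" "j < n"
  shows "lin_comb N n g (unit_vec R n j) = g j"
proof -
  interpret cring R by fact
  interpret N: module R N by fact
  have "lin_comb N n g (unit_vec R n j) = (\<Oplus>\<^bsub>N\<^esub>k\<in>{..<n}. if j = k then g k else \<zero>\<^bsub>N\<^esub>)"
    unfolding lin_comb_def using assms(3,4) by (intro N.finsum_cong') (auto simp: unit_vec_def)
  also have "\<dots> = g j" using assms(3,4) by (intro N.finsum_singleton) auto
  finally show ?thesis .
qed

lemma free_module_hom_eqI: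
  assumes "cring R" "module R N" "f \<in> module_hom R (free_module R n) N" "g \<in> module_hom R (free_module R n) N"
    "\<And>k. k < n \<Longrightarrow> f (unit_vec R n k) = g (unit_vec R n k)" "x \<in> carrier (free_module R n)"
  shows "f x = g x"
proof -
  interpret N: module R N by fact
  have "f x = (\<Oplus>\<^bsub>N\<^esub>k\<in>{..<n}. x k \<odot>\<^bsub>N\<^esub> f (unit_vec R n k))"
    using assms by (intro free_module_hom_expand)
  also have "\<dots> = (\<Oplus>\<^bsub>N\<^esub>k\<in>{..<n}. x k \<odot>\<^bsub>N\<^esub> g (unit_vec R n k))"
    using assms module_homD(1)[OF assms(4)] unit_vec_closed[OF assms(1)] by (intro N.finsum_cong') (auto simp: PiE_mem)
  also have "\<dots> = g x"
    using assms by (intro free_module_hom_expand[symmetric])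
  finally show ?thesis .
qed

lemma matrix_map_hom:
  assumes "cring R" "\<And>i j. i < n \<Longrightarrow> j < m \<Longrightarrow> a i j \<in> carrier R"
  shows "matrix_map R n m a \<in> module_hom R (free_module R m) (free_module R n)"
proof -
  interpret cring R by fact
  interpret F: module R "free_module R n" using free_module_module[OF assms(1)] .
  \<comment> \<open>These are the columns of the matrix; the matrix map is the linear extension of
    sending unit vectors to columns.\<close>
  define g where "g j = (\<lambda>i\<in>{..<n}. a i j)" for j
  have g: "g j \<in> carrier (free_module R n)" if "j < m" for j using assms(2) that by (auto simp: g_def)
  have eq: "lin_comb (free_module R n) m g x = matrix_map R n m a x" if "x \<in> carrier (free_module R m)" for x
  proof -
    have xk: "x k \<in> carrier R" if "k < m" for k using \<open>x \<in> _\<close> that by auto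
    have "lin_comb (free_module R n) m g x = (\<lambda>i\<in>{..<n}. \<Oplus>\<^bsub>R\<^esub>j\<in>{..<m}. (x j \<odot>\<^bsub>free_module R n\<^esub> g j) i)"
      unfolding lin_comb_def using xk g F.smult_closed[of "x _" "g _"]
      by (intro finsum_free_module[OF assms(1)]) auto
    also have "\<dots> = matrix_map R n m a x"
      unfolding matrix_map_def using xk assms(2) by (auto simp: g_def m_comm intro!: restrict_ext finsum_cong')
    finally show ?thesis .
  qed
  have l: "lin_comb (free_module R n) m g \<in> module_hom R (free_module R m) (free_module R n)"
    using lin_comb_hom[OF assms(1) F.module_axioms g] .
  interpret Fm: module R "free_module R m" using free_module_module[OF assms(1)] .
  show ?thesis
    using module_homD[OF l] Fm.a_closed Fm.smult_closed by (intro module_homI) (simp_all only: eq[symmetric])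
qed

section \<open>Adic filtrations\<close>

text \<open>A vector with entries in J is a combination of unit vectors with coefficients in J. The
  ring is arbitrary because the lemma serves twice: for the powers of I over R and for the
  irrelevant ideal over A.\<close>

lemma (in cring) ideal_smult_free:
  assumes "ideal J R"
  shows "ideal_smult R J (free_module R n) = {..<n} \<rightarrow>\<^sub>E J"
proof
  interpret J: ideal J R by fact
  interpret L: module R "free_module R n" by (rule free_module_module[OF is_cring])
  have "submodule ({..<n} \<rightarrow>\<^sub>E J) R (free_module R n)"
  proof (rule L.submoduleI)
    fix x assume x: "x \<in> {..<n} \<rightarrow>\<^sub>E J"
    then have xc: "x \<in> carrier (free_module R n)" using J.Icarr by (auto simp: PiE_iff)
    show "\<ominus>\<^bsub>free_module R n\<^esub> x \<in> {..<n} \<rightarrow>\<^sub>E J"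
      using L.a_inv_closed[OF xc] free_module_inv[OF is_cring xc] x by (auto simp: PiE_iff)
    show "x \<oplus>\<^bsub>free_module R n\<^esub> y \<in> {..<n} \<rightarrow>\<^sub>E J" if "y \<in> {..<n} \<rightarrow>\<^sub>E J" for y
      using x that by (auto simp: PiE_iff)
    show "r \<odot>\<^bsub>free_module R n\<^esub> x \<in> {..<n} \<rightarrow>\<^sub>E J" if "r \<in> carrier R" for r
      using x that by (auto simp: PiE_iff intro: J.I_l_closed)
  qed (auto simp: PiE_iff intro: J.Icarr)
  then show "ideal_smult R J (free_module R n) \<subseteq> {..<n} \<rightarrow>\<^sub>E J"
    by (rule ideal_smult_least) (auto simp: J.I_r_closed PiE_iff)
  show "{..<n} \<rightarrow>\<^sub>E J \<subseteq> ideal_smult R J (free_module R n)"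
  proof
    fix x assume x: "x \<in> {..<n} \<rightarrow>\<^sub>E J"
    then have xc: "x \<in> carrier (free_module R n)" using J.Icarr by (auto simp: PiE_iff)
    have "(\<Oplus>\<^bsub>free_module R n\<^esub>k\<in>{..<n}. x k \<odot>\<^bsub>free_module R n\<^esub> unit_vec R n k) \<in> ideal_smult R J (free_module R n)"
    proof (rule submodule_finsum[OF L.module_axioms ideal_smult_submodule[OF L.module_axioms J.a_subset]])
      fix k assume "k \<in> {..<n}"
      then show "x k \<odot>\<^bsub>free_module R n\<^esub> unit_vec R n k \<in> ideal_smult R J (free_module R n)"
        using x unit_vec_closed[OF is_cring] by (intro ideal_smultI) (auto simp: PiE_iff)
    qed simp
    then show "x \<in> ideal_smult R J (free_module R n)"
      using free_module_expand[OF is_cring xc] by simp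
  qed
qed

text \<open>The formalism of associated graded modules is set up for any ideal of a commutative
  ring. The Noetherian and local hypotheses enter later, in \<open>noetherian_local\<close>, for the
  theorems of Nakayama and Krull.\<close>

locale adic = cring R + ideal I R for R (structure) and I
begin

lemma power_ideal: "ideal (ideal_power R I i) R"
  by (induction i) (auto intro: oneideal ideal_prod_is_ideal ideal_axioms)

lemma power_carrier: "x \<in> ideal_power R I i \<Longrightarrow> x \<in> carrier R"
  using power_ideal by (rule ideal.Icarr)

lemma power_Suc_subset: "ideal_power R I (Suc i) \<subseteq> ideal_power R I i"
  using ideal_prod_inter[OF ideal_axioms power_ideal[of i]] by auto

lemma power_antimono: "i \<le> j \<Longrightarrow> ideal_power R I j \<subseteq> ideal_power R I i"
  using power_Suc_subset by (rule lift_Suc_antimono_le[where f = "ideal_power R I"])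

lemma power_one: "ideal_power R I (Suc 0) = I"
proof -
  have "i \<in> ideal_prod R I (carrier R)" if "i \<in> I" for i
    using ideal_prod.prod[of i I \<one> "carrier R" R] that Icarr by simp
  then show ?thesis using ideal_prod_inter[OF ideal_axioms oneideal] by auto
qed

lemma power_mult:
  assumes "a \<in> ideal_power R I k" "b \<in> ideal_power R I l"
  shows "a \<otimes> b \<in> ideal_power R I (k + l)"
  using assms(1)
proof (induction k arbitrary: a)
  case 0
  then show ?case using assms(2) ideal.I_l_closed[OF power_ideal] by simp
next
  case (Suc k)
  from Suc.prems have "a \<in> ideal_prod R I (ideal_power R I k)" by simp
  then show ?case
  proof (induction a rule: ideal_prod.induct)
    case (prod i j)
    have "i \<otimes> (j \<otimes> b) \<in> ideal_prod R I (ideal_power R I (k + l))"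
      using prod Suc.IH by (intro ideal_prod.prod)
    then show ?case using prod Icarr power_carrier[of j k] power_carrier[OF assms(2)] by (simp add: m_assoc)
  next
    case (sum s1 s2)
    then show ?case
      using ideal_prod_in_carrier[OF ideal_axioms power_ideal[of k]] power_carrier[OF assms(2)]
      by (auto simp: l_distr subset_iff intro!: ideal_prod.sum)
  qed
qed

lemma filt_submodule: "module R L \<Longrightarrow> submodule (filtration R I L i) R L"
  unfolding filtration_def by (rule ideal_smult_submodule) (auto intro: power_carrier)

lemma filt_carrier: "module R L \<Longrightarrow> x \<in> filtration R I L i \<Longrightarrow> x \<in> carrier L"
  using module.submoduleE(1)[OF _ filt_submodule] by blast

lemma filt_0: "module R L \<Longrightarrow> filtration R I L 0 = carrier L"
  using ideal_smultI[of \<one> "ideal_power R I 0" _ L R] filt_carrier[of L _ 0] module.smult_one[of R L]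
  by (auto simp: filtration_def)

lemma filt_antimono: "i \<le> j \<Longrightarrow> filtration R I L j \<subseteq> filtration R I L i"
  unfolding filtration_def by (rule ideal_smult_mono[OF power_antimono])

lemma filt_abelian_subgroup: "module R L \<Longrightarrow> abelian_subgroup (filtration R I L i) L"
  by (rule submodule_abelian_subgroup[OF _ filt_submodule])

lemma filt_smult:
  assumes "module R L" "a \<in> ideal_power R I k" "x \<in> filtration R I L l"
  shows "a \<odot>\<^bsub>L\<^esub> x \<in> filtration R I L (k + l)"
proof -
  interpret L: module R L by fact
  have a: "a \<in> carrier R" using assms(2) power_carrier by blast
  \<comment> \<open>The elements for which the claim holds form a submodule, so it suffices to find
    the generators b x of I^l L in it.\<close>
  let ?N = "{x \<in> carrier L. a \<odot>\<^bsub>L\<^esub> x \<in> filtration R I L (k + l)}"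
  note E = L.submoduleE[OF filt_submodule[OF assms(1)]]
  have "submodule ?N R L"
  proof (rule L.submoduleI)
    show "r \<odot>\<^bsub>L\<^esub> x \<in> ?N" if "r \<in> carrier R" "x \<in> ?N" for r x
    proof -
      have "a \<odot>\<^bsub>L\<^esub> (r \<odot>\<^bsub>L\<^esub> x) = r \<odot>\<^bsub>L\<^esub> (a \<odot>\<^bsub>L\<^esub> x)"
        using that a by (simp flip: L.smult_assoc1 add: m_comm)
      then show ?thesis using that E(4) by auto
    qed
  qed (use a E submodule_zero[OF assms(1) filt_submodule[OF assms(1)]] in \<open>auto simp: L.smult_r_minus L.smult_r_distr\<close>)
  moreover have "b \<odot>\<^bsub>L\<^esub> x \<in> ?N" if "b \<in> ideal_power R I l" "x \<in> carrier L" for b x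
    using that a power_carrier[of b l] ideal_smultI[OF power_mult[OF assms(2) that(1)] that(2), of R]
    by (simp add: L.smult_assoc1 filtration_def)
  ultimately have "filtration R I L l \<subseteq> ?N"
    unfolding filtration_def by (intro ideal_smult_least) auto
  then show ?thesis using assms(3) by blast
qed

text \<open>On a generator r x with r in I^i, the value f (r x) = r f x lies in I^i I^s N. This
  makes the induced map of degree s on associated graded modules well defined.\<close>

lemma filt_hom_shift:
  assumes "module R L" "module R N" "f \<in> module_hom R L N" "f ` carrier L \<subseteq> filtration R I N s"
    "x \<in> filtration R I L i"
  shows "f x \<in> filtration R I N (s + i)"
proof -
  have "f (r \<odot>\<^bsub>L\<^esub> x) \<in> filtration R I N (s + i)" if "r \<in> ideal_power R I i" "x \<in> carrier L" for r x
    using filt_smult[OF assms(2) that(1), of "f x" s] assms(4) that(2) module_homD(3)[OF assms(3), of r x] power_carrier[OF that(1)]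
    by (auto simp: add.commute)
  then have "filtration R I L i \<subseteq> {x \<in> carrier L. f x \<in> filtration R I N (s + i)}"
    unfolding filtration_def[of _ _ L]
    using module.smult_closed[OF assms(1)] power_carrier
    by (intro ideal_smult_least module_hom_vimage_submodule[OF assms(1-3) filt_submodule[OF assms(2)]]) auto
  then show ?thesis using assms(5) by auto
qed

lemma filt_hom_surj:
  assumes "module R L" "module R N" "f \<in> module_hom R L N" "f ` carrier L = carrier N"
  shows "f ` filtration R I L i = filtration R I N i"
  unfolding filtration_def by (rule ideal_smult_hom_surj[OF assms(1-3) _ assms(4)]) (auto intro: power_carrier)

lemma filt_self: "filtration R I (self_module R) i = ideal_power R I i"
proof
  have "submodule (ideal_power R I i) R (self_module R)"
    using submodule_self_module_iff[OF is_cring] power_ideal by simp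
  then show "filtration R I (self_module R) i \<subseteq> ideal_power R I i"
    unfolding filtration_def
    by (rule ideal_smult_least) (auto intro: ideal.I_r_closed[OF power_ideal])
  show "ideal_power R I i \<subseteq> filtration R I (self_module R) i"
    using ideal_smultI[of _ "ideal_power R I i" \<one> "self_module R" R] power_carrier
    by (auto simp: filtration_def)
qed

lemma filt_free: "filtration R I (free_module R n) i = {..<n} \<rightarrow>\<^sub>E ideal_power R I i"
  unfolding filtration_def by (rule ideal_smult_free[OF power_ideal])

section \<open>Representatives in the associated graded module\<close>

text \<open>An element of the associated graded module of \<open>L\<close> is the class \<open>cl L x\<close> of a sequence \<open>x\<close> with
  \<open>x i \<in> I\<^sup>iL\<close> of which all but finitely many terms lie in \<open>I\<^bsup>i+1\<^esup>L\<close>; the Cauchy product of cosets is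
  the class of the Cauchy product \<open>conv\<close> of representatives.\<close>

definition seq :: "('a, 'd, 'o) module_scheme \<Rightarrow> (nat \<Rightarrow> 'd) \<Rightarrow> bool" where
  "seq L x \<longleftrightarrow> (\<forall>i. x i \<in> filtration R I L i)"

definition fin_seq :: "('a, 'd, 'o) module_scheme \<Rightarrow> (nat \<Rightarrow> 'd) \<Rightarrow> bool" where
  "fin_seq L x \<longleftrightarrow> seq L x \<and> finite {i. x i \<notin> filtration R I L (Suc i)}"

definition cl :: "('a, 'd, 'o) module_scheme \<Rightarrow> (nat \<Rightarrow> 'd) \<Rightarrow> nat \<Rightarrow> 'd set" where
  "cl L x = (\<lambda>i. filtration R I L (Suc i) +>\<^bsub>L\<^esub> x i)"

definition conv :: "('a, 'd, 'o) module_scheme \<Rightarrow> (nat \<Rightarrow> 'a) \<Rightarrow> (nat \<Rightarrow> 'd) \<Rightarrow> nat \<Rightarrow> 'd" where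
  "conv L a x = (\<lambda>i. \<Oplus>\<^bsub>L\<^esub>k\<in>{..i}. a k \<odot>\<^bsub>L\<^esub> x (i - k))"

definition single :: "('a, 'd, 'o) module_scheme \<Rightarrow> nat \<Rightarrow> 'd \<Rightarrow> nat \<Rightarrow> 'd" where
  "single L s x = (\<lambda>i. if i = s then x else \<zero>\<^bsub>L\<^esub>)"

abbreviation gr :: "('a, 'd, 'o) module_scheme \<Rightarrow> (nat \<Rightarrow> 'a set, nat \<Rightarrow> 'd set) graded_module" where
  "gr \<equiv> gr_module R I"

abbreviation A :: "(nat \<Rightarrow> 'a set) graded_ring" where
  "A \<equiv> gr_ring R I"

abbreviation S :: "('a, 'a) module" where
  "S \<equiv> self_module R"

lemma S_module: "module R S" by (rule self_module_module[OF is_cring])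

lemma seqD: "seq L x \<Longrightarrow> x i \<in> filtration R I L i"
  by (simp add: seq_def)

lemma seq_carrier: "module R L \<Longrightarrow> seq L x \<Longrightarrow> x i \<in> carrier L"
  using filt_carrier seqD by metis

lemma seq_S_iff: "seq S a \<longleftrightarrow> (\<forall>i. a i \<in> ideal_power R I i)"
  by (simp add: seq_def filt_self)

lemma coset_eq_iff:
  assumes "module R L" "x \<in> carrier L" "y \<in> carrier L"
  shows "filtration R I L i +>\<^bsub>L\<^esub> x = filtration R I L i +>\<^bsub>L\<^esub> y \<longleftrightarrow> x \<ominus>\<^bsub>L\<^esub> y \<in> filtration R I L i"
proof -
  interpret L: module R L by fact
  interpret H: abelian_subgroup "filtration R I L i" L using filt_abelian_subgroup[OF assms(1)] .
  show ?thesis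
  proof
    assume "filtration R I L i +>\<^bsub>L\<^esub> x = filtration R I L i +>\<^bsub>L\<^esub> y"
    then have "x \<in> filtration R I L i +>\<^bsub>L\<^esub> y" using H.a_rcos_self[OF assms(2)] by simp
    then show "x \<ominus>\<^bsub>L\<^esub> y \<in> filtration R I L i" using H.a_rcos_module_imp assms by (simp add: L.minus_eq)
  next
    assume "x \<ominus>\<^bsub>L\<^esub> y \<in> filtration R I L i"
    then have "x \<in> filtration R I L i +>\<^bsub>L\<^esub> y" using H.a_rcos_module_rev[OF assms(3,2)] by (simp add: L.minus_eq)
    then show "filtration R I L i +>\<^bsub>L\<^esub> x = filtration R I L i +>\<^bsub>L\<^esub> y"
      using L.a_repr_independence[OF _ assms(3) H.a_subgroup] by simp
  qed
qed

lemma coset_eq_self_iff: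
  assumes "module R L" "x \<in> carrier L"
  shows "filtration R I L i +>\<^bsub>L\<^esub> x = filtration R I L i \<longleftrightarrow> x \<in> filtration R I L i"
proof -
  interpret L: module R L by fact
  interpret H: abelian_subgroup "filtration R I L i" L using filt_abelian_subgroup[OF assms(1)] .
  show ?thesis
    using assms L.a_coset_join1[OF _ _ H.a_subgroup] L.a_coset_join2[OF _ H.a_subgroup] H.a_subset by blast
qed

lemma coset_mem_iff:
  assumes "module R L" "x \<in> carrier L"
  shows "y \<in> filtration R I L i +>\<^bsub>L\<^esub> x \<longleftrightarrow> (\<exists>h\<in>filtration R I L i. y = h \<oplus>\<^bsub>L\<^esub> x)"
  by (auto simp: a_r_coset_def')

lemma cl_eq_iff:
  assumes "module R L" "seq L x" "seq L y"
  shows "cl L x = cl L y \<longleftrightarrow> (\<forall>i. x i \<ominus>\<^bsub>L\<^esub> y i \<in> filtration R I L (Suc i))"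
  unfolding cl_def fun_eq_iff using coset_eq_iff[OF assms(1)] seq_carrier[OF assms(1)] assms(2,3) by auto

lemma gr_carrier:
  assumes "module R L"
  shows "carrier (gr L) = cl L ` Collect (fin_seq L)"
proof
  show "cl L ` Collect (fin_seq L) \<subseteq> carrier (gr L)"
    using seq_carrier[OF assms]
    by (auto simp: gr_module_def Let_def gr_component_def cl_def fin_seq_def seqD coset_eq_self_iff[OF assms])
  show "carrier (gr L) \<subseteq> cl L ` Collect (fin_seq L)"
  proof
    fix f assume "f \<in> carrier (gr L)"
    then have f: "\<forall>i. \<exists>x\<in>filtration R I L i. f i = filtration R I L (Suc i) +>\<^bsub>L\<^esub> x" "finite {i. f i \<noteq> filtration R I L (Suc i)}"
      by (auto simp: gr_module_def Let_def gr_component_def)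
    from f(1) obtain x where x: "\<And>i. x i \<in> filtration R I L i" "\<And>i. f i = filtration R I L (Suc i) +>\<^bsub>L\<^esub> x i" by metis
    then have "seq L x" "f = cl L x" by (auto simp: seq_def cl_def)
    moreover have "finite {i. x i \<notin> filtration R I L (Suc i)}"
      using f(2) x coset_eq_self_iff[OF assms] filt_carrier[OF assms] by (metis (mono_tags, lifting) Collect_cong)
    ultimately show "f \<in> cl L ` Collect (fin_seq L)" by (auto simp: fin_seq_def)
  qed
qed

lemma gr_elem:
  assumes "module R L" "f \<in> carrier (gr L)"
  obtains x where "fin_seq L x" "seq L x" "f = cl L x"
  using assms(2) that unfolding gr_carrier[OF assms(1)] fin_seq_def by auto

lemma cl_closed: "module R L \<Longrightarrow> fin_seq L x \<Longrightarrow> cl L x \<in> carrier (gr L)"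
  using gr_carrier by auto

lemma fin_seq_seq: "fin_seq L x \<Longrightarrow> seq L x"
  by (simp add: fin_seq_def)

lemma seq_add: "module R L \<Longrightarrow> seq L x \<Longrightarrow> seq L y \<Longrightarrow> seq L (\<lambda>i. x i \<oplus>\<^bsub>L\<^esub> y i)"
  by (simp add: seq_def module.submoduleE(5)[OF _ filt_submodule])

lemma fin_seq_add:
  assumes "module R L" "fin_seq L x" "fin_seq L y"
  shows "fin_seq L (\<lambda>i. x i \<oplus>\<^bsub>L\<^esub> y i)"
proof -
  have "{i. x i \<oplus>\<^bsub>L\<^esub> y i \<notin> filtration R I L (Suc i)} \<subseteq> {i. x i \<notin> filtration R I L (Suc i)} \<union> {i. y i \<notin> filtration R I L (Suc i)}"
    using module.submoduleE(5)[OF assms(1) filt_submodule[OF assms(1)]] by auto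
  then show ?thesis
    using assms seq_add[OF assms(1)] by (auto simp: fin_seq_def intro: finite_subset)
qed

lemma seq_zero: "module R L \<Longrightarrow> seq L (\<lambda>i. \<zero>\<^bsub>L\<^esub>)"
  by (simp add: seq_def submodule_zero[OF _ filt_submodule])

lemma fin_seq_zero: "module R L \<Longrightarrow> fin_seq L (\<lambda>i. \<zero>\<^bsub>L\<^esub>)"
  by (simp add: fin_seq_def seq_zero submodule_zero[OF _ filt_submodule])

lemma gr_zero:
  assumes "module R L"
  shows "\<zero>\<^bsub>gr L\<^esub> = cl L (\<lambda>i. \<zero>\<^bsub>L\<^esub>)"
proof -
  interpret L: module R L by fact
  show ?thesis
    using coset_eq_self_iff[OF assms] submodule_zero[OF assms filt_submodule[OF assms]]
    by (auto simp: gr_module_def Let_def cl_def)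
qed

lemma gr_add:
  assumes "module R L" "seq L x" "seq L y"
  shows "cl L x \<oplus>\<^bsub>gr L\<^esub> cl L y = cl L (\<lambda>i. x i \<oplus>\<^bsub>L\<^esub> y i)"
proof -
  have "filtration R I L (Suc i) +>\<^bsub>L\<^esub> x i <+>\<^bsub>L\<^esub> (filtration R I L (Suc i) +>\<^bsub>L\<^esub> y i) = filtration R I L (Suc i) +>\<^bsub>L\<^esub> (x i \<oplus>\<^bsub>L\<^esub> y i)" for i
    using seq_carrier[OF assms(1)] assms(2,3)
    by (intro abelian_subgroup.a_rcos_sum[OF filt_abelian_subgroup[OF assms(1)]])
  then show ?thesis by (simp add: gr_module_def Let_def cl_def)
qed

text \<open>Well-definedness of the product: replacing a by h + a with h in I^(k+1) and x by g + x
  with g in I^(l+1) L changes a x by h (g + x) + a g, and both summands lie in I^(k+l+1) L.\<close>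

lemma coset_smult_cosets:
  assumes "module R L" "a \<in> ideal_power R I k" "x \<in> filtration R I L l"
  shows "coset_smult L (filtration R I L (Suc (k + l))) (filtration R I S (Suc k) +>\<^bsub>S\<^esub> a) (filtration R I L (Suc l) +>\<^bsub>L\<^esub> x)
    = filtration R I L (Suc (k + l)) +>\<^bsub>L\<^esub> (a \<odot>\<^bsub>L\<^esub> x)" (is "_ = ?H +>\<^bsub>L\<^esub> _")
proof -
  interpret L: module R L by fact
  have a: "a \<in> carrier R" using assms(2) by (rule power_carrier)
  have x: "x \<in> carrier L" using assms(1,3) by (rule filt_carrier)
  have eq: "?H +>\<^bsub>L\<^esub> (r \<odot>\<^bsub>L\<^esub> y) = ?H +>\<^bsub>L\<^esub> (a \<odot>\<^bsub>L\<^esub> x)"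
    if r: "r \<in> filtration R I S (Suc k) +>\<^bsub>S\<^esub> a" and y: "y \<in> filtration R I L (Suc l) +>\<^bsub>L\<^esub> x" for r y
  proof -
    obtain h where h: "h \<in> ideal_power R I (Suc k)" "r = h \<oplus> a"
      using r a coset_mem_iff[OF S_module, of a r] by (auto simp: filt_self simp del: ideal_power.simps)
    obtain g where g: "g \<in> filtration R I L (Suc l)" "y = g \<oplus>\<^bsub>L\<^esub> x"
      using y x coset_mem_iff[OF assms(1)] by auto
    have hc: "h \<in> carrier R" using h(1) by (rule power_carrier)
    have gc: "g \<in> carrier L" using assms(1) g(1) by (rule filt_carrier)
    have "g \<in> filtration R I L l" using g(1) filt_antimono[of l "Suc l" L] by auto
    then have "g \<oplus>\<^bsub>L\<^esub> x \<in> filtration R I L l"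
      using assms(3) L.submoduleE(5)[OF filt_submodule[OF assms(1)]] by blast
    then have 1: "h \<odot>\<^bsub>L\<^esub> (g \<oplus>\<^bsub>L\<^esub> x) \<in> ?H"
      using filt_smult[OF assms(1) h(1)] by force
    have 2: "a \<odot>\<^bsub>L\<^esub> g \<in> ?H" using filt_smult[OF assms(1,2) g(1)] by simp
    have "r \<odot>\<^bsub>L\<^esub> y \<ominus>\<^bsub>L\<^esub> a \<odot>\<^bsub>L\<^esub> x = h \<odot>\<^bsub>L\<^esub> (g \<oplus>\<^bsub>L\<^esub> x) \<oplus>\<^bsub>L\<^esub> a \<odot>\<^bsub>L\<^esub> g"
      using h g hc gc a x by (simp add: L.smult_l_distr L.smult_r_distr L.minus_eq L.a_assoc L.r_neg) (simp add: L.a_comm)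
    then have "r \<odot>\<^bsub>L\<^esub> y \<ominus>\<^bsub>L\<^esub> a \<odot>\<^bsub>L\<^esub> x \<in> ?H"
      using 1 2 L.submoduleE(5)[OF filt_submodule[OF assms(1)]] by auto
    then show ?thesis using coset_eq_iff[OF assms(1)] h g hc gc a x by auto
  qed
  moreover have "a \<in> filtration R I S (Suc k) +>\<^bsub>S\<^esub> a"
    using abelian_subgroup.a_rcos_self[OF filt_abelian_subgroup[OF S_module]] a by simp
  moreover have "x \<in> filtration R I L (Suc l) +>\<^bsub>L\<^esub> x"
    using abelian_subgroup.a_rcos_self[OF filt_abelian_subgroup[OF assms(1)]] x by simp
  ultimately show ?thesis unfolding coset_smult_def by blast
qed

text \<open>The projection to the quotient group respects finite sums; this turns the Cauchy product
  of cosets into the class of \<open>conv\<close>.\<close>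

lemma finprod_cosets:
  assumes "module R L" "finite K" "g \<in> K \<rightarrow> carrier L"
  shows "(\<Otimes>\<^bsub>L A_Mod filtration R I L i\<^esub>k\<in>K. filtration R I L i +>\<^bsub>L\<^esub> g k) = filtration R I L i +>\<^bsub>L\<^esub> (\<Oplus>\<^bsub>L\<^esub>k\<in>K. g k)"
proof -
  interpret L: module R L by fact
  interpret H: abelian_subgroup "filtration R I L i" L using filt_abelian_subgroup[OF assms(1)] .
  interpret Q: comm_group "L A_Mod filtration R I L i" by (rule H.a_factorgroup_is_comm_group)
  have c: "filtration R I L i +>\<^bsub>L\<^esub> y \<in> carrier (L A_Mod filtration R I L i)" if "y \<in> carrier L" for y
    using that H.a_subset by (auto simp: A_FactGroup_def' intro: L.a_rcosetsI)
  from assms(2,3) show ?thesis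
  proof (induction K)
    case empty
    show ?case
      using coset_eq_self_iff[OF assms(1), of "\<zero>\<^bsub>L\<^esub>" i] by (simp only: Q.finprod_empty) (simp add: A_FactGroup_def')
  next
    case (insert k K)
    then have "g \<in> K \<rightarrow> carrier L" "g k \<in> carrier L" by auto
    then show ?case
      using insert c by (subst Q.finprod_insert) (auto simp: L.finsum_insert H.a_rcos_sum)
  qed
qed

lemma conv_term:
  assumes "module R L" "seq S a" "seq L x" "k \<le> i"
  shows "a k \<odot>\<^bsub>L\<^esub> x (i - k) \<in> filtration R I L i"
  using filt_smult[OF assms(1) _ seqD[OF assms(3)], of "a k" k "i - k"] assms(2,4) by (auto simp: seq_S_iff)

lemma seq_conv:
  assumes "module R L" "seq S a" "seq L x"
  shows "seq L (conv L a x)"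
  unfolding seq_def conv_def
  by (intro allI submodule_finsum[OF assms(1) filt_submodule[OF assms(1)]] conv_term[OF assms]) auto

lemma gr_smult:
  assumes "module R L" "seq S a" "seq L x"
  shows "cl S a \<odot>\<^bsub>gr L\<^esub> cl L x = cl L (conv L a x)"
proof
  fix i
  interpret L: module R L by fact
  interpret H: abelian_subgroup "filtration R I L (Suc i)" L using filt_abelian_subgroup[OF assms(1)] .
  interpret Q: comm_group "L A_Mod filtration R I L (Suc i)" by (rule H.a_factorgroup_is_comm_group)
  have t: "a k \<odot>\<^bsub>L\<^esub> x (i - k) \<in> carrier L" if "k \<le> i" for k
    using conv_term[OF assms that] filt_carrier[OF assms(1)] by auto
  have c: "filtration R I L (Suc i) +>\<^bsub>L\<^esub> y \<in> carrier (L A_Mod filtration R I L (Suc i))" if "y \<in> carrier L" for y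
    using that H.a_subset by (auto simp: A_FactGroup_def' intro: L.a_rcosetsI)
  have "(cl S a \<odot>\<^bsub>gr L\<^esub> cl L x) i = (\<Otimes>\<^bsub>L A_Mod filtration R I L (Suc i)\<^esub>k\<in>{..i}. coset_smult L (filtration R I L (Suc i))
     (filtration R I S (Suc k) +>\<^bsub>S\<^esub> a k) (filtration R I L (Suc (i - k)) +>\<^bsub>L\<^esub> x (i - k)))"
    by (simp add: gr_module_def Let_def cl_def)
  also have "\<dots> = (\<Otimes>\<^bsub>L A_Mod filtration R I L (Suc i)\<^esub>k\<in>{..i}. filtration R I L (Suc i) +>\<^bsub>L\<^esub> (a k \<odot>\<^bsub>L\<^esub> x (i - k)))"
  proof (rule Q.finprod_cong')
    fix k assume "k \<in> {..i}"
    then show "coset_smult L (filtration R I L (Suc i)) (filtration R I S (Suc k) +>\<^bsub>S\<^esub> a k) (filtration R I L (Suc (i - k)) +>\<^bsub>L\<^esub> x (i - k))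
       = filtration R I L (Suc i) +>\<^bsub>L\<^esub> (a k \<odot>\<^bsub>L\<^esub> x (i - k))"
      using coset_smult_cosets[OF assms(1), of "a k" k "x (i - k)" "i - k"] assms(2) seqD[OF assms(3)]
      by (simp add: seq_S_iff)
  qed (use c t in auto)
  also have "\<dots> = cl L (conv L a x) i"
    using t by (subst finprod_cosets[OF assms(1)]) (auto simp: cl_def conv_def)
  finally show "(cl S a \<odot>\<^bsub>gr L\<^esub> cl L x) i = cl L (conv L a x) i" .
qed

lemma gr_class_eq:
  assumes "module R L" 
  shows "gr_class R I L s x = cl L (single L s x)"
proof -
  interpret L: module R L by fact
  show ?thesis
    using coset_eq_self_iff[OF assms, of "\<zero>\<^bsub>L\<^esub>"] submodule_zero[OF assms filt_submodule[OF assms]]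
    by (auto simp: gr_class_def cl_def single_def fun_eq_iff)
qed

lemma fin_seq_single:
  assumes "module R L" "x \<in> filtration R I L s"
  shows "fin_seq L (single L s x)"
  using assms submodule_zero[OF assms(1) filt_submodule[OF assms(1)]]
  by (auto simp: fin_seq_def seq_def single_def intro: finite_subset[of _ "{s}"])

lemma fin_seq_conv:
  assumes "module R L" "fin_seq S a" "fin_seq L x"
  shows "fin_seq L (conv L a x)"
proof -
  interpret L: module R L by fact
  let ?P = "{i. a i \<notin> filtration R I S (Suc i)}" and ?Q = "{i. x i \<notin> filtration R I L (Suc i)}"
  note sq = fin_seq_seq[OF assms(2)] fin_seq_seq[OF assms(3)]
  \<comment> \<open>If a product a_k x_(i-k) has nonzero class in degree i, both factors have
    nonzero classes in their own degrees. Hence the degrees with nonzero class lie in the sumset of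
    two finite sets.\<close>
  have "{i. conv L a x i \<notin> filtration R I L (Suc i)} \<subseteq> (\<lambda>(k, l). k + l) ` (?P \<times> ?Q)"
  proof
    fix i assume "i \<in> {i. conv L a x i \<notin> filtration R I L (Suc i)}"
    then have "\<exists>k\<le>i. a k \<odot>\<^bsub>L\<^esub> x (i - k) \<notin> filtration R I L (Suc i)"
      unfolding conv_def mem_Collect_eq
      by (rule contrapos_np) (auto intro: submodule_finsum[OF assms(1) filt_submodule[OF assms(1)]])
    then obtain k where k: "k \<le> i" "a k \<odot>\<^bsub>L\<^esub> x (i - k) \<notin> filtration R I L (Suc i)" by blast
    have "k \<in> ?P"
      using filt_smult[OF assms(1), of "a k" "Suc k" "x (i - k)" "i - k"] k seqD[OF sq(2)]
      by (auto simp: filt_self simp del: ideal_power.simps)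
    moreover have "i - k \<in> ?Q"
      using filt_smult[OF assms(1), of "a k" "k" "x (i - k)" "Suc (i - k)"] k sq(1)
      by (auto simp: seq_S_iff)
    ultimately show "i \<in> (\<lambda>(k, l). k + l) ` (?P \<times> ?Q)"
      using k(1) by (intro image_eqI[of _ _ "(k, i - k)"]) auto
  qed
  then show ?thesis
    using assms seq_conv[OF assms(1) sq] by (auto simp: fin_seq_def intro: finite_subset)
qed

end

section \<open>The associated graded ring and its modules\<close>

text \<open>This is the reindexing behind associativity of the Cauchy product. The induction splits
  off the antidiagonal k + l = Suc i.\<close>

lemma (in comm_monoid) finprod_triangle:
  assumes "\<And>k l. k + l \<le> i \<Longrightarrow> g k l \<in> carrier G"
  shows "(\<Otimes>k\<in>{..i}. \<Otimes>l\<in>{..k}. g l (k - l)) = (\<Otimes>l\<in>{..(i::nat)}. \<Otimes>m\<in>{..i - l}. g l m)"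
  using assms
proof (induction i)
  case 0
  then show ?case by simp
next
  case (Suc i)
  have "(\<Otimes>l\<in>{..Suc i}. \<Otimes>m\<in>{..Suc i - l}. g l m) = g (Suc i) 0 \<otimes> (\<Otimes>l\<in>{..i}. \<Otimes>m\<in>{..Suc i - l}. g l m)"
    using Suc.prems by (subst finprod_Suc) (auto intro!: finprod_closed)
  also have "(\<Otimes>l\<in>{..i}. \<Otimes>m\<in>{..Suc i - l}. g l m) = (\<Otimes>l\<in>{..i}. g l (Suc i - l) \<otimes> (\<Otimes>m\<in>{..i - l}. g l m))"
    using Suc.prems by (intro finprod_cong') (auto simp: Suc_diff_le intro!: finprod_closed finprod_Suc)
  also have "\<dots> = (\<Otimes>l\<in>{..i}. g l (Suc i - l)) \<otimes> (\<Otimes>l\<in>{..i}. \<Otimes>m\<in>{..i - l}. g l m)"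
    using Suc.prems by (intro finprod_multf) (auto intro!: finprod_closed)
  also have "g (Suc i) 0 \<otimes> \<dots> = (g (Suc i) 0 \<otimes> (\<Otimes>l\<in>{..i}. g l (Suc i - l))) \<otimes> (\<Otimes>l\<in>{..i}. \<Otimes>m\<in>{..i - l}. g l m)"
    using Suc.prems by (intro m_assoc[symmetric]) (auto intro!: finprod_closed)
  also have "g (Suc i) 0 \<otimes> (\<Otimes>l\<in>{..i}. g l (Suc i - l)) = (\<Otimes>l\<in>{..Suc i}. g l (Suc i - l))"
    using Suc.prems by (subst finprod_Suc) auto
  also have "(\<Otimes>l\<in>{..i}. \<Otimes>m\<in>{..i - l}. g l m) = (\<Otimes>k\<in>{..i}. \<Otimes>l\<in>{..k}. g l (k - l))"
    using Suc.prems by (intro Suc.IH[symmetric]) auto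
  also have "(\<Otimes>l\<in>{..Suc i}. g l (Suc i - l)) \<otimes> \<dots> = (\<Otimes>k\<in>{..Suc i}. \<Otimes>l\<in>{..k}. g l (k - l))"
    using Suc.prems by (subst finprod_Suc) (auto intro!: finprod_closed)
  finally show ?case by simp
qed

lemmas (in abelian_monoid) finsum_triangle = add.finprod_triangle

context adic
begin

lemma gr_ring_simps [simp]:
  "carrier A = carrier (gr S)" "monoid.mult A = smult (gr S)" "\<zero>\<^bsub>A\<^esub> = \<zero>\<^bsub>gr S\<^esub>" "add A = add (gr S)"
  "ring_grade A = grade (gr S)"
  by (simp_all add: gr_ring_def Let_def)

lemma gr_one: "\<one>\<^bsub>A\<^esub> = cl S (single S 0 \<one>)"
  using gr_class_eq[OF S_module, of 0 \<one>] by (simp add: gr_ring_def Let_def)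

lemma fin_seq_one: "fin_seq S (single S 0 \<one>)"
  by (rule fin_seq_single[OF S_module]) (simp add: filt_0[OF S_module])

lemma gr_abelian_group:
  assumes "module R L"
  shows "abelian_group (gr L)"
proof -
  interpret L: module R L by fact
  note C = seq_carrier[OF assms]
  show ?thesis
  proof (rule abelian_groupI)
    fix f g assume "f \<in> carrier (gr L)" "g \<in> carrier (gr L)"
    then obtain x y where x: "fin_seq L x" "seq L x" "f = cl L x" and y: "fin_seq L y" "seq L y" "g = cl L y"
      by (metis gr_elem[OF assms])
    show "f \<oplus>\<^bsub>gr L\<^esub> g \<in> carrier (gr L)"
      using x y by (simp add: gr_add[OF assms] cl_closed[OF assms] fin_seq_add[OF assms])
    show "f \<oplus>\<^bsub>gr L\<^esub> g = g \<oplus>\<^bsub>gr L\<^esub> f"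
      using x y C by (simp add: gr_add[OF assms] L.a_comm)
    fix h assume "h \<in> carrier (gr L)"
    then obtain z where z: "fin_seq L z" "seq L z" "h = cl L z" by (metis gr_elem[OF assms])
    show "f \<oplus>\<^bsub>gr L\<^esub> g \<oplus>\<^bsub>gr L\<^esub> h = f \<oplus>\<^bsub>gr L\<^esub> (g \<oplus>\<^bsub>gr L\<^esub> h)"
      using x y z C by (simp add: gr_add[OF assms] seq_add[OF assms] L.a_assoc)
  next
    show "\<zero>\<^bsub>gr L\<^esub> \<in> carrier (gr L)" by (simp add: gr_zero[OF assms] cl_closed[OF assms] fin_seq_zero[OF assms])
    fix f assume "f \<in> carrier (gr L)"
    then obtain x where x: "fin_seq L x" "seq L x" "f = cl L x" by (metis gr_elem[OF assms])
    show "\<zero>\<^bsub>gr L\<^esub> \<oplus>\<^bsub>gr L\<^esub> f = f"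
      using x C by (simp add: gr_zero[OF assms] gr_add[OF assms] seq_zero[OF assms])
    have n: "\<ominus>\<^bsub>L\<^esub> x i \<in> filtration R I L j \<longleftrightarrow> x i \<in> filtration R I L j" for i j
      using L.submoduleE(3)[OF filt_submodule[OF assms]] C[OF x(2)] by (metis L.minus_minus)
    then have "fin_seq L (\<lambda>i. \<ominus>\<^bsub>L\<^esub> x i)" using x by (simp add: fin_seq_def seq_def)
    moreover have "cl L (\<lambda>i. \<ominus>\<^bsub>L\<^esub> x i) \<oplus>\<^bsub>gr L\<^esub> f = \<zero>\<^bsub>gr L\<^esub>"
      using x C fin_seq_seq[OF calculation] by (simp add: gr_zero[OF assms] gr_add[OF assms] L.l_neg)
    ultimately show "\<exists>y\<in>carrier (gr L). y \<oplus>\<^bsub>gr L\<^esub> f = \<zero>\<^bsub>gr L\<^esub>" using cl_closed[OF assms] by blast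
  qed
qed

lemma conv_term_carrier:
  assumes "module R L" "seq S a" "seq L x"
  shows "a k \<odot>\<^bsub>L\<^esub> x l \<in> carrier L"
  using seq_carrier[OF assms(1,3)] seq_carrier[OF S_module assms(2)] module.smult_closed[OF assms(1)] by simp

lemma conv_assoc:
  assumes "module R L" "seq S a" "seq S b" "seq L x"
  shows "conv L (conv S a b) x = conv L a (conv L b x)"
proof
  fix i
  interpret L: module R L by fact
  interpret SM: module R S by (rule S_module)
  have aR: "a k \<in> carrier R" "b k \<in> carrier R" "x k \<in> carrier L" for k
    using seq_carrier[OF S_module assms(2)] seq_carrier[OF S_module assms(3)] seq_carrier[OF assms(1,4)] by auto
  have sum_S: "finsum S f K = finsum R f K" for f :: "nat \<Rightarrow> 'a" and K
    unfolding finsum_def finprod_def by simp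
  have l: "(\<Oplus>k\<in>K. f k) \<odot>\<^bsub>L\<^esub> y = (\<Oplus>\<^bsub>L\<^esub>k\<in>K. f k \<odot>\<^bsub>L\<^esub> y)" if "finite K" "f \<in> K \<rightarrow> carrier R" "y \<in> carrier L" for f :: "nat \<Rightarrow> 'a" and K y
    using that by (induction K) (auto simp: L.smult_l_distr Pi_iff)
  have "conv L (conv S a b) x i = (\<Oplus>\<^bsub>L\<^esub>k\<in>{..i}. \<Oplus>\<^bsub>L\<^esub>l\<in>{..k}. a l \<odot>\<^bsub>L\<^esub> (b (k - l) \<odot>\<^bsub>L\<^esub> x (i - l - (k - l))))"
    unfolding conv_def sum_S using aR
    by (intro L.finsum_cong') (auto simp: l L.smult_assoc1 intro!: L.finsum_cong' L.finsum_closed)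
  also have "\<dots> = (\<Oplus>\<^bsub>L\<^esub>l\<in>{..i}. \<Oplus>\<^bsub>L\<^esub>m\<in>{..i - l}. a l \<odot>\<^bsub>L\<^esub> (b m \<odot>\<^bsub>L\<^esub> x (i - l - m)))"
    using aR by (intro L.finsum_triangle[where g = "\<lambda>l m. a l \<odot>\<^bsub>L\<^esub> (b m \<odot>\<^bsub>L\<^esub> x (i - l - m))"]) auto
  also have "\<dots> = conv L a (conv L b x) i"
    unfolding conv_def using aR
    by (intro L.finsum_cong') (auto simp: L.finsum_smult_ldistr Pi_iff intro!: L.finsum_closed)
  finally show "conv L (conv S a b) x i = conv L a (conv L b x) i" .
qed

lemma conv_comm:
  assumes "seq S a" "seq S b"
  shows "conv S a b = conv S b a"
proof
  fix i :: nat
  interpret SM: module R S by (rule S_module)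
  have aR: "a k \<in> carrier R" "b k \<in> carrier R" for k
    using seq_carrier[OF S_module assms(1)] seq_carrier[OF S_module assms(2)] by auto
  have im: "{..i} = (-) i ` {..i}" 
    by (auto simp: image_iff) (metis atMost_iff diff_diff_cancel diff_le_self)
  have inj: "inj_on ((-) i) {..i}" by (auto simp: inj_on_def)
  have "conv S a b i = (\<Oplus>\<^bsub>S\<^esub>k\<in>((-) i ` {..i}). a k \<otimes> b (i - k))"
    unfolding conv_def by (subst im[symmetric]) simp
  also have "\<dots> = (\<Oplus>\<^bsub>S\<^esub>k\<in>{..i}. a (i - k) \<otimes> b (i - (i - k)))"
    using aR inj by (intro SM.finsum_reindex) auto
  also have "\<dots> = conv S b a i"
    unfolding conv_def using aR by (intro SM.finsum_cong') (auto simp: m_comm)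
  finally show "conv S a b i = conv S b a i" .
qed

lemma conv_add_left:
  assumes "module R L" "seq S a" "seq S b" "seq L x"
  shows "conv L (\<lambda>i. a i \<oplus> b i) x = (\<lambda>i. conv L a x i \<oplus>\<^bsub>L\<^esub> conv L b x i)"
proof
  fix i
  interpret L: module R L by fact
  have aR: "a k \<in> carrier R" "b k \<in> carrier R" "x k \<in> carrier L" for k
    using seq_carrier[OF S_module assms(2)] seq_carrier[OF S_module assms(3)] seq_carrier[OF assms(1,4)] by auto
  have "conv L (\<lambda>i. a i \<oplus> b i) x i = (\<Oplus>\<^bsub>L\<^esub>k\<in>{..i}. a k \<odot>\<^bsub>L\<^esub> x (i - k) \<oplus>\<^bsub>L\<^esub> b k \<odot>\<^bsub>L\<^esub> x (i - k))"
    unfolding conv_def using aR by (intro L.finsum_cong') (auto simp: L.smult_l_distr)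
  also have "\<dots> = conv L a x i \<oplus>\<^bsub>L\<^esub> conv L b x i"
    unfolding conv_def using aR by (intro L.finsum_addf) auto
  finally show "conv L (\<lambda>i. a i \<oplus> b i) x i = conv L a x i \<oplus>\<^bsub>L\<^esub> conv L b x i" .
qed

lemma conv_add_right:
  assumes "module R L" "seq S a" "seq L x" "seq L y"
  shows "conv L a (\<lambda>i. x i \<oplus>\<^bsub>L\<^esub> y i) = (\<lambda>i. conv L a x i \<oplus>\<^bsub>L\<^esub> conv L a y i)"
proof
  fix i
  interpret L: module R L by fact
  have aR: "a k \<in> carrier R" "y k \<in> carrier L" "x k \<in> carrier L" for k
    using seq_carrier[OF S_module assms(2)] seq_carrier[OF assms(1,3)] seq_carrier[OF assms(1,4)] by auto
  have "conv L a (\<lambda>i. x i \<oplus>\<^bsub>L\<^esub> y i) i = (\<Oplus>\<^bsub>L\<^esub>k\<in>{..i}. a k \<odot>\<^bsub>L\<^esub> x (i - k) \<oplus>\<^bsub>L\<^esub> a k \<odot>\<^bsub>L\<^esub> y (i - k))"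
    unfolding conv_def using aR by (intro L.finsum_cong') (auto simp: L.smult_r_distr)
  also have "\<dots> = conv L a x i \<oplus>\<^bsub>L\<^esub> conv L a y i"
    unfolding conv_def using aR by (intro L.finsum_addf) auto
  finally show "conv L a (\<lambda>i. x i \<oplus>\<^bsub>L\<^esub> y i) i = conv L a x i \<oplus>\<^bsub>L\<^esub> conv L a y i" .
qed

lemma conv_single_left:
  assumes "module R L" "r \<in> ideal_power R I s" "seq L x"
  shows "conv L (single S s r) x = (\<lambda>i. if i < s then \<zero>\<^bsub>L\<^esub> else r \<odot>\<^bsub>L\<^esub> x (i - s))"
proof
  fix i
  interpret L: module R L by fact
  have aR: "r \<in> carrier R" "x k \<in> carrier L" for k
    using power_carrier[OF assms(2)] seq_carrier[OF assms(1,3)] by auto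
  have "conv L (single S s r) x i = (\<Oplus>\<^bsub>L\<^esub>k\<in>{..i}. if s = k then r \<odot>\<^bsub>L\<^esub> x (i - k) else \<zero>\<^bsub>L\<^esub>)"
    unfolding conv_def using aR by (intro L.finsum_cong') (auto simp: single_def)
  also have "\<dots> = (if i < s then \<zero>\<^bsub>L\<^esub> else r \<odot>\<^bsub>L\<^esub> x (i - s))"
  proof (cases "i < s")
    case True
    then have "(\<Oplus>\<^bsub>L\<^esub>k\<in>{..i}. if s = k then r \<odot>\<^bsub>L\<^esub> x (i - k) else \<zero>\<^bsub>L\<^esub>) = (\<Oplus>\<^bsub>L\<^esub>k\<in>{..i}. \<zero>\<^bsub>L\<^esub>)"
      by (intro L.finsum_cong') auto
    then show ?thesis using True by simp
  next
    case False
    then show ?thesis using aR by (subst L.finsum_singleton) auto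
  qed
  finally show "conv L (single S s r) x i = (if i < s then \<zero>\<^bsub>L\<^esub> else r \<odot>\<^bsub>L\<^esub> x (i - s))" .
qed

lemma conv_single_right:
  assumes "module R L" "x \<in> filtration R I L s" "seq S a"
  shows "conv L a (single L s x) = (\<lambda>i. if i < s then \<zero>\<^bsub>L\<^esub> else a (i - s) \<odot>\<^bsub>L\<^esub> x)"
proof
  fix i
  interpret L: module R L by fact
  have aR: "a k \<in> carrier R" "x \<in> carrier L" for k
    using filt_carrier[OF assms(1,2)] seq_carrier[OF S_module assms(3)] by auto
  \<comment> \<open>The guard \<open>s \<le> i\<close> excludes a false match: for i < s the
    truncated difference i - s is 0 and would select k = 0.\<close>
  have "conv L a (single L s x) i = (\<Oplus>\<^bsub>L\<^esub>k\<in>{..i}. if i - s = k \<and> s \<le> i then a k \<odot>\<^bsub>L\<^esub> x else \<zero>\<^bsub>L\<^esub>)"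
    unfolding conv_def using aR by (intro L.finsum_cong') (auto simp: single_def)
  also have "\<dots> = (if i < s then \<zero>\<^bsub>L\<^esub> else a (i - s) \<odot>\<^bsub>L\<^esub> x)"
  proof (cases "i < s")
    case True
    then have "(\<Oplus>\<^bsub>L\<^esub>k\<in>{..i}. if i - s = k \<and> s \<le> i then a k \<odot>\<^bsub>L\<^esub> x else \<zero>\<^bsub>L\<^esub>) = (\<Oplus>\<^bsub>L\<^esub>k\<in>{..i}. \<zero>\<^bsub>L\<^esub>)"
      by (intro L.finsum_cong') auto
    then show ?thesis using True by simp
  next
    case False
    then have "(\<Oplus>\<^bsub>L\<^esub>k\<in>{..i}. if i - s = k \<and> s \<le> i then a k \<odot>\<^bsub>L\<^esub> x else \<zero>\<^bsub>L\<^esub>) = (\<Oplus>\<^bsub>L\<^esub>k\<in>{..i}. if i - s = k then a k \<odot>\<^bsub>L\<^esub> x else \<zero>\<^bsub>L\<^esub>)"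
      using aR by (intro L.finsum_cong') auto
    also have "\<dots> = a (i - s) \<odot>\<^bsub>L\<^esub> x"
      using aR by (intro L.finsum_singleton) auto
    finally show ?thesis using False by simp
  qed
  finally show "conv L a (single L s x) i = (if i < s then \<zero>\<^bsub>L\<^esub> else a (i - s) \<odot>\<^bsub>L\<^esub> x)" .
qed

lemma gr_smult_closed:
  assumes "module R L" "a \<in> carrier (gr S)" "u \<in> carrier (gr L)"
  shows "a \<odot>\<^bsub>gr L\<^esub> u \<in> carrier (gr L)"
proof -
  obtain r where r: "fin_seq S r" "seq S r" "a = cl S r" by (rule gr_elem[OF S_module assms(2)])
  obtain x where x: "fin_seq L x" "seq L x" "u = cl L x" by (rule gr_elem[OF assms(1,3)])
  show ?thesis using r x by (simp add: gr_smult[OF assms(1)] cl_closed[OF assms(1)] fin_seq_conv[OF assms(1)])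
qed

lemma gr_smult_l_distr:
  assumes "module R L" "a \<in> carrier (gr S)" "b \<in> carrier (gr S)" "u \<in> carrier (gr L)"
  shows "(a \<oplus>\<^bsub>gr S\<^esub> b) \<odot>\<^bsub>gr L\<^esub> u = a \<odot>\<^bsub>gr L\<^esub> u \<oplus>\<^bsub>gr L\<^esub> b \<odot>\<^bsub>gr L\<^esub> u"
proof -
  obtain r where r: "seq S r" "a = cl S r" by (rule gr_elem[OF S_module assms(2)])
  obtain s where s: "seq S s" "b = cl S s" by (rule gr_elem[OF S_module assms(3)])
  obtain x where x: "seq L x" "u = cl L x" by (rule gr_elem[OF assms(1,4)])
  show ?thesis
    using r s x conv_add_left[OF assms(1) r(1) s(1) x(1)] seq_add[OF S_module r(1) s(1)]
    by (simp add: gr_smult[OF assms(1)] gr_add[OF S_module] gr_add[OF assms(1)] seq_conv[OF assms(1)])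
qed

lemma gr_smult_r_distr:
  assumes "module R L" "a \<in> carrier (gr S)" "u \<in> carrier (gr L)" "v \<in> carrier (gr L)"
  shows "a \<odot>\<^bsub>gr L\<^esub> (u \<oplus>\<^bsub>gr L\<^esub> v) = a \<odot>\<^bsub>gr L\<^esub> u \<oplus>\<^bsub>gr L\<^esub> a \<odot>\<^bsub>gr L\<^esub> v"
proof -
  obtain r where r: "seq S r" "a = cl S r" by (rule gr_elem[OF S_module assms(2)])
  obtain x where x: "seq L x" "u = cl L x" by (rule gr_elem[OF assms(1,3)])
  obtain y where y: "seq L y" "v = cl L y" by (rule gr_elem[OF assms(1,4)])
  show ?thesis
    using r y x conv_add_right[OF assms(1) r(1) x(1) y(1)] seq_add[OF assms(1) x(1) y(1)]
    by (simp add: gr_smult[OF assms(1)] gr_add[OF assms(1)] seq_conv[OF assms(1)])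
qed

lemma gr_smult_assoc:
  assumes "module R L" "a \<in> carrier (gr S)" "b \<in> carrier (gr S)" "u \<in> carrier (gr L)"
  shows "(a \<odot>\<^bsub>gr S\<^esub> b) \<odot>\<^bsub>gr L\<^esub> u = a \<odot>\<^bsub>gr L\<^esub> (b \<odot>\<^bsub>gr L\<^esub> u)"
proof -
  obtain r where r: "seq S r" "a = cl S r" by (rule gr_elem[OF S_module assms(2)])
  obtain s where s: "seq S s" "b = cl S s" by (rule gr_elem[OF S_module assms(3)])
  obtain x where x: "seq L x" "u = cl L x" by (rule gr_elem[OF assms(1,4)])
  show ?thesis
    using r s x conv_assoc[OF assms(1) r(1) s(1) x(1)]
    by (simp add: gr_smult[OF assms(1)] gr_smult[OF S_module] seq_conv[OF assms(1)] seq_conv[OF S_module])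
qed

lemma gr_smult_comm:
  assumes "a \<in> carrier (gr S)" "b \<in> carrier (gr S)"
  shows "a \<odot>\<^bsub>gr S\<^esub> b = b \<odot>\<^bsub>gr S\<^esub> a"
proof -
  obtain r where r: "seq S r" "a = cl S r" by (rule gr_elem[OF S_module assms(1)])
  obtain s where s: "seq S s" "b = cl S s" by (rule gr_elem[OF S_module assms(2)])
  show ?thesis using r s conv_comm[OF r(1) s(1)] by (simp add: gr_smult[OF S_module])
qed

lemma gr_smult_one:
  assumes "module R L" "u \<in> carrier (gr L)"
  shows "\<one>\<^bsub>A\<^esub> \<odot>\<^bsub>gr L\<^esub> u = u"
proof -
  interpret L: module R L by fact
  obtain x where x: "seq L x" "u = cl L x" by (rule gr_elem[OF assms])
  have "conv L (single S 0 \<one>) x = x"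
    using conv_single_left[OF assms(1), of \<one> 0 x] x seq_carrier[OF assms(1)] by auto
  then show ?thesis using x fin_seq_seq[OF fin_seq_one] by (simp add: gr_smult[OF assms(1)] gr_one)
qed

lemma gr_cring: "cring A"
proof (rule cringI)
  show "abelian_group A"
    using abelian_groupE[OF gr_abelian_group[OF S_module]] by (intro abelian_groupI) simp_all
  have one: "\<one>\<^bsub>A\<^esub> \<in> carrier (gr S)" using cl_closed[OF S_module fin_seq_one] gr_one by simp
  show "comm_monoid A"
    using gr_smult_closed[OF S_module] gr_smult_assoc[OF S_module] gr_smult_comm gr_smult_one[OF S_module] one
    by (intro comm_monoidI) auto
qed (simp add: gr_smult_l_distr[OF S_module])

lemma gr_module_module:
  assumes "module R L"
  shows "module A (gr L)"
  using gr_smult_closed[OF assms] gr_smult_l_distr[OF assms] gr_smult_r_distr[OF assms]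
    gr_smult_assoc[OF assms] gr_smult_one[OF assms]
  by (intro moduleI gr_cring gr_abelian_group[OF assms]) simp_all

end

section \<open>Finite sums of classes\<close>

context adic
begin

lemma cl_cong:
  assumes "\<And>i. filtration R I L (Suc i) +>\<^bsub>L\<^esub> x i = filtration R I L (Suc i) +>\<^bsub>L\<^esub> y i"
  shows "cl L x = cl L y"
  using assms by (auto simp: cl_def)

text \<open>It allows a representative to be corrected term by term, as in
  \<open>gr_shift_kernel\<close>, without checking finiteness anew.\<close>

lemma fin_seq_cong:
  assumes "module R L" "fin_seq L x" "seq L y" "cl L x = cl L y"
  shows "fin_seq L y"
proof -
  have "{i. x i \<notin> filtration R I L (Suc i)} = {i. y i \<notin> filtration R I L (Suc i)}"
    using assms(4) coset_eq_self_iff[OF assms(1)] seq_carrier[OF assms(1,3)] seq_carrier[OF assms(1) fin_seq_seq[OF assms(2)]]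
    by (auto simp: cl_def fun_eq_iff) metis+
  then show ?thesis using assms by (simp add: fin_seq_def)
qed

lemma finsum_gr:
  assumes "module R L" "finite K" "\<And>k. k \<in> K \<Longrightarrow> fin_seq L (g k)"
  shows "(\<Oplus>\<^bsub>gr L\<^esub>k\<in>K. cl L (g k)) = cl L (\<lambda>i. \<Oplus>\<^bsub>L\<^esub>k\<in>K. g k i)"
    "fin_seq L (\<lambda>i. \<Oplus>\<^bsub>L\<^esub>k\<in>K. g k i)"
proof -
  interpret L: module R L by fact
  interpret G: module A "gr L" using gr_module_module[OF assms(1)] .
  have "(\<Oplus>\<^bsub>gr L\<^esub>k\<in>K. cl L (g k)) = cl L (\<lambda>i. \<Oplus>\<^bsub>L\<^esub>k\<in>K. g k i) \<and> fin_seq L (\<lambda>i. \<Oplus>\<^bsub>L\<^esub>k\<in>K. g k i)"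
    using assms(2,3)
  proof (induction K)
    case empty
    then show ?case by (simp add: gr_zero[OF assms(1)] fin_seq_zero[OF assms(1)])
  next
    case (insert k K)
    have c: "fin_seq L (g j) \<Longrightarrow> g j i \<in> carrier L" for i j using seq_carrier[OF assms(1)] fin_seq_seq by blast
    have eq: "(\<Oplus>\<^bsub>L\<^esub>k\<in>insert k K. g k i) = g k i \<oplus>\<^bsub>L\<^esub> (\<Oplus>\<^bsub>L\<^esub>k\<in>K. g k i)" for i
      using insert c by (intro L.finsum_insert) auto
    have "(\<Oplus>\<^bsub>gr L\<^esub>k\<in>insert k K. cl L (g k)) = cl L (g k) \<oplus>\<^bsub>gr L\<^esub> (\<Oplus>\<^bsub>gr L\<^esub>k\<in>K. cl L (g k))"
      using insert cl_closed[OF assms(1)] by (intro G.finsum_insert) auto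
    then show ?case
      using insert fin_seq_add[OF assms(1)] by (simp add: eq gr_add[OF assms(1)] fin_seq_seq)
  qed
  then show "(\<Oplus>\<^bsub>gr L\<^esub>k\<in>K. cl L (g k)) = cl L (\<lambda>i. \<Oplus>\<^bsub>L\<^esub>k\<in>K. g k i)"
    "fin_seq L (\<lambda>i. \<Oplus>\<^bsub>L\<^esub>k\<in>K. g k i)" by auto
qed

subsection \<open>Homogeneous components\<close>

lemma gr_grade: "grade (gr L) j = {f \<in> carrier (gr L). \<forall>i. int i \<noteq> j \<longrightarrow> f i = filtration R I L (Suc i)}"
  by (auto simp: gr_module_def Let_def)

lemma gr_zero_apply: "\<zero>\<^bsub>gr L\<^esub> i = filtration R I L (Suc i)"
  by (simp add: gr_module_def Let_def)

lemma grade_closed: "u \<in> grade (gr L) j \<Longrightarrow> u \<in> carrier (gr L)"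
  by (simp add: gr_grade)

lemma grade_zero: "module R L \<Longrightarrow> \<zero>\<^bsub>gr L\<^esub> \<in> grade (gr L) j"
  using abelian_groupE(2)[OF gr_abelian_group] by (auto simp: gr_grade gr_zero_apply)

lemma grade_neg: "u \<in> grade (gr L) j \<Longrightarrow> j < 0 \<Longrightarrow> u = \<zero>\<^bsub>gr L\<^esub>"
  by (auto simp: gr_grade gr_zero_apply fun_eq_iff)

lemma single_grade:
  assumes "module R L" "x \<in> filtration R I L s"
  shows "cl L (single L s x) \<in> grade (gr L) (int s)"
  using assms cl_closed[OF assms(1) fin_seq_single[OF assms]] coset_eq_self_iff[OF assms(1)]
    submodule_zero[OF assms(1) filt_submodule[OF assms(1)]] filt_carrier[OF assms(1)]
  by (auto simp: gr_grade cl_def single_def)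

lemma gr_zeroI:
  assumes "\<And>i. u i = filtration R I L (Suc i)"
  shows "u = \<zero>\<^bsub>gr L\<^esub>"
  using assms by (auto simp: gr_zero_apply fun_eq_iff)

lemma grade_elem:
  assumes "module R L" "u \<in> grade (gr L) (int s)"
  obtains x where "x \<in> filtration R I L s" "u = cl L (single L s x)"
proof -
  obtain x where x: "seq L x" "u = cl L x" using gr_elem[OF assms(1) grade_closed[OF assms(2)]] by metis
  have "u = cl L (single L s (x s))"
  proof
    fix i show "u i = cl L (single L s (x s)) i"
      using assms(2) x(2) submodule_zero[OF assms(1) filt_submodule[OF assms(1)]] filt_carrier[OF assms(1)]
        coset_eq_self_iff[OF assms(1), of "\<zero>\<^bsub>L\<^esub>" "Suc i"]
      by (cases "i = s") (auto simp: gr_grade cl_def single_def)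
  qed
  then show ?thesis using that seqD[OF x(1)] by blast
qed

subsection \<open>Shifted graded maps\<close>

text \<open>The map of degree s induced by an f with f L \<subseteq> I^s N. The case s = 0 is
  \<open>gr_map\<close>, and for a matrix of order s it is the initial form
  (\<open>initial_form_map_eq\<close>). So the augmentation and the differentials are covered by one
  exactness argument.\<close>

definition gr_shift :: "('a, 'e, 'q) module_scheme \<Rightarrow> nat \<Rightarrow> ('d \<Rightarrow> 'e) \<Rightarrow> (nat \<Rightarrow> 'd set) \<Rightarrow> nat \<Rightarrow> 'e set" where
  "gr_shift N s f u = (\<lambda>j. if j < s then filtration R I N (Suc j) else \<Union>x\<in>u (j - s). filtration R I N (Suc j) +>\<^bsub>N\<^esub> f x)"

definition shift_seq :: "('a, 'e, 'q) module_scheme \<Rightarrow> nat \<Rightarrow> (nat \<Rightarrow> 'e) \<Rightarrow> nat \<Rightarrow> 'e" where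
  "shift_seq N s x = (\<lambda>j. if j < s then \<zero>\<^bsub>N\<^esub> else x (j - s))"

lemma gr_shift_0: "gr_shift N 0 f u = gr_map R I N f u"
  by (simp add: gr_shift_def gr_map_def)

context
  fixes L :: "('a, 'd, 'o) module_scheme" and N :: "('a, 'e, 'q) module_scheme" and f s
  assumes L: "module R L" and N: "module R N" and f: "f \<in> module_hom R L N"
    and fs: "f ` carrier L \<subseteq> filtration R I N s"
begin

lemma fin_seq_shift:
  assumes "fin_seq L x"
  shows "fin_seq N (shift_seq N s (f \<circ> x))"
proof -
  note h = filt_hom_shift[OF L N f fs]
  have "f (x (i - s)) \<in> filtration R I N i" if "s \<le> i" for i
    using h[of "x (i - s)" "i - s"] seqD[OF fin_seq_seq[OF assms], of "i - s"] that by auto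
  then have sq: "seq N (shift_seq N s (f \<circ> x))"
    using submodule_zero[OF N filt_submodule[OF N]] by (auto simp: seq_def shift_seq_def)
  have "{i. shift_seq N s (f \<circ> x) i \<notin> filtration R I N (Suc i)} \<subseteq> (\<lambda>i. i + s) ` {i. x i \<notin> filtration R I L (Suc i)}"
  proof
    fix i assume i: "i \<in> {i. shift_seq N s (f \<circ> x) i \<notin> filtration R I N (Suc i)}"
    then have "s \<le> i" using submodule_zero[OF N filt_submodule[OF N]] by (auto simp: shift_seq_def split: if_splits)
    moreover have "x (i - s) \<notin> filtration R I L (Suc (i - s))"
      using h[of "x (i - s)" "Suc (i - s)"] i \<open>s \<le> i\<close> by (auto simp: shift_seq_def)
    ultimately show "i \<in> (\<lambda>i. i + s) ` {i. x i \<notin> filtration R I L (Suc i)}"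
      by (intro image_eqI[of _ _ "i - s"]) auto
  qed
  then show ?thesis using sq assms by (auto simp: fin_seq_def intro: finite_subset)
qed

text \<open>The union over a coset collapses to a single coset because f maps I^(i+1) L into
  I^(s+i+1) N.\<close>

lemma gr_shift_cl:
  assumes "seq L x"
  shows "gr_shift N s f (cl L x) = cl N (shift_seq N s (f \<circ> x))"
proof
  fix j
  interpret L: module R L by (rule L)
  interpret N: module R N by (rule N)
  note h = filt_hom_shift[OF L N f fs]
  show "gr_shift N s f (cl L x) j = cl N (shift_seq N s (f \<circ> x)) j"
  proof (cases "j < s")
    case True
    then show ?thesis
      using coset_eq_self_iff[OF N, of "\<zero>\<^bsub>N\<^esub>"] submodule_zero[OF N filt_submodule[OF N]]
      by (simp add: gr_shift_def cl_def shift_seq_def)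
  next
    case False
    have xc: "x (j - s) \<in> carrier L" by (rule seq_carrier[OF L assms])
    have "filtration R I N (Suc j) +>\<^bsub>N\<^esub> f y = filtration R I N (Suc j) +>\<^bsub>N\<^esub> f (x (j - s))"
      if y: "y \<in> filtration R I L (Suc (j - s)) +>\<^bsub>L\<^esub> x (j - s)" for y
    proof -
      obtain g where g: "g \<in> filtration R I L (Suc (j - s))" "y = g \<oplus>\<^bsub>L\<^esub> x (j - s)"
        using coset_mem_iff[OF L xc] y by blast
      have gc: "g \<in> carrier L" using filt_carrier[OF L g(1)] .
      have "f y \<ominus>\<^bsub>N\<^esub> f (x (j - s)) = f g"
        using g(2) gc xc module_homD[OF f] by (simp add: N.minus_eq N.a_assoc N.r_neg)
      moreover have "f g \<in> filtration R I N (Suc j)" using h[OF g(1)] False by auto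
      ultimately show ?thesis
        using coset_eq_iff[OF N, of "f y" "f (x (j - s))"] g(2) gc xc module_homD(1)[OF f] by simp
    qed
    moreover have "x (j - s) \<in> filtration R I L (Suc (j - s)) +>\<^bsub>L\<^esub> x (j - s)"
      using abelian_subgroup.a_rcos_self[OF filt_abelian_subgroup[OF L] xc] .
    ultimately have "(\<Union>y\<in>filtration R I L (Suc (j - s)) +>\<^bsub>L\<^esub> x (j - s). filtration R I N (Suc j) +>\<^bsub>N\<^esub> f y)
       = filtration R I N (Suc j) +>\<^bsub>N\<^esub> f (x (j - s))" by blast
    then show ?thesis using False by (simp add: gr_shift_def cl_def shift_seq_def)
  qed
qed

lemma gr_shift_hom: "gr_shift N s f \<in> module_hom A (gr L) (gr N)"
proof (rule module_homI)
  interpret L: module R L by (rule L)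
  interpret N: module R N by (rule N)
  fix u assume "u \<in> carrier (gr L)"
  then obtain x where x: "fin_seq L x" "seq L x" "u = cl L x" by (rule gr_elem[OF L])
  show "gr_shift N s f u \<in> carrier (gr N)" using x cl_closed[OF N fin_seq_shift] by (simp add: gr_shift_cl)
  note sx = fin_seq_seq[OF fin_seq_shift[OF x(1)]]
  { fix v assume "v \<in> carrier (gr L)"
    then obtain y where y: "fin_seq L y" "seq L y" "v = cl L y" by (rule gr_elem[OF L])
    have "shift_seq N s (f \<circ> (\<lambda>i. x i \<oplus>\<^bsub>L\<^esub> y i)) = (\<lambda>i. shift_seq N s (f \<circ> x) i \<oplus>\<^bsub>N\<^esub> shift_seq N s (f \<circ> y) i)"
      using module_homD(2)[OF f] seq_carrier[OF L x(2)] seq_carrier[OF L y(2)] by (auto simp: shift_seq_def)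
    then show "gr_shift N s f (u \<oplus>\<^bsub>gr L\<^esub> v) = gr_shift N s f u \<oplus>\<^bsub>gr N\<^esub> gr_shift N s f v"
      using x y sx fin_seq_seq[OF fin_seq_shift[OF y(1)]]
      by (simp add: gr_add[OF L] gr_add[OF N] gr_shift_cl seq_add[OF L]) }
  fix a assume "a \<in> carrier A"
  then obtain r where r: "fin_seq S r" "seq S r" "a = cl S r" using gr_elem[OF S_module] by auto
  have rc: "r k \<in> carrier R" for k using seq_carrier[OF S_module r(2)] by simp
  have xc: "x k \<in> carrier L" for k using seq_carrier[OF L x(2)] by simp
  have "shift_seq N s (f \<circ> conv L r x) = conv N r (shift_seq N s (f \<circ> x))"
  proof
    fix j
    show "shift_seq N s (f \<circ> conv L r x) j = conv N r (shift_seq N s (f \<circ> x)) j"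
    proof (cases "j < s")
      case True
      then have "conv N r (shift_seq N s (f \<circ> x)) j = (\<Oplus>\<^bsub>N\<^esub>k\<in>{..j}. \<zero>\<^bsub>N\<^esub>)"
        unfolding conv_def using rc by (intro N.finsum_cong') (auto simp: shift_seq_def)
      then show ?thesis using True by (simp add: shift_seq_def)
    next
      case False
      have "shift_seq N s (f \<circ> conv L r x) j = (\<Oplus>\<^bsub>N\<^esub>k\<in>{..j - s}. f (r k \<odot>\<^bsub>L\<^esub> x (j - s - k)))"
        using False rc xc unfolding shift_seq_def conv_def
        by (simp add: module_hom_finsum[OF L N f] comp_def Pi_iff)
      also have "\<dots> = (\<Oplus>\<^bsub>N\<^esub>k\<in>{..j - s}. r k \<odot>\<^bsub>N\<^esub> shift_seq N s (f \<circ> x) (j - k))"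
        using False rc xc module_homD[OF f]
        by (intro N.finsum_cong') (auto simp: shift_seq_def add.commute)
      \<comment> \<open>The added terms, with j - s < k, vanish: there j - k < s, where the shifted
        sequence is zero.\<close>
      also have "\<dots> = (\<Oplus>\<^bsub>N\<^esub>k\<in>{..j}. r k \<odot>\<^bsub>N\<^esub> shift_seq N s (f \<circ> x) (j - k))"
        using False rc xc module_homD[OF f]
        by (intro N.add.finprod_mono_neutral_cong_left) (auto simp: shift_seq_def)
      finally show ?thesis by (simp add: conv_def)
    qed
  qed
  then show "gr_shift N s f (a \<odot>\<^bsub>gr L\<^esub> u) = a \<odot>\<^bsub>gr N\<^esub> gr_shift N s f u"
    using x r sx by (simp add: gr_smult[OF L] gr_smult[OF N] gr_shift_cl seq_conv[OF L])
qed

lemma gr_shift_grade: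
  assumes "u \<in> grade (gr L) j"
  shows "gr_shift N s f u \<in> grade (gr N) (j + int s)"
proof (cases "j < 0")
  \<comment> \<open>Degrees are integers while representatives are indexed by natural numbers; the
    components of negative degree are zero.\<close>
  case True
  then have "u = \<zero>\<^bsub>gr L\<^esub>" using assms grade_neg by blast
  then have "gr_shift N s f u = \<zero>\<^bsub>gr N\<^esub>"
    using module_hom_zero[OF gr_module_module[OF L] gr_module_module[OF N] gr_shift_hom] by simp
  then show ?thesis using grade_zero[OF N] by simp
next
  case False
  then obtain t where t: "j = int t" using nonneg_int_cases[of j] by auto
  then obtain x where x: "x \<in> filtration R I L t" "u = cl L (single L t x)" using grade_elem[OF L] assms by metis
  have "shift_seq N s (f \<circ> single L t x) = single N (s + t) (f x)"
    using module_hom_zero[OF L N f] by (auto simp: shift_seq_def single_def fun_eq_iff)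
  then have "gr_shift N s f u = cl N (single N (s + t) (f x))"
    using x gr_shift_cl[OF fin_seq_seq[OF fin_seq_single[OF L x(1)]]] by simp
  then show ?thesis
    using single_grade[OF N filt_hom_shift[OF L N f fs x(1)]] by (simp add: t add.commute)
qed

end

subsection \<open>Initial modules and strict maps\<close>

text \<open>The graded submodule whose component of degree i is the image of Z \<inter> I^i L in I^i
  L / I^(i+1) L, that is, the associated graded module of Z for the filtration induced from
  L.\<close>

definition initial_module :: "('a, 'd, 'o) module_scheme \<Rightarrow> 'd set \<Rightarrow> (nat \<Rightarrow> 'd set) set" where
  "initial_module L Z = cl L ` {x. fin_seq L x \<and> (\<forall>i. x i \<in> Z)}"

text \<open>For such a map, f (I^i L) = f L \<inter> I^(s+i) N: on the image, the filtration induced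
  from N is the one coming from L, moved by s. Only the inclusion that can fail is demanded; the
  other is \<open>filt_hom_shift\<close>.\<close>

definition strict_hom :: "('a, 'd, 'o) module_scheme \<Rightarrow> ('a, 'e, 'q) module_scheme \<Rightarrow> nat \<Rightarrow> ('d \<Rightarrow> 'e) \<Rightarrow> bool" where
  "strict_hom L N s f \<longleftrightarrow> f \<in> module_hom R L N \<and> f ` carrier L \<subseteq> filtration R I N s \<and>
     (\<forall>i. f ` carrier L \<inter> filtration R I N (s + i) \<subseteq> f ` filtration R I L i)"

text \<open>If the class of f (x i) vanishes, strictness gives y i in I^(i+1) L with f (x i) = f (y
  i). Then x i - y i lies in the kernel of f and has the same class as x i.\<close>

lemma gr_shift_kernel:
  assumes L: "module R L" and N: "module R N" and f: "strict_hom L N s f"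
  shows "{u \<in> carrier (gr L). gr_shift N s f u = \<zero>\<^bsub>gr N\<^esub>} = initial_module L {x \<in> carrier L. f x = \<zero>\<^bsub>N\<^esub>}"
proof -
  interpret L: module R L by (rule L)
  interpret N: module R N by (rule N)
  have fh: "f \<in> module_hom R L N" and fs: "f ` carrier L \<subseteq> filtration R I N s"
    and st: "\<And>i. f ` carrier L \<inter> filtration R I N (s + i) \<subseteq> f ` filtration R I L i"
    using f by (auto simp: strict_hom_def)
  show ?thesis
  proof (intro equalityI subsetI)
    fix u assume "u \<in> {u \<in> carrier (gr L). gr_shift N s f u = \<zero>\<^bsub>gr N\<^esub>}"
    then obtain x where x: "fin_seq L x" "seq L x" "u = cl L x" and z: "gr_shift N s f u = \<zero>\<^bsub>gr N\<^esub>"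
      using gr_elem[OF L] by auto
    note xc = seq_carrier[OF L x(2)]
    have "\<exists>y\<in>filtration R I L (Suc i). f (x i) = f y" for i
    proof -
      have "filtration R I N (Suc (s + i)) +>\<^bsub>N\<^esub> f (x i) = filtration R I N (Suc (s + i))"
        using fun_cong[OF z, of "s + i"] x(3) gr_shift_cl[OF L N fh fs x(2)] by (simp add: cl_def shift_seq_def gr_zero_apply)
      then have "f (x i) \<in> filtration R I N (s + Suc i)"
        using coset_eq_self_iff[OF N] module_homD(1)[OF fh xc] by simp
      then show ?thesis using st[of "Suc i"] xc by auto
    qed
    then obtain y where y: "\<And>i. y i \<in> filtration R I L (Suc i)" "\<And>i. f (x i) = f (y i)" by metis
    have yc: "y i \<in> carrier L" for i using filt_carrier[OF L y(1)] .
    let ?x = "\<lambda>i. x i \<ominus>\<^bsub>L\<^esub> y i"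
    have yF: "y i \<in> filtration R I L i" for i using y(1) filt_antimono[of i "Suc i" L] by auto
    have sq: "seq L ?x"
      using submodule_minus[OF L filt_submodule[OF L] seqD[OF x(2)] yF] by (auto simp: seq_def)
    have "x i \<ominus>\<^bsub>L\<^esub> ?x i = y i" for i
      using xc yc by (simp add: L.minus_eq L.minus_add L.a_assoc[symmetric] L.r_neg)
    then have eq: "cl L x = cl L ?x" using cl_eq_iff[OF L x(2) sq] y(1) by simp
    have "f (?x i) = \<zero>\<^bsub>N\<^esub>" for i
      using y(2)[of i] module_homD(1)[OF fh yc] by (simp add: module_hom_minus[OF L N fh xc yc] N.minus_eq N.r_neg)
    then show "u \<in> initial_module L {x \<in> carrier L. f x = \<zero>\<^bsub>N\<^esub>}"
      using x(3) eq fin_seq_cong[OF L x(1) sq eq] xc yc by (auto simp: initial_module_def)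
  next
    fix u assume "u \<in> initial_module L {x \<in> carrier L. f x = \<zero>\<^bsub>N\<^esub>}"
    then obtain x where x: "fin_seq L x" "\<And>i. f (x i) = \<zero>\<^bsub>N\<^esub>" "u = cl L x" by (auto simp: initial_module_def)
    have "shift_seq N s (f \<circ> x) = (\<lambda>i. \<zero>\<^bsub>N\<^esub>)" using x(2) by (auto simp: shift_seq_def)
    then show "u \<in> {u \<in> carrier (gr L). gr_shift N s f u = \<zero>\<^bsub>gr N\<^esub>}"
      using x cl_closed[OF L x(1)] gr_shift_cl[OF L N fh fs fin_seq_seq[OF x(1)]] by (simp add: gr_zero[OF N])
  qed
qed

lemma gr_shift_image:
  assumes L: "module R L" and N: "module R N" and f: "strict_hom L N s f"
  shows "gr_shift N s f ` carrier (gr L) = initial_module N (f ` carrier L)"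
proof -
  interpret L: module R L by (rule L)
  interpret N: module R N by (rule N)
  have fh: "f \<in> module_hom R L N" and fs: "f ` carrier L \<subseteq> filtration R I N s"
    and st: "\<And>i. f ` carrier L \<inter> filtration R I N (s + i) \<subseteq> f ` filtration R I L i"
    using f by (auto simp: strict_hom_def)
  show ?thesis
  proof (intro equalityI subsetI)
    fix w assume "w \<in> gr_shift N s f ` carrier (gr L)"
    then obtain u where "u \<in> carrier (gr L)" "w = gr_shift N s f u" by auto
    then obtain x where x: "fin_seq L x" "seq L x" "w = gr_shift N s f (cl L x)" using gr_elem[OF L] by metis
    have "\<zero>\<^bsub>N\<^esub> \<in> f ` carrier L" using module_hom_zero[OF L N fh] L.zero_closed by (metis imageI)
    then have "shift_seq N s (f \<circ> x) i \<in> f ` carrier L" for i using seq_carrier[OF L x(2)] by (auto simp: shift_seq_def)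
    then show "w \<in> initial_module N (f ` carrier L)"
      using x gr_shift_cl[OF L N fh fs x(2)] fin_seq_shift[OF L N fh fs x(1)] by (auto simp: initial_module_def)
  next
    fix w assume "w \<in> initial_module N (f ` carrier L)"
    then obtain z where z: "fin_seq N z" "\<And>i. z i \<in> f ` carrier L" "w = cl N z" by (auto simp: initial_module_def)
    have zF: "z i \<in> filtration R I N i" for i using seqD[OF fin_seq_seq[OF z(1)]] .
    have zc: "z i \<in> carrier N" for i using filt_carrier[OF N zF] .
    \<comment> \<open>Where the class of z (s + i) is zero, y i is taken to be 0 instead of a
      preimage; this keeps the sequence of preimages finite.\<close>
    have "\<exists>y\<in>filtration R I L i. (z (s + i) \<in> filtration R I N (Suc (s + i)) \<longrightarrow> y = \<zero>\<^bsub>L\<^esub>) \<and>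
        (z (s + i) \<notin> filtration R I N (Suc (s + i)) \<longrightarrow> z (s + i) = f y)" for i
    proof (cases "z (s + i) \<in> filtration R I N (Suc (s + i))")
      case True
      then show ?thesis using submodule_zero[OF L filt_submodule[OF L]] by (intro bexI[of _ "\<zero>\<^bsub>L\<^esub>"]) auto
    next
      case False
      have "z (s + i) \<in> f ` filtration R I L i" using st[of i] z(2)[of "s + i"] zF[of "s + i"] by blast
      then show ?thesis using False by auto
    qed
    then obtain y where y: "\<And>i. y i \<in> filtration R I L i"
      "\<And>i. z (s + i) \<in> filtration R I N (Suc (s + i)) \<Longrightarrow> y i = \<zero>\<^bsub>L\<^esub>"
      "\<And>i. z (s + i) \<notin> filtration R I N (Suc (s + i)) \<Longrightarrow> z (s + i) = f (y i)" by metis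
    have "finite ((\<lambda>i. i + s) -` {i. z i \<notin> filtration R I N (Suc i)})"
      using z(1) by (intro finite_vimageI) (auto simp: fin_seq_def)
    moreover have "{i. y i \<notin> filtration R I L (Suc i)} \<subseteq> (\<lambda>i. i + s) -` {i. z i \<notin> filtration R I N (Suc i)}"
    proof
      fix i assume i: "i \<in> {i. y i \<notin> filtration R I L (Suc i)}"
      have "z (s + i) \<notin> filtration R I N (Suc (s + i))"
      proof
        assume "z (s + i) \<in> filtration R I N (Suc (s + i))"
        then have "y i = \<zero>\<^bsub>L\<^esub>" by (rule y(2))
        then show False using i submodule_zero[OF L filt_submodule[OF L], of "Suc i"] by simp
      qed
      then show "i \<in> (\<lambda>i. i + s) -` {i. z i \<notin> filtration R I N (Suc i)}" by (simp add: add.commute)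
    qed
    ultimately have fy: "fin_seq L y" using y(1) by (auto simp: fin_seq_def seq_def intro: finite_subset)
    have "cl N (shift_seq N s (f \<circ> y)) = cl N z"
    proof (rule cl_cong)
      fix i
      show "filtration R I N (Suc i) +>\<^bsub>N\<^esub> shift_seq N s (f \<circ> y) i = filtration R I N (Suc i) +>\<^bsub>N\<^esub> z i"
      proof (cases "i < s")
        case True
        \<comment> \<open>Nothing is lost below degree s: the image of f lies in I^s N, so all
          classes there are zero.\<close>
        then have "z i \<in> filtration R I N (Suc i)" using z(2) fs filt_antimono[of "Suc i" s N] by auto
        then have "filtration R I N (Suc i) +>\<^bsub>N\<^esub> z i = filtration R I N (Suc i)"
          using coset_eq_self_iff[OF N zc] by simp
        then show ?thesis
          using True coset_eq_self_iff[OF N N.zero_closed] submodule_zero[OF N filt_submodule[OF N]]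
          by (simp add: shift_seq_def)
      next
        case False
        then obtain k where k: "i = s + k" using le_Suc_ex by (metis not_less)
        show ?thesis
        proof (cases "z i \<in> filtration R I N (Suc i)")
          case True
          then have "f (y k) = \<zero>\<^bsub>N\<^esub>" using y(2)[of k] k module_hom_zero[OF L N fh] by simp
          moreover have "filtration R I N (Suc i) +>\<^bsub>N\<^esub> z i = filtration R I N (Suc i)"
            using True coset_eq_self_iff[OF N zc] by simp
          ultimately show ?thesis
            using k coset_eq_self_iff[OF N N.zero_closed] submodule_zero[OF N filt_submodule[OF N]]
            by (simp add: shift_seq_def)
        next
          case False
          then show ?thesis using y(3)[of k] k by (simp add: shift_seq_def)
        qed
      qed
    qed
    then show "w \<in> gr_shift N s f ` carrier (gr L)"
      using z(3) gr_shift_cl[OF L N fh fs fin_seq_seq[OF fy]] cl_closed[OF L fy] by (metis imageI)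
  qed
qed

text \<open>Minimality over R in graded form: a submodule of I L has no initial forms of degree 0.
  Its counterpart over A is \<open>irrelevant_smult_homog\<close>.\<close>

lemma initial_module_grade_0:
  assumes L: "module R L" and Z: "Z \<subseteq> filtration R I L 1" and u: "u \<in> initial_module L Z" "u \<in> grade (gr L) 0"
  shows "u = \<zero>\<^bsub>gr L\<^esub>"
proof (rule gr_zeroI)
  fix i
  obtain x where x: "fin_seq L x" "\<And>i. x i \<in> Z" "u = cl L x" using u(1) by (auto simp: initial_module_def)
  show "u i = filtration R I L (Suc i)"
  proof (cases "i = 0")
    case True
    have "x 0 \<in> filtration R I L (Suc 0)" using x(2) Z by auto
    then show ?thesis using True x(3) coset_eq_self_iff[OF L] filt_carrier[OF L] by (simp add: cl_def)
  next
    case False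
    then show ?thesis using u(2) by (simp add: gr_grade)
  qed
qed

end

section \<open>Transport of graded free resolutions\<close>

text \<open>Linearity of g' is inherited through the surjection h. In this way the maps of the
  complex of initial forms are recognized as linear from a commuting square alone.\<close>

lemma module_hom_transport:
  assumes "module R P" "module R Q" "h \<in> module_hom R P Q" "h ` carrier P = carrier Q"
    "g \<in> module_hom R P N" "\<And>x. x \<in> carrier P \<Longrightarrow> g' (h x) = g x"
  shows "g' \<in> module_hom R Q N"
proof -
  interpret P: module R P by fact
  note h = module_homD[OF assms(3)] and g = module_homD[OF assms(5)]
  show ?thesis
  proof (rule module_homI)
    fix u assume "u \<in> carrier Q"
    then obtain x where x: "x \<in> carrier P" "u = h x" using assms(4) by auto
    show "g' u \<in> carrier N" using x g assms(6) by simp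
    { fix v assume "v \<in> carrier Q"
      then obtain y where y: "y \<in> carrier P" "v = h y" using assms(4) by auto
      show "g' (u \<oplus>\<^bsub>Q\<^esub> v) = g' u \<oplus>\<^bsub>N\<^esub> g' v"
        using x y assms(6)[of "x \<oplus>\<^bsub>P\<^esub> y"] by (simp add: h g assms(6)) }
    fix r assume r: "r \<in> carrier R"
    show "g' (r \<odot>\<^bsub>Q\<^esub> u) = r \<odot>\<^bsub>N\<^esub> g' u"
      using x r assms(6)[of "r \<odot>\<^bsub>P\<^esub> x"] by (simp add: h g assms(6))
  qed
qed

text \<open>The maps d' and e' are only required to commute with h. Their linearity, degrees,
  exactness and minimality all follow, since h is bijective on the modules and on their components.
  Both directions of the equivalence end with this lemma.\<close>

lemma minimal_graded_free_resolution_transport: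
  assumes P: "minimal_graded_free_resolution A L P d e"
    and irr: "irrelevant_ideal A \<subseteq> carrier A"
    and Q: "\<And>p. module A (Q p)"
    and h: "\<And>p. h p \<in> module_hom A (P p) (Q p)" "\<And>p. bij_betw (h p) (carrier (P p)) (carrier (Q p))"
      "\<And>p j. h p ` grade (P p) j = grade (Q p) j"
    and gr: "\<And>p j. grade (P p) j \<subseteq> carrier (P p)"
    and d': "\<And>p x. x \<in> carrier (P (Suc p)) \<Longrightarrow> d' (Suc p) (h (Suc p) x) = h p (d (Suc p) x)"
    and e': "\<And>x. x \<in> carrier (P 0) \<Longrightarrow> e' (h 0 x) = e x"
  shows "minimal_graded_free_resolution A L Q d' e'"
proof -
  have free: "is_graded_free A (P p)" and dg: "d (Suc p) \<in> graded_hom A (P (Suc p)) (P p)"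
    and eg: "e \<in> graded_hom A (P 0) L" and res: "resolution A L P d e"
    and min: "d (Suc p) ` carrier (P (Suc p)) \<subseteq> ideal_smult A (irrelevant_ideal A) (P p)" for p
    using P by (auto simp: minimal_graded_free_resolution_def)
  have mP: "module A (P p)" for p using free[of p] by (simp add: is_graded_free_def)
  have dh: "d (Suc p) \<in> module_hom A (P (Suc p)) (P p)" and eh: "e \<in> module_hom A (P 0) L" for p
    using dg eg by (auto simp: graded_hom_def)
  have hs: "h p ` carrier (P p) = carrier (Q p)" and hi: "inj_on (h p) (carrier (P p))" for p
    using h(2)[of p] by (auto simp: bij_betw_def)
  have d'h: "d' (Suc p) \<in> module_hom A (Q (Suc p)) (Q p)" for p
    by (rule module_hom_transport[OF mP Q h(1) hs module_hom_comp[OF dh h(1)]]) (simp add: d')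
  have e'h: "e' \<in> module_hom A (Q 0) L"
    by (rule module_hom_transport[OF mP Q h(1) hs eh]) (simp add: e')
  have img: "d' (Suc p) ` carrier (Q (Suc p)) = h p ` d (Suc p) ` carrier (P (Suc p))" for p
    unfolding hs[symmetric] image_image by (rule image_cong) (auto simp: d')
  have h0: "h p x = \<zero>\<^bsub>Q p\<^esub> \<longleftrightarrow> x = \<zero>\<^bsub>P p\<^esub>" if "x \<in> carrier (P p)" for p x
    using module_hom_zero[OF mP Q h(1)[of p]] inj_onD[OF hi[of p] _ that]
      abelian_groupE(2)[OF module.axioms(2)[OF mP[of p]]] by metis
  have ker: "a_kernel (Q (Suc p)) (Q p) (d' (Suc p)) = h (Suc p) ` a_kernel (P (Suc p)) (P p) (d (Suc p))" for p
    using h0 module_homD(1)[OF dh] by (force simp: a_kernel_def' hs[symmetric] d')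
  have ker0: "a_kernel (Q 0) L e' = h 0 ` a_kernel (P 0) L e"
    by (auto simp: a_kernel_def' hs[symmetric] e')
  have "is_graded_free A (Q p)" for p
  proof -
    obtain n b f where f: "f \<in> graded_hom A (graded_free A n b) (P p)"
      "bij_betw f (carrier (graded_free A n b)) (carrier (P p))"
      "\<And>j. f ` grade (graded_free A n b) j = grade (P p) j"
      using free[of p] unfolding is_graded_free_def by blast
    have fg: "(h p \<circ> f) ` grade (graded_free A n b) j = grade (Q p) j" for j
      using f(3)[of j] h(3)[of p j] by (metis image_comp)
    moreover have "h p \<circ> f \<in> module_hom A (graded_free A n b) (Q p)"
      using f(1) by (intro module_hom_comp[OF _ h(1)]) (simp add: graded_hom_def)
    ultimately show ?thesis
      unfolding is_graded_free_def graded_hom_def using Q bij_betw_trans[OF f(2) h(2)] by blast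
  qed
  moreover have "d' (Suc p) \<in> graded_hom A (Q (Suc p)) (Q p)" for p
  proof -
    have "d' (Suc p) ` grade (Q (Suc p)) j \<subseteq> grade (Q p) j" for j
    proof -
      have "d' (Suc p) ` h (Suc p) ` grade (P (Suc p)) j = h p ` d (Suc p) ` grade (P (Suc p)) j"
        unfolding image_image by (rule image_cong[OF refl d'[OF subsetD[OF gr]]])
      also have "\<dots> \<subseteq> h p ` grade (P p) j" using dg[of p] by (auto simp: graded_hom_def)
      finally show ?thesis by (simp add: h(3))
    qed
    then show ?thesis using d'h by (simp add: graded_hom_def)
  qed
  moreover have "e' \<in> graded_hom A (Q 0) L"
  proof -
    have "e' ` h 0 ` grade (P 0) j = e ` grade (P 0) j" for j
      unfolding image_image by (rule image_cong[OF refl e'[OF subsetD[OF gr]]])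
    then show ?thesis using e'h eg by (auto simp: graded_hom_def h(3))
  qed
  moreover have "resolution A L Q d' e'"
    unfolding resolution_def
  proof (intro conjI allI)
    show "e' ` carrier (Q 0) = carrier L"
    proof -
      have "e' ` h 0 ` carrier (P 0) = e ` carrier (P 0)" unfolding image_image by (intro image_cong) (auto simp: e')
      then show ?thesis using res by (simp add: hs resolution_def)
    qed
    show "a_kernel (Q 0) L e' = d' 1 ` carrier (Q 1)"
      using res img[of 0] by (simp add: ker0 resolution_def)
    show "a_kernel (Q (Suc p)) (Q p) (d' (Suc p)) = d' (Suc (Suc p)) ` carrier (Q (Suc (Suc p)))" for p
      using res img[of "Suc p"] by (simp add: ker resolution_def)
  qed (fact d'h e'h)+
  moreover have "d' (Suc p) ` carrier (Q (Suc p)) \<subseteq> ideal_smult A (irrelevant_ideal A) (Q p)" for p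
    unfolding img using image_mono[OF min[of p], of "h p"] ideal_smult_hom[OF mP Q h(1) irr, of p] by blast
  ultimately show ?thesis by (simp add: minimal_graded_free_resolution_def)
qed

context adic
begin

section \<open>Coordinates of the associated graded module of a free module\<close>

abbreviation F :: "nat \<Rightarrow> ('a, nat \<Rightarrow> 'a) module" where
  "F \<equiv> free_module R"

lemma F_module: "module R (F n)" by (rule free_module_module[OF is_cring])

lemma AF_module: "module A (free_module A n)" by (rule free_module_module[OF gr_cring])

lemma finsum_S: "finsum S f K = finsum R f K"
  unfolding finsum_def finprod_def by simp

lemma finsum_A: "finsum A f K = finsum (gr S) f K"
  unfolding finsum_def finprod_def by simp

lemma coset_free:
  assumes "x \<in> carrier (F n)"
  shows "filtration R I (F n) i +>\<^bsub>F n\<^esub> x = (\<Pi>\<^sub>E k\<in>{..<n}. filtration R I S i +>\<^bsub>S\<^esub> x k)"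
proof (intro equalityI subsetI)
  fix y assume "y \<in> filtration R I (F n) i +>\<^bsub>F n\<^esub> x"
  then obtain h where h: "h \<in> filtration R I (F n) i" "y = h \<oplus>\<^bsub>F n\<^esub> x" using coset_mem_iff[OF F_module assms] by blast
  then show "y \<in> (\<Pi>\<^sub>E k\<in>{..<n}. filtration R I S i +>\<^bsub>S\<^esub> x k)"
    using coset_mem_iff[OF S_module, of "x _"] assms by (auto simp: filt_free filt_self PiE_iff)
next
  fix y assume y: "y \<in> (\<Pi>\<^sub>E k\<in>{..<n}. filtration R I S i +>\<^bsub>S\<^esub> x k)"
  then have "\<forall>k\<in>{..<n}. \<exists>h\<in>ideal_power R I i. y k = h \<oplus> x k"
    using coset_mem_iff[OF S_module, of "x _"] assms by (auto simp: filt_self PiE_iff)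
  then obtain h where h: "\<And>k. k < n \<Longrightarrow> h k \<in> ideal_power R I i" "\<And>k. k < n \<Longrightarrow> y k = h k \<oplus> x k"
    by (metis lessThan_iff)
  have "restrict h {..<n} \<in> filtration R I (F n) i" "y = restrict h {..<n} \<oplus>\<^bsub>F n\<^esub> x"
    using h y by (auto simp: filt_free fun_eq_iff PiE_iff extensional_def)
  then show "y \<in> filtration R I (F n) i +>\<^bsub>F n\<^esub> x" using coset_mem_iff[OF F_module assms] by blast
qed

text \<open>A transposition: coordinates in A^n give a vector of sequences, whereas the associated
  graded module of R^n is represented by sequences of vectors.\<close>

definition vec :: "nat \<Rightarrow> (nat \<Rightarrow> nat \<Rightarrow> 'a) \<Rightarrow> nat \<Rightarrow> nat \<Rightarrow> 'a" where
  "vec n y = (\<lambda>i. \<lambda>k\<in>{..<n}. y k i)"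

lemma seq_vec: "seq (F n) (vec n y) \<longleftrightarrow> (\<forall>k<n. seq S (y k))"
  by (auto simp: seq_def vec_def filt_free filt_self)

lemma fin_seq_vec: "fin_seq (F n) (vec n y) \<longleftrightarrow> (\<forall>k<n. fin_seq S (y k))"
proof -
  have "{i. vec n y i \<notin> filtration R I (F n) (Suc i)} = (\<Union>k\<in>{..<n}. {i. y k i \<notin> filtration R I S (Suc i)})"
    by (auto simp: vec_def filt_free filt_self)
  then show ?thesis by (auto simp: fin_seq_def seq_vec)
qed

lemma seq_F_vec: "seq (F n) x \<Longrightarrow> x = vec n (\<lambda>k i. x i k)"
  by (auto simp: seq_def vec_def filt_free fun_eq_iff PiE_iff extensional_def)

lemma gr_of_coords_cl:
  assumes "\<And>k. k < n \<Longrightarrow> seq S (y k)"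
  shows "gr_of_coords n (\<lambda>k\<in>{..<n}. cl S (y k)) = cl (F n) (vec n y)"
proof
  fix i
  have c: "vec n y i \<in> carrier (F n)" using seq_carrier[OF F_module, of n "vec n y" i] assms by (simp add: seq_vec)
  show "gr_of_coords n (\<lambda>k\<in>{..<n}. cl S (y k)) i = cl (F n) (vec n y) i"
    using coset_free[OF c, of "Suc i"] unfolding gr_of_coords_def cl_def
    by (auto simp: vec_def intro!: PiE_cong)
qed

lemma gr_coords_cl:
  assumes "seq (F n) x"
  shows "gr_coords n (cl (F n) x) = (\<lambda>k\<in>{..<n}. cl S (\<lambda>i. x i k))"
proof -
  have "(\<lambda>z. z k) ` cl (F n) x i = cl S (\<lambda>i. x i k) i" if k: "k < n" for i k
  proof -
    have c: "x i \<in> carrier (F n)" by (rule seq_carrier[OF F_module assms])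
    have "x i k \<in> carrier S" if "k < n" for k using c that by auto
    \<comment> \<open>A product of sets projects onto a factor only when the other factors are
      nonempty.\<close>
    then have ne: "filtration R I S (Suc i) +>\<^bsub>S\<^esub> x i k \<noteq> {}" if "k < n" for k
      using that abelian_subgroup.a_rcos_self[OF filt_abelian_subgroup[OF S_module]] by blast
    have "(\<lambda>z. z k) ` (\<Pi>\<^sub>E k\<in>{..<n}. filtration R I S (Suc i) +>\<^bsub>S\<^esub> x i k) = filtration R I S (Suc i) +>\<^bsub>S\<^esub> x i k"
      using k ne by (subst image_projection_PiE) (auto simp: PiE_eq_empty_iff)
    then show ?thesis by (simp only: cl_def coset_free[OF c])
  qed
  then show ?thesis by (auto simp: gr_coords_def fun_eq_iff)
qed

lemma free_A_elem:
  assumes "v \<in> carrier (free_module A n)"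
  obtains y where "\<forall>k<n. fin_seq S (y k)" "\<forall>k<n. seq S (y k)" "v = (\<lambda>k\<in>{..<n}. cl S (y k))"
proof -
  define y where "y k = (SOME y. fin_seq S y \<and> v k = cl S y)" for k
  have y: "fin_seq S (y k) \<and> v k = cl S (y k)" if "k < n" for k
  proof -
    have "v k \<in> carrier (gr S)" using assms that by auto
    then obtain z where z: "fin_seq S z" "seq S z" "v k = cl S z" by (rule gr_elem[OF S_module])
    show ?thesis unfolding y_def by (rule someI[of _ z]) (use z in simp)
  qed
  have "v = (\<lambda>k\<in>{..<n}. cl S (y k))" using assms y by (auto simp: fun_eq_iff PiE_iff extensional_def)
  then show ?thesis using that[of y] y fin_seq_seq by blast
qed

lemma gr_coords_of_coords:
  assumes "v \<in> carrier (free_module A n)"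
  shows "gr_coords n (gr_of_coords n v) = v"
proof -
  obtain y where y: "\<forall>k<n. fin_seq S (y k)" "\<forall>k<n. seq S (y k)" "v = (\<lambda>k\<in>{..<n}. cl S (y k))" by (rule free_A_elem[OF assms])
  then have "gr_coords n (gr_of_coords n v) = (\<lambda>k\<in>{..<n}. cl S (\<lambda>i. vec n y i k))"
    by (simp add: gr_of_coords_cl gr_coords_cl seq_vec)
  also have "\<dots> = v" using y(3) by (auto simp: vec_def)
  finally show ?thesis .
qed

lemma gr_of_coords_coords:
  assumes "u \<in> carrier (gr (F n))"
  shows "gr_of_coords n (gr_coords n u) = u" "gr_coords n u \<in> carrier (free_module A n)"
proof -
  obtain x where x: "fin_seq (F n) x" "seq (F n) x" "u = cl (F n) x" by (rule gr_elem[OF F_module assms])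
  let ?y = "\<lambda>k i. x i k"
  have xv: "x = vec n ?y" by (rule seq_F_vec[OF x(2)])
  have y: "\<And>k. k < n \<Longrightarrow> fin_seq S (?y k)" using x(1) fin_seq_vec[of n ?y] xv by simp
  then show "gr_of_coords n (gr_coords n u) = u"
    using xv x(3) by (simp add: gr_coords_cl[OF x(2)] gr_of_coords_cl fin_seq_seq)
  show "gr_coords n u \<in> carrier (free_module A n)"
    using y x(3) by (auto simp: gr_coords_cl[OF x(2)] cl_closed[OF S_module])
qed

lemma gr_of_coords_bij: "bij_betw (gr_of_coords n) (carrier (free_module A n)) (carrier (gr (F n)))"
proof (rule bij_betwI[where g = "gr_coords n"])
  show "gr_of_coords n \<in> carrier (free_module A n) \<rightarrow> carrier (gr (F n))"
  proof
    fix v assume "v \<in> carrier (free_module A n)"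
    then obtain y where y: "\<forall>k<n. fin_seq S (y k)" "\<forall>k<n. seq S (y k)" "v = (\<lambda>k\<in>{..<n}. cl S (y k))"
      by (rule free_A_elem)
    then show "gr_of_coords n v \<in> carrier (gr (F n))"
      by (simp add: gr_of_coords_cl cl_closed[OF F_module] fin_seq_vec)
  qed
qed (use gr_coords_of_coords gr_of_coords_coords in blast)+

lemma gr_of_coords_hom: "gr_of_coords n \<in> module_hom A (free_module A n) (gr (F n))"
proof (rule module_homI)
  fix v assume v: "v \<in> carrier (free_module A n)"
  then obtain y where y: "\<forall>k<n. fin_seq S (y k)" "\<forall>k<n. seq S (y k)" "v = (\<lambda>k\<in>{..<n}. cl S (y k))"
    by (rule free_A_elem)
  show "gr_of_coords n v \<in> carrier (gr (F n))" using bij_betwE[OF gr_of_coords_bij] v by blast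
  { fix w assume "w \<in> carrier (free_module A n)"
    then obtain z where z: "\<forall>k<n. fin_seq S (z k)" "\<forall>k<n. seq S (z k)" "w = (\<lambda>k\<in>{..<n}. cl S (z k))"
      by (rule free_A_elem)
    have 1: "v \<oplus>\<^bsub>free_module A n\<^esub> w = (\<lambda>k\<in>{..<n}. cl S (\<lambda>i. y k i \<oplus> z k i))"
      using y(2) z(2) unfolding y(3) z(3) free_module_simps by (intro restrict_ext) (simp add: gr_add[OF S_module])
    have 2: "vec n (\<lambda>k i. y k i \<oplus> z k i) = (\<lambda>i. vec n y i \<oplus>\<^bsub>F n\<^esub> vec n z i)"
      by (auto simp: vec_def fun_eq_iff)
    show "gr_of_coords n (v \<oplus>\<^bsub>free_module A n\<^esub> w) = gr_of_coords n v \<oplus>\<^bsub>gr (F n)\<^esub> gr_of_coords n w"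
      unfolding 1 using y z seq_add[OF S_module, of "y _" "z _"]
      by (simp add: gr_of_coords_cl gr_add[OF F_module] seq_vec 2 del: free_module_simps) }
  fix a assume "a \<in> carrier A"
  then obtain r where r: "seq S r" "a = cl S r" using gr_elem[OF S_module] by auto
  have 1: "a \<odot>\<^bsub>free_module A n\<^esub> v = (\<lambda>k\<in>{..<n}. cl S (conv S r (y k)))"
    using y(2) r(1) unfolding y(3) r(2) free_module_simps by (intro restrict_ext) (simp add: gr_smult[OF S_module])
  have 2: "vec n (\<lambda>k. conv S r (y k)) = conv (F n) r (vec n y)"
  proof
    fix i
    have c: "r l \<odot>\<^bsub>F n\<^esub> vec n y m \<in> carrier (F n)" for l m
      using y(2) by (intro conv_term_carrier[OF F_module r(1)]) (simp add: seq_vec)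
    then have "conv (F n) r (vec n y) i = (\<lambda>k\<in>{..<n}. \<Oplus>l\<in>{..i}. (r l \<odot>\<^bsub>F n\<^esub> vec n y (i - l)) k)"
      unfolding conv_def by (intro finsum_free_module[OF is_cring]) auto
    also have "\<dots> = vec n (\<lambda>k. conv S r (y k)) i"
      using seq_carrier[OF S_module r(1)] seq_carrier[OF S_module y(2)[rule_format]]
      by (auto simp: vec_def conv_def finsum_S fun_eq_iff intro!: finsum_cong')
    finally show "vec n (\<lambda>k. conv S r (y k)) i = conv (F n) r (vec n y) i" by simp
  qed
  show "gr_of_coords n (a \<odot>\<^bsub>free_module A n\<^esub> v) = a \<odot>\<^bsub>gr (F n)\<^esub> gr_of_coords n v"
    unfolding 1 using y r seq_conv[OF S_module r(1)]
    by (simp add: gr_of_coords_cl gr_smult[OF F_module] seq_vec 2)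
qed

lemma gr_of_coords_grade: "gr_of_coords n ` (\<Pi>\<^sub>E k\<in>{..<n}. grade (gr S) j) = grade (gr (F n)) j"
proof (intro equalityI subsetI)
  fix u assume "u \<in> gr_of_coords n ` (\<Pi>\<^sub>E k\<in>{..<n}. grade (gr S) j)"
  then obtain v where v: "v \<in> (\<Pi>\<^sub>E k\<in>{..<n}. grade (gr S) j)" "u = gr_of_coords n v" by auto
  then have "v \<in> carrier (free_module A n)" using grade_closed by (fastforce simp: PiE_iff)
  then have "u \<in> carrier (gr (F n))" using bij_betwE[OF gr_of_coords_bij] v(2) by blast
  moreover have "u i = filtration R I (F n) (Suc i)" if "int i \<noteq> j" for i
    using v that by (auto simp: gr_of_coords_def filt_free gr_grade filt_self PiE_iff)
  ultimately show "u \<in> grade (gr (F n)) j" by (simp add: gr_grade)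
next
  fix u assume u: "u \<in> grade (gr (F n)) j"
  then have c: "u \<in> carrier (gr (F n))" by (rule grade_closed)
  define v where "v = gr_coords n u"
  have v: "gr_of_coords n v = u" "v \<in> carrier (free_module A n)" using gr_of_coords_coords[OF c] by (auto simp: v_def)
  have "v k i = filtration R I S (Suc i)" if "int i \<noteq> j" "k < n" for k i
  proof -
    have "u i = filtration R I (F n) (Suc i)" using u that by (auto simp: gr_grade)
    then have "(\<lambda>z. z k) ` u i = ideal_power R I (Suc i)"
      using that power_ideal[of "Suc i"] 
      by (simp add: filt_free image_projection_PiE PiE_eq_empty_iff del: ideal_power.simps)
    then show ?thesis using that by (simp add: v_def gr_coords_def filt_self)
  qed
  then have "v \<in> (\<Pi>\<^sub>E k\<in>{..<n}. grade (gr S) j)" using v(2) by (auto simp: PiE_iff gr_grade)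
  then show "u \<in> gr_of_coords n ` (\<Pi>\<^sub>E k\<in>{..<n}. grade (gr S) j)" using v(1) by blast
qed

text \<open>The class of a i j in degree s times the class of x_j in degree t is the class of a i j
  x_j in degree s + t. The entries are assumed to lie in I^s because the greatest element defining
  \<open>matrix_order\<close> need not exist, as for a zero matrix with entries; strictness later
  provides this.\<close>

lemma initial_form_map_eq:
  assumes a: "\<And>i j. i < n \<Longrightarrow> j < m \<Longrightarrow> a i j \<in> ideal_power R I (matrix_order R I n m a)"
    and u: "u \<in> carrier (gr (F m))"
  shows "initial_form_map R I n m a u = gr_shift (F n) (matrix_order R I n m a) (matrix_map R n m a) u"
proof -
  define s where "s = matrix_order R I n m a"
  note a = a[folded s_def]
  obtain x where x: "fin_seq (F m) x" "seq (F m) x" "u = cl (F m) x" by (rule gr_elem[OF F_module u])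
  let ?y = "\<lambda>k i. x i k"
  have xv: "x = vec m ?y" by (rule seq_F_vec[OF x(2)])
  have y: "\<And>k. k < m \<Longrightarrow> fin_seq S (?y k)" using x(1) fin_seq_vec[of m ?y] xv by simp
  have ac: "i < n \<Longrightarrow> j < m \<Longrightarrow> a i j \<in> carrier R" for i j using power_carrier[OF a] .
  have yc: "k < m \<Longrightarrow> x i k \<in> carrier R" for i k using seq_carrier[OF S_module fin_seq_seq[OF y]] by simp
  have fs: "matrix_map R n m a ` carrier (F m) \<subseteq> filtration R I (F n) s"
    using a power_ideal[of s] ideal.I_r_closed[OF power_ideal]
    by (auto simp: matrix_map_def filt_free PiE_iff intro!: submodule_finsum[OF S_module, of "ideal_power R I s", unfolded finsum_S] 
       simp: submodule_self_module_iff[OF is_cring])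
  \<comment> \<open>This represents the product of the initial form of a i j with the j-th
    coordinate: the coordinate is delayed by s places.\<close>
  define p where "p i j = (\<lambda>t. if t < s then \<zero> else a i j \<otimes> x (t - s) j)" for i j
  have p: "conv S (single S s (a i j)) (?y j) = p i j" if "i < n" "j < m" for i j
    using conv_single_left[OF S_module a[OF that] fin_seq_seq[OF y[OF that(2)]]] by (auto simp: p_def fun_eq_iff)
  have fp: "fin_seq S (p i j)" if "i < n" "j < m" for i j
    using fin_seq_conv[OF S_module fin_seq_single[OF S_module] y[OF that(2)], of "a i j" s] a[OF that] p[OF that]
    by (simp add: filt_self)
  have q: "(\<Oplus>\<^bsub>A\<^esub>j\<in>{..<m}. initial_form R I n m a i j \<otimes>\<^bsub>A\<^esub> gr_coords m u j) = cl S (\<lambda>t. \<Oplus>j\<in>{..<m}. p i j t)"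
     "fin_seq S (\<lambda>t. \<Oplus>j\<in>{..<m}. p i j t)" if i: "i < n" for i
  proof -
    interpret G: module A "gr S" by (rule gr_module_module[OF S_module])
    have "(\<Oplus>\<^bsub>A\<^esub>j\<in>{..<m}. initial_form R I n m a i j \<otimes>\<^bsub>A\<^esub> gr_coords m u j) = (\<Oplus>\<^bsub>gr S\<^esub>j\<in>{..<m}. cl S (p i j))"
      unfolding finsum_A
    proof (rule G.finsum_cong')
      fix j assume "j \<in> {..<m}"
      then have j: "j < m" by simp
      have "seq S (single S s (a i j))" using fin_seq_seq[OF fin_seq_single[OF S_module]] a[OF i j] by (simp add: filt_self)
      then show "initial_form R I n m a i j \<otimes>\<^bsub>A\<^esub> gr_coords m u j = cl S (p i j)"
        using j p[OF i j] fin_seq_seq[OF y[OF j]]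
        by (simp add: initial_form_def gr_class_eq[OF S_module] s_def[symmetric] x(3) gr_coords_cl[OF x(2)] gr_smult[OF S_module])
    qed (use fp i cl_closed[OF S_module] in auto)
    then show "(\<Oplus>\<^bsub>A\<^esub>j\<in>{..<m}. initial_form R I n m a i j \<otimes>\<^bsub>A\<^esub> gr_coords m u j) = cl S (\<lambda>t. \<Oplus>j\<in>{..<m}. p i j t)"
       "fin_seq S (\<lambda>t. \<Oplus>j\<in>{..<m}. p i j t)"
      using finsum_gr[OF S_module, of "{..<m}" "p i"] fp[OF i] by (auto simp: finsum_S)
  qed
  have "matrix_map A n m (initial_form R I n m a) (gr_coords m u) = (\<lambda>i\<in>{..<n}. cl S (\<lambda>t. \<Oplus>j\<in>{..<m}. p i j t))"
    unfolding matrix_map_def using q(1) by (auto simp: fun_eq_iff)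
  then have "initial_form_map R I n m a u = cl (F n) (vec n (\<lambda>i t. \<Oplus>j\<in>{..<m}. p i j t))"
    using q(2) by (simp add: initial_form_map_def gr_of_coords_cl fin_seq_seq)
  also have "vec n (\<lambda>i t. \<Oplus>j\<in>{..<m}. p i j t) = shift_seq (F n) s (matrix_map R n m a \<circ> x)"
    using yc ac by (auto simp: vec_def p_def shift_seq_def matrix_map_def fun_eq_iff intro!: finsum_cong')
  also have "cl (F n) \<dots> = gr_shift (F n) s (matrix_map R n m a) u"
    unfolding x(3) by (rule gr_shift_cl[OF F_module F_module matrix_map_hom[OF is_cring ac] fs x(2), symmetric])
  finally show ?thesis by (simp add: s_def)
qed

end

section \<open>Submodules of a free module over a Noetherian local ring\<close>

lemma submodule_sum:
  assumes "module R M" "submodule C R M" "submodule D R M"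
  shows "submodule (C <+>\<^bsub>M\<^esub> D) R M" "C \<subseteq> C <+>\<^bsub>M\<^esub> D" "D \<subseteq> C <+>\<^bsub>M\<^esub> D"
proof -
  interpret M: module R M by fact
  note C = M.submoduleE[OF assms(2)] and D = M.submoduleE[OF assms(3)]
  note z = submodule_zero[OF assms(1,2)] submodule_zero[OF assms(1,3)]
  have cc: "\<And>x. x \<in> C \<Longrightarrow> x \<in> carrier M" "\<And>x. x \<in> D \<Longrightarrow> x \<in> carrier M" using C(1) D(1) by auto
  have memI: "x \<in> C \<Longrightarrow> y \<in> D \<Longrightarrow> x \<oplus>\<^bsub>M\<^esub> y \<in> C <+>\<^bsub>M\<^esub> D" for x y by (auto simp: set_add_def')
  show "C \<subseteq> C <+>\<^bsub>M\<^esub> D" using memI[OF _ z(2)] cc by fastforce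
  show "D \<subseteq> C <+>\<^bsub>M\<^esub> D" using memI[OF z(1)] cc by fastforce
  show "submodule (C <+>\<^bsub>M\<^esub> D) R M"
  proof (rule M.submoduleI)
    show "C <+>\<^bsub>M\<^esub> D \<subseteq> carrier M" using cc by (auto simp: set_add_def')
    show "\<zero>\<^bsub>M\<^esub> \<in> C <+>\<^bsub>M\<^esub> D" using memI[OF z] by simp
    fix a assume "a \<in> C <+>\<^bsub>M\<^esub> D"
    then obtain x y where x: "x \<in> C" "y \<in> D" "a = x \<oplus>\<^bsub>M\<^esub> y" by (auto simp: set_add_def')
    show "\<ominus>\<^bsub>M\<^esub> a \<in> C <+>\<^bsub>M\<^esub> D"
      using x memI[OF C(3)[OF x(1)] D(3)[OF x(2)]] cc by (simp add: M.minus_add)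
    { fix b assume "b \<in> C <+>\<^bsub>M\<^esub> D"
      then obtain u v where u: "u \<in> C" "v \<in> D" "b = u \<oplus>\<^bsub>M\<^esub> v" by (auto simp: set_add_def')
      have "a \<oplus>\<^bsub>M\<^esub> b = (x \<oplus>\<^bsub>M\<^esub> u) \<oplus>\<^bsub>M\<^esub> (y \<oplus>\<^bsub>M\<^esub> v)" using x u cc by (simp add: M.a_ac)
      then show "a \<oplus>\<^bsub>M\<^esub> b \<in> C <+>\<^bsub>M\<^esub> D" using memI[OF C(5)[OF x(1) u(1)] D(5)[OF x(2) u(2)]] by simp }
    fix r assume "r \<in> carrier R"
    then show "r \<odot>\<^bsub>M\<^esub> a \<in> C <+>\<^bsub>M\<^esub> D"
      using x memI[OF C(4)[OF _ x(1)] D(4)[OF _ x(2)], of r r] cc by (simp add: M.smult_r_distr)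
  qed
qed

lemma submodule_sum_least:
  assumes "module R M" "submodule E R M" "C \<subseteq> E" "D \<subseteq> E"
  shows "C <+>\<^bsub>M\<^esub> D \<subseteq> E"
  using assms module.submoduleE(5)[OF assms(1,2)] by (auto simp: set_add_def')

lemma smult_hom: "module R M \<Longrightarrow> r \<in> carrier R \<Longrightarrow> (\<lambda>x. r \<odot>\<^bsub>M\<^esub> x) \<in> module_hom R M M"
proof (rule module_homI)
  assume M: "module R M" and r: "r \<in> carrier R"
  interpret M: module R M by fact
  show "r \<odot>\<^bsub>M\<^esub> x \<in> carrier M" if "x \<in> carrier M" for x using r that by simp
  show "r \<odot>\<^bsub>M\<^esub> (x \<oplus>\<^bsub>M\<^esub> y) = r \<odot>\<^bsub>M\<^esub> x \<oplus>\<^bsub>M\<^esub> r \<odot>\<^bsub>M\<^esub> y" if "x \<in> carrier M" "y \<in> carrier M" for x y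
    using r that by (simp add: M.smult_r_distr)
  show "r \<odot>\<^bsub>M\<^esub> (s \<odot>\<^bsub>M\<^esub> x) = s \<odot>\<^bsub>M\<^esub> (r \<odot>\<^bsub>M\<^esub> x)" if "s \<in> carrier R" "x \<in> carrier M" for s x
    using r that by (simp add: M.smult_assoc1[symmetric] M.R.m_comm)
qed

lemma cyclic_hom: "module R M \<Longrightarrow> x \<in> carrier M \<Longrightarrow> (\<lambda>r. r \<odot>\<^bsub>M\<^esub> x) \<in> module_hom R (self_module R) M"
  by (rule module_homI) (auto simp: module.smult_closed module.smult_l_distr module.smult_assoc1)

context cring
begin

lemma smult_image_submodule:
  assumes "module R M" "r \<in> carrier R" "submodule N R M"
  shows "submodule ((\<lambda>x. r \<odot>\<^bsub>M\<^esub> x) ` N) R M" "submodule {x \<in> carrier M. r \<odot>\<^bsub>M\<^esub> x \<in> N} R M"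
  using module_hom_image_submodule[OF assms(1,1) smult_hom[OF assms(1,2)] assms(3)]
    module_hom_vimage_submodule[OF assms(1,1) smult_hom[OF assms(1,2)] assms(3)] by auto

lemma cyclic_submodule:
  assumes "module R M" "x \<in> carrier M"
  shows "submodule ((\<lambda>r. r \<odot>\<^bsub>M\<^esub> x) ` carrier R) R M"
  using module_hom_image_submodule[OF self_module_module[OF is_cring] assms(1) cyclic_hom[OF assms] module.carrier_is_submodule[OF self_module_module[OF is_cring]]]
  by simp

text \<open>The ideal of leading coefficients at position \<open>k\<close>. A submodule of \<open>R\<^sup>n\<close> is determined within a
  larger one by these ideals, so that ascending chains are controlled by chains of ideals.\<close>

definition leading :: "nat \<Rightarrow> (nat \<Rightarrow> 'a) set \<Rightarrow> 'a set" where
  "leading k N = (\<lambda>x. x k) ` {x \<in> N. \<forall>l<k. x l = \<zero>}"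

lemma leading_ideal:
  assumes N: "submodule N R (free_module R n)" and k: "k < n"
  shows "ideal (leading k N) R"
proof -
  interpret F: module R "free_module R n" by (rule free_module_module[OF is_cring])
  note E = F.submoduleE[OF N]
  have c: "x l \<in> carrier R" if "x \<in> N" "l < n" for x l using E(1) that by (auto simp: PiE_iff)
  have memI: "x \<in> N \<Longrightarrow> (\<And>l. l < k \<Longrightarrow> x l = \<zero>) \<Longrightarrow> y = x k \<Longrightarrow> y \<in> leading k N" for x y
    by (auto simp: leading_def)
  have memE: "\<exists>x\<in>N. (\<forall>l<k. x l = \<zero>) \<and> y = x k" if "y \<in> leading k N" for y
    using that by (auto simp: leading_def)
  show ?thesis
  proof (rule idealI, rule ring_axioms, rule add.subgroupI)
    show "leading k N \<subseteq> carrier R" using c k by (auto simp: leading_def)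
    show "leading k N \<noteq> {}" using memI[OF submodule_zero[OF F.module_axioms N]] k by fastforce
    fix a assume "a \<in> leading k N"
    then obtain x where x: "x \<in> N" "\<And>l. l < k \<Longrightarrow> x l = \<zero>" "a = x k" using memE by blast
    have xc: "x \<in> carrier (free_module R n)" using x(1) E(1) by blast
    show "\<ominus> a \<in> leading k N"
      using x k by (intro memI[OF E(3)[OF x(1)]]) (simp_all add: free_module_inv[OF is_cring xc])
    { fix b assume "b \<in> leading k N"
      then obtain y where y: "y \<in> N" "\<And>l. l < k \<Longrightarrow> y l = \<zero>" "b = y k" using memE by blast
      show "a \<oplus> b \<in> leading k N"
        using x y k by (intro memI[OF E(5)[OF x(1) y(1)]]) simp_all }
    fix r assume r: "r \<in> carrier R"
    show "r \<otimes> a \<in> leading k N"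
      using x k r by (intro memI[OF E(4)[OF r x(1)]]) simp_all
    then show "a \<otimes> r \<in> leading k N" using r x(3) c[OF x(1) k] by (simp add: m_comm)
  qed
qed

lemma leading_mono: "N \<subseteq> N' \<Longrightarrow> leading k N \<subseteq> leading k N'"
  by (auto simp: leading_def)

lemma leading_eq:
  assumes N: "submodule N R (free_module R n)" and N': "submodule N' R (free_module R n)" "N \<subseteq> N'"
    and eq: "\<And>k. k < n \<Longrightarrow> leading k N' \<subseteq> leading k N"
  shows "N' = N"
proof (intro antisym[OF _ N'(2)] subsetI)
  interpret F: module R "free_module R n" by (rule free_module_module[OF is_cring])
  note E = F.submoduleE[OF N] and E' = F.submoduleE[OF N'(1)]
  fix x assume x: "x \<in> N'"
  have xc: "x \<in> carrier (free_module R n)" using x E'(1) by blast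
  \<comment> \<open>x is matched by elements of N on longer and longer initial segments. The
    difference at position k is a leading coefficient of N', hence of N, so it is the k-th entry of
    some w in N that vanishes before k; adding w repairs that position.\<close>
  have "\<exists>y\<in>N. \<forall>l<k. x l = y l" if "k \<le> n" for k
    using that
  proof (induction k)
    case 0
    then show ?case using E(2) by auto
  next
    case (Suc k)
    then obtain y where y: "y \<in> N" "\<And>l. l < k \<Longrightarrow> x l = y l" by auto
    have yc: "y \<in> carrier (free_module R n)" using y(1) E(1) by blast
    have z: "x \<ominus>\<^bsub>free_module R n\<^esub> y \<in> N'" using submodule_minus[OF F.module_axioms N'(1) x] y(1) N'(2) by blast
    have c: "x l \<in> carrier R" "y l \<in> carrier R" if "l < n" for l using xc yc that by (auto simp: PiE_iff)
    have "(x \<ominus>\<^bsub>free_module R n\<^esub> y) k \<in> leading k N'"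
      unfolding leading_def using z y(2) Suc.prems c
      by (intro imageI) (auto simp: free_module_minus[OF is_cring xc yc] minus_eq r_neg)
    then have "x k \<ominus> y k \<in> leading k N" using eq[of k] Suc.prems free_module_minus[OF is_cring xc yc, of k] by auto
    then obtain w where w: "w \<in> N" "\<And>l. l < k \<Longrightarrow> w l = \<zero>" "x k \<ominus> y k = w k" by (auto simp: leading_def)
    have "x l = (y \<oplus>\<^bsub>free_module R n\<^esub> w) l" if "l < Suc k" for l
    proof (cases "l = k")
      case True
      then show ?thesis using Suc.prems w(3)[symmetric] c[of k] by (simp add: minus_eq a_lcomm r_neg)
    next
      case False
      then show ?thesis using that Suc.prems w(2)[of l] y(2)[of l] c[of l] by simp
    qed
    then show ?case using E(5)[OF y(1) w(1)] by blast
  qed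
  then obtain y where y: "y \<in> N" "\<And>l. l < n \<Longrightarrow> x l = y l" by blast
  have "y \<in> carrier (free_module R n)" using y(1) E(1) by blast
  then have "x = y" using xc y(2) by (auto intro: PiE_ext)
  then show "x \<in> N" using y(1) by simp
qed

end

lemma (in noetherian_ring) ideal_chain_stationary:
  assumes "\<And>i. ideal (J i) R" "\<And>i. J i \<subseteq> J (Suc i)"
  shows "\<exists>m::nat. \<forall>i\<ge>m. J i = J m"
proof -
  have mono: "i \<le> j \<Longrightarrow> J i \<subseteq> J j" for i j using assms(2) by (rule lift_Suc_mono_le)
  then have "subset.chain {I. ideal I R} (range J)"
    unfolding subset_chain_def using assms(1) nat_le_linear by blast
  then have "\<Union>(range J) \<in> range J" using ideal_chain_is_trivial[of "range J"] by auto
  then obtain m where "\<Union>(range J) = J m" by auto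
  then have "J i = J m" if "m \<le> i" for i using mono[OF that] by blast
  then show ?thesis by blast
qed

locale noetherian_cring = cring R + noetherian_ring R for R (structure)
begin

lemma submodule_chain_stationary:
  assumes N: "\<And>i. submodule (N i) R (free_module R n)" and inc: "\<And>i. N i \<subseteq> N (Suc i)"
  shows "\<exists>m::nat. \<forall>i\<ge>m. N i = N m"
proof -
  have mono: "i \<le> j \<Longrightarrow> N i \<subseteq> N j" for i j using inc by (rule lift_Suc_mono_le)
  have "\<forall>k\<in>{..<n}. \<exists>m. \<forall>i\<ge>m. leading k (N i) = leading k (N m)"
    using leading_ideal[OF N] leading_mono[OF inc] by (intro ballI ideal_chain_stationary) auto
  then obtain m where m: "\<forall>k\<in>{..<n}. \<forall>i\<ge>m k. leading k (N i) = leading k (N (m k))" by metis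
  \<comment> \<open>The sum of the n stabilization indices bounds each of them, also when n =
    0.\<close>
  define t where "t = (\<Sum>k<n. m k)"
  have mt: "m k \<le> t" if "k < n" for k unfolding t_def using that by (intro member_le_sum) auto
  have "N i = N t" if "t \<le> i" for i
  proof (rule leading_eq[OF N N mono[OF that]])
    fix k assume "k < n"
    then show "leading k (N i) \<subseteq> leading k (N t)" using m mt[of k] that by (metis le_trans lessThan_iff order_refl)
  qed
  then show ?thesis by blast
qed

text \<open>The maximum condition, obtained from the chain condition by dependent choice. It drives
  the proofs of Nakayama's lemma and of Krull's theorem below.\<close>

lemma maximal_submodule_exists:
  assumes "\<N> \<noteq> {}" "\<And>N. N \<in> \<N> \<Longrightarrow> submodule N R (free_module R n)"
  obtains C where "C \<in> \<N>" "\<And>D. D \<in> \<N> \<Longrightarrow> C \<subseteq> D \<Longrightarrow> D = C"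
proof -
  have "\<exists>C\<in>\<N>. \<forall>D\<in>\<N>. C \<subseteq> D \<longrightarrow> D = C"
  proof (rule ccontr)
    assume a: "\<not> (\<exists>C\<in>\<N>. \<forall>D\<in>\<N>. C \<subseteq> D \<longrightarrow> D = C)"
    have "\<exists>f. \<forall>i::nat. f i \<in> \<N> \<and> f i \<subset> f (Suc i)"
      using assms(1) a by (intro dependent_nat_choice) auto
    then obtain f where f: "\<And>i. f i \<in> \<N>" "\<And>i. f i \<subset> f (Suc i)" by blast
    then obtain m where "\<forall>i\<ge>m. f i = f m" using submodule_chain_stationary[of f n] assms(2) by blast
    then have "f (Suc m) = f m" by (metis le_Suc_eq order_refl)
    then show False using f(2)[of m] by auto
  qed
  then show ?thesis using that by blast
qed

end

locale noetherian_local = noetherian_cring R + adic R I for R (structure) and I +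
  assumes maximal: "maximalideal I R" and unique_maximal: "\<And>J. maximalideal J R \<Longrightarrow> J = I"
begin

text \<open>The hypothesis says B = N + I B without forming I B, since \<open>ideal_smult\<close>
  applies to module records and B is only a set. For C maximal among the submodules with N
  \<subseteq> C \<subset> B, the quotient B/C is simple, so the colon ideal of C at any b of B
  outside C is maximal and equals I. Thus I B \<subseteq> C, and the hypothesis gives B \<subseteq>
  C, a contradiction.\<close>

lemma nakayama:
  assumes N: "submodule N R (F n)" and B: "submodule B R (F n)" "N \<subseteq> B"
    and gen: "\<And>C. submodule C R (F n) \<Longrightarrow> N \<subseteq> C \<Longrightarrow> (\<And>r b. r \<in> I \<Longrightarrow> b \<in> B \<Longrightarrow> r \<odot>\<^bsub>F n\<^esub> b \<in> C) \<Longrightarrow> B \<subseteq> C"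
  shows "B = N"
proof (rule ccontr)
  assume ne: "B \<noteq> N"
  interpret F: module R "F n" by (rule F_module)
  let ?\<N> = "{C. submodule C R (F n) \<and> N \<subseteq> C \<and> C \<subset> B}"
  have "N \<in> ?\<N>" using N B ne by auto
  then obtain C where C: "C \<in> ?\<N>" and max: "\<And>D. D \<in> ?\<N> \<Longrightarrow> C \<subseteq> D \<Longrightarrow> D = C"
    using maximal_submodule_exists[of ?\<N> n] by blast
  have Cs: "submodule C R (F n)" "N \<subseteq> C" "C \<subset> B" using C by auto
  note E = F.submoduleE[OF Cs(1)] and EB = F.submoduleE[OF B(1)]
  have "r \<odot>\<^bsub>F n\<^esub> b \<in> C" if r: "r \<in> I" and b: "b \<in> B" for r b
  proof (cases "b \<in> C")
    case True
    then show ?thesis using E(4) r Icarr by blast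
  next
    case False
    have bc: "b \<in> carrier (F n)" using b EB(1) by blast
    let ?J = "{s \<in> carrier R. s \<odot>\<^bsub>F n\<^esub> b \<in> C}"
    have J: "ideal ?J R" by (rule ideal_submodule[OF is_cring ideal_axioms F_module bc Cs(1)])
    have "maximalideal ?J R"
    proof (rule maximalidealI[OF J])
      have "\<one> \<notin> ?J" using False F.smult_one[OF bc] by auto
      then show "carrier R \<noteq> ?J" by auto
      fix K assume K: "ideal K R" "?J \<subseteq> K" "K \<subseteq> carrier R"
      show "K = ?J \<or> K = carrier R"
      proof (rule disjCI)
        assume "K \<noteq> carrier R"
        interpret K: ideal K R by (rule K(1))
        show "K = ?J"
        proof (intro antisym[OF _ K(2)] subsetI)
          fix s assume s: "s \<in> K"
          show "s \<in> ?J"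
          proof (rule ccontr)
            assume sJ: "s \<notin> ?J"
            have sc: "s \<in> carrier R" using s by (rule K.Icarr)
            then have sb: "s \<odot>\<^bsub>F n\<^esub> b \<notin> C" "s \<odot>\<^bsub>F n\<^esub> b \<in> carrier (F n)" "s \<odot>\<^bsub>F n\<^esub> b \<in> B"
              using sJ F.smult_closed[OF sc bc] EB(4)[OF sc b] by (simp_all del: free_module_simps)
            define U where "U = (\<lambda>r. r \<odot>\<^bsub>F n\<^esub> (s \<odot>\<^bsub>F n\<^esub> b)) ` carrier R"
            have Us: "submodule U R (F n)" unfolding U_def by (rule cyclic_submodule[OF F_module sb(2)])
            \<comment> \<open>By maximality of C this sum is all of B, so b = c + u s b for some c
              in C. Then 1 - u s belongs to the colon ideal, and together with s it would make K the
              whole ring.\<close>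
            let ?D = "C <+>\<^bsub>F n\<^esub> U"
            note D = submodule_sum[OF F_module Cs(1) Us]
            have "\<one> \<odot>\<^bsub>F n\<^esub> (s \<odot>\<^bsub>F n\<^esub> b) \<in> U" unfolding U_def by blast
            then have "s \<odot>\<^bsub>F n\<^esub> b \<in> ?D" using F.smult_one[OF sb(2)] D(3) by auto
            then have neC: "?D \<noteq> C" using sb(1) by auto
            have "?D \<subseteq> B"
              using Cs(3) EB(4)[OF _ sb(3)] by (intro submodule_sum_least[OF F_module B(1)]) (auto simp: U_def)
            then have "?D = B" using max[of ?D] neC D(1,2) Cs(2) by blast
            then obtain c u where cu: "c \<in> C" "u \<in> carrier R" "b = c \<oplus>\<^bsub>F n\<^esub> u \<odot>\<^bsub>F n\<^esub> (s \<odot>\<^bsub>F n\<^esub> b)"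
              using b unfolding set_add_def' U_def by blast
            have cc: "c \<in> carrier (F n)" using cu(1) E(1) by blast
            have usc: "u \<otimes> s \<in> carrier R" using cu(2) sc by simp
            have b2: "b = c \<oplus>\<^bsub>F n\<^esub> (u \<otimes> s) \<odot>\<^bsub>F n\<^esub> b" using cu(3) F.smult_assoc1[OF cu(2) sc bc] by simp
            have "(\<one> \<ominus> u \<otimes> s) \<odot>\<^bsub>F n\<^esub> b = b \<ominus>\<^bsub>F n\<^esub> (u \<otimes> s) \<odot>\<^bsub>F n\<^esub> b"
              using F.smult_l_distr[OF one_closed add.inv_closed[OF usc] bc] F.smult_l_minus[OF usc bc] F.smult_one[OF bc] usc bc
              by (simp only: minus_eq F.minus_eq one_closed add.inv_closed)
            also have "\<dots> = (c \<oplus>\<^bsub>F n\<^esub> (u \<otimes> s) \<odot>\<^bsub>F n\<^esub> b) \<ominus>\<^bsub>F n\<^esub> (u \<otimes> s) \<odot>\<^bsub>F n\<^esub> b"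
              using b2 by simp
            also have "\<dots> = c"
              using F.smult_closed[OF usc bc] cc by (simp only: F.minus_eq F.a_assoc F.a_inv_closed F.r_neg F.r_zero)
            finally have "\<one> \<ominus> u \<otimes> s \<in> ?J" using cu(1) usc by simp
            then have "\<one> \<ominus> u \<otimes> s \<in> K" using K(2) by blast
            moreover have "u \<otimes> s \<in> K" using K.I_l_closed[OF s cu(2)] .
            ultimately have "(\<one> \<ominus> u \<otimes> s) \<oplus> u \<otimes> s \<in> K" by (rule K.a_closed)
            then have "\<one> \<in> K" using usc by (simp add: minus_eq a_assoc l_neg)
            then show False using K.one_imp_carrier \<open>K \<noteq> carrier R\<close> by simp
          qed
        qed
      qed
    qed
    then show ?thesis using unique_maximal r by blast
  qed
  then have "B \<subseteq> C" using gen[OF Cs(1,2)] by blast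
  then show False using Cs(3) by blast
qed

text \<open>I^(k+l) is contained in I^k I^l, as a containment test; \<open>power_mult\<close> is the
  converse. Since \<open>ideal_power\<close> splits off one factor i at a time, the induction
  hypothesis is applied to the colon ideal of J at i, which is why J varies.\<close>

lemma power_add_least:
  assumes "ideal J R" "\<And>u v. u \<in> ideal_power R I k \<Longrightarrow> v \<in> ideal_power R I l \<Longrightarrow> u \<otimes> v \<in> J"
  shows "ideal_power R I (k + l) \<subseteq> J"
  using assms
proof (induction k arbitrary: J)
  case 0
  show ?case
  proof
    fix v assume "v \<in> ideal_power R I (0 + l)"
    then have v: "v \<in> ideal_power R I l" by simp
    have "\<one> \<otimes> v \<in> J" by (rule "0"(2)) (use v in simp_all)
    then show "v \<in> J" using power_carrier[OF v] by simp
  qed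
next
  case (Suc k)
  interpret J: ideal J R by (rule Suc.prems(1))
  show ?case
  proof
    fix x assume "x \<in> ideal_power R I (Suc k + l)"
    then have "x \<in> ideal_prod R I (ideal_power R I (k + l))" by simp
    then show "x \<in> J"
    proof (induction x rule: ideal_prod.induct)
      case (prod i j)
      have ic: "i \<in> carrier R" using prod(1) by (rule Icarr)
      have S: "submodule J R S" using submodule_self_module_iff[OF is_cring] J.ideal_axioms by blast
      have "ideal {r \<in> carrier R. r \<odot>\<^bsub>S\<^esub> i \<in> J} R"
        by (rule ideal_submodule[OF is_cring ideal_axioms S_module _ S]) (use ic in simp)
      moreover have "u \<otimes> v \<in> {r \<in> carrier R. r \<odot>\<^bsub>S\<^esub> i \<in> J}" if "u \<in> ideal_power R I k" "v \<in> ideal_power R I l" for u v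
      proof -
        have c: "u \<in> carrier R" "v \<in> carrier R" using that power_carrier by blast+
        have "i \<otimes> u \<in> ideal_power R I (Suc k)" using ideal_prod.prod[OF prod(1) that(1)] by simp
        then have "i \<otimes> u \<otimes> v \<in> J" using Suc.prems(2) that(2) by blast
        then show ?thesis using c ic by (simp add: m_assoc m_comm[of _ i])
      qed
      ultimately have "ideal_power R I (k + l) \<subseteq> {r \<in> carrier R. r \<odot>\<^bsub>S\<^esub> i \<in> J}" by (rule Suc.IH)
      then show ?case using prod(2) ic m_comm by auto
    qed (rule J.a_closed)
  qed
qed

text \<open>The same test for modules, reduced to ideals through the colon ideal of D at each
  x.\<close>

lemma filt_add_least:
  assumes "module R L" "submodule D R L" "\<And>u y. u \<in> ideal_power R I k \<Longrightarrow> y \<in> filtration R I L l \<Longrightarrow> u \<odot>\<^bsub>L\<^esub> y \<in> D"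
  shows "filtration R I L (k + l) \<subseteq> D"
proof -
  interpret L: module R L by fact
  have "ideal_power R I (k + l) \<subseteq> {r \<in> carrier R. r \<odot>\<^bsub>L\<^esub> x \<in> D}" if x: "x \<in> carrier L" for x
  proof (rule power_add_least[OF ideal_submodule[OF is_cring ideal_axioms assms(1) x assms(2)]])
    fix u v assume uv: "u \<in> ideal_power R I k" "v \<in> ideal_power R I l"
    have "v \<odot>\<^bsub>L\<^esub> x \<in> filtration R I L l" unfolding filtration_def using uv(2) x by (rule ideal_smultI)
    then have "u \<odot>\<^bsub>L\<^esub> (v \<odot>\<^bsub>L\<^esub> x) \<in> D" using assms(3) uv(1) by blast
    then show "u \<otimes> v \<in> {r \<in> carrier R. r \<odot>\<^bsub>L\<^esub> x \<in> D}" using power_carrier[OF uv(1)] power_carrier[OF uv(2)] x by (simp add: L.smult_assoc1)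
  qed
  then show ?thesis unfolding filtration_def by (intro ideal_smult_least[OF assms(2)]) blast
qed

text \<open>This is where one passes from powers of single elements to powers of the ideal, as in the
  proof that an ideal contains a power of its radical.\<close>

lemma filt_subset_if_powers:
  assumes C: "submodule C R (F n)" and r: "\<And>r. r \<in> I \<Longrightarrow> \<exists>t::nat. \<forall>x\<in>carrier (F n). (r [^] t) \<odot>\<^bsub>F n\<^esub> x \<in> C"
  shows "\<exists>j. filtration R I (F n) j \<subseteq> C"
proof (rule ccontr)
  assume no: "\<not> (\<exists>j. filtration R I (F n) j \<subseteq> C)"
  interpret F: module R "F n" by (rule F_module)
  \<comment> \<open>Let D be maximal here and r x outside D with r in I. Then D + r F is larger than
    D. So is the colon submodule (D : r): otherwise all (D : r^t) equal D, although r^t F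
    \<subseteq> C \<subseteq> D for some t. Hence I^j F \<subseteq> D + r F and r I^k F \<subseteq>
    D for some j and k, and so I^(k+j) F \<subseteq> D.\<close>
  let ?\<N> = "{D. submodule D R (F n) \<and> C \<subseteq> D \<and> (\<forall>j. \<not> filtration R I (F n) j \<subseteq> D)}"
  have "C \<in> ?\<N>" using C no by auto
  then obtain D where D: "D \<in> ?\<N>" and max: "\<And>E. E \<in> ?\<N> \<Longrightarrow> D \<subseteq> E \<Longrightarrow> E = D"
    using maximal_submodule_exists[of ?\<N> n] by blast
  have Ds: "submodule D R (F n)" "C \<subseteq> D" "\<And>j. \<not> filtration R I (F n) j \<subseteq> D" using D by auto
  note E = F.submoduleE[OF Ds(1)]
  have "\<exists>r\<in>I. \<exists>x\<in>carrier (F n). r \<odot>\<^bsub>F n\<^esub> x \<notin> D"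
  proof (rule ccontr)
    assume "\<not> (\<exists>r\<in>I. \<exists>x\<in>carrier (F n). r \<odot>\<^bsub>F n\<^esub> x \<notin> D)"
    then have "filtration R I (F n) (Suc 0) \<subseteq> D"
      unfolding filtration_def power_one by (intro ideal_smult_least[OF Ds(1)]) blast
    then show False using Ds(3) by blast
  qed
  then obtain r x where rx: "r \<in> I" "x \<in> carrier (F n)" "r \<odot>\<^bsub>F n\<^esub> x \<notin> D" by blast
  have rc: "r \<in> carrier R" using rx(1) by (rule Icarr)
  let ?X = "(\<lambda>x. r \<odot>\<^bsub>F n\<^esub> x) ` carrier (F n)"
  have Xs: "submodule ?X R (F n)" by (rule smult_image_submodule(1)[OF F_module rc F.carrier_is_submodule])
  note D1 = submodule_sum[OF F_module Ds(1) Xs]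
  have "r \<odot>\<^bsub>F n\<^esub> x \<in> D <+>\<^bsub>F n\<^esub> ?X" using D1(3) rx(2) by blast
  then have "D <+>\<^bsub>F n\<^esub> ?X \<noteq> D" using rx(3) by auto
  then obtain j where j: "filtration R I (F n) j \<subseteq> D <+>\<^bsub>F n\<^esub> ?X"
    using max[of "D <+>\<^bsub>F n\<^esub> ?X"] D1 Ds(2) by blast
  let ?D2 = "{x \<in> carrier (F n). r \<odot>\<^bsub>F n\<^esub> x \<in> D}"
  have D2: "submodule ?D2 R (F n)" by (rule smult_image_submodule(2)[OF F_module rc Ds(1)])
  have DD2: "D \<subseteq> ?D2" using E(1) E(4)[OF rc] by blast
  have "?D2 \<noteq> D"
  proof
    assume eq: "?D2 = D"
    obtain t :: nat where t: "\<forall>x\<in>carrier (F n). (r [^] t) \<odot>\<^bsub>F n\<^esub> x \<in> C" using r[OF rx(1)] by blast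
    have "\<forall>x\<in>carrier (F n). (r [^] t) \<odot>\<^bsub>F n\<^esub> x \<in> D \<longrightarrow> x \<in> D" for t :: nat
    proof (induction t)
      case 0
      then show ?case using F.smult_one by (simp del: free_module_simps)
    next
      case (Suc t)
      show ?case
      proof (intro ballI impI)
        fix x assume x: "x \<in> carrier (F n)" "(r [^] Suc t) \<odot>\<^bsub>F n\<^esub> x \<in> D"
        have "(r [^] t) \<odot>\<^bsub>F n\<^esub> (r \<odot>\<^bsub>F n\<^esub> x) \<in> D" using x rc F.smult_assoc1[OF nat_pow_closed[OF rc, of t] rc x(1)] by simp
        then have "r \<odot>\<^bsub>F n\<^esub> x \<in> D" using Suc F.smult_closed[OF rc x(1)] by blast
        then show "x \<in> D" using eq x(1) by blast
      qed
    qed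
    then have "carrier (F n) \<subseteq> D" using t Ds(2) by blast
    then show False using Ds(3)[of 0] filt_0[OF F_module] by simp
  qed
  then obtain k where k: "filtration R I (F n) k \<subseteq> ?D2" using max[of ?D2] D2 DD2 Ds(2) by blast
  have "filtration R I (F n) (k + j) \<subseteq> D"
  proof (rule filt_add_least[OF F_module Ds(1)])
    fix u y assume u: "u \<in> ideal_power R I k" and "y \<in> filtration R I (F n) j"
    then obtain d x where d: "d \<in> D" "x \<in> carrier (F n)" "y = d \<oplus>\<^bsub>F n\<^esub> r \<odot>\<^bsub>F n\<^esub> x"
      using j unfolding set_add_def' by blast
    have uc: "u \<in> carrier R" using u by (rule power_carrier)
    have dc: "d \<in> carrier (F n)" using d(1) E(1) by blast
    have "u \<odot>\<^bsub>F n\<^esub> x \<in> filtration R I (F n) k" unfolding filtration_def using u d(2) by (rule ideal_smultI)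
    then have "r \<odot>\<^bsub>F n\<^esub> (u \<odot>\<^bsub>F n\<^esub> x) \<in> D" using k by blast
    then have "u \<odot>\<^bsub>F n\<^esub> (r \<odot>\<^bsub>F n\<^esub> x) \<in> D"
      using F.smult_assoc1[OF uc rc d(2)] F.smult_assoc1[OF rc uc d(2)] m_comm[OF uc rc] by simp
    then have "u \<odot>\<^bsub>F n\<^esub> d \<oplus>\<^bsub>F n\<^esub> u \<odot>\<^bsub>F n\<^esub> (r \<odot>\<^bsub>F n\<^esub> x) \<in> D" using E(4)[OF uc d(1)] E(5) by blast
    then show "u \<odot>\<^bsub>F n\<^esub> y \<in> D" using F.smult_r_distr[OF uc dc F.smult_closed[OF rc d(2)]] d(3) by simp
  qed
  then show False using Ds(3) by blast
qed

text \<open>The argument is the one of Herstein and Kaplansky, which does not need the Artin--Rees lemma.\<close>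

theorem krull_intersection:
  assumes N: "submodule N R (F n)" and x: "\<And>j. \<exists>y\<in>N. \<exists>z\<in>filtration R I (F n) j. x = y \<oplus>\<^bsub>F n\<^esub> z"
  shows "x \<in> N"
proof -
  interpret F: module R "F n" by (rule F_module)
  let ?B = "\<Inter>(range (\<lambda>j. N <+>\<^bsub>F n\<^esub> filtration R I (F n) j))"
  note NF = submodule_sum[OF F_module N filt_submodule[OF F_module]]
  have B: "submodule ?B R (F n)" using NF(1) by (intro submodule_Inter[OF F_module]) auto
  note EB = F.submoduleE[OF B]
  have NB: "N \<subseteq> ?B" using NF(2) by blast
  have "?B = N"
  proof (rule nakayama[OF N B NB])
    fix C assume C: "submodule C R (F n)" "N \<subseteq> C" "\<And>r b. r \<in> I \<Longrightarrow> b \<in> ?B \<Longrightarrow> r \<odot>\<^bsub>F n\<^esub> b \<in> C"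
    \<comment> \<open>For D maximal here it is enough that D contains some I^j F: then B \<subseteq>
      N + I^j F \<subseteq> D, and B = D \<inter> B \<subseteq> C. This is reduced to showing that
      every r in I has a power with r^t F \<subseteq> D.\<close>
    let ?\<N> = "{D. submodule D R (F n) \<and> C \<subseteq> D \<and> D \<inter> ?B \<subseteq> C}"
    have "C \<in> ?\<N>" using C by auto
    then obtain D where D: "D \<in> ?\<N>" and max: "\<And>E. E \<in> ?\<N> \<Longrightarrow> D \<subseteq> E \<Longrightarrow> E = D"
      using maximal_submodule_exists[of ?\<N> n] by blast
    have Ds: "submodule D R (F n)" "C \<subseteq> D" "D \<inter> ?B \<subseteq> C" using D by auto
    note E = F.submoduleE[OF Ds(1)]
    have "\<exists>j. filtration R I (F n) j \<subseteq> D"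
    proof (rule filt_subset_if_powers[OF Ds(1)])
      fix r assume r: "r \<in> I"
      have rc: "r \<in> carrier R" using r by (rule Icarr)
      have rt: "r [^] (t::nat) \<in> carrier R" for t using rc by simp
      let ?Q = "\<lambda>t::nat. {x \<in> carrier (F n). (r [^] t) \<odot>\<^bsub>F n\<^esub> x \<in> D}"
      have Qs: "submodule (?Q t) R (F n)" for t by (rule smult_image_submodule(2)[OF F_module rt Ds(1)])
      have Suc_pow: "(r [^] Suc t) \<odot>\<^bsub>F n\<^esub> x = r \<odot>\<^bsub>F n\<^esub> ((r [^] t) \<odot>\<^bsub>F n\<^esub> x)" if "x \<in> carrier (F n)" for t :: nat and x
        using F.smult_assoc1[OF rc rt that, of t] m_comm[OF rc rt, of t] by simp
      have "?Q t \<subseteq> ?Q (Suc t)" for t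
      proof
        fix x assume "x \<in> ?Q t"
        then have x: "x \<in> carrier (F n)" "(r [^] t) \<odot>\<^bsub>F n\<^esub> x \<in> D" by blast+
        then show "x \<in> ?Q (Suc t)" using E(4)[OF rc x(2)] Suc_pow[OF x(1)] by (simp only: mem_Collect_eq)
      qed
      then obtain t where "\<forall>i\<ge>t. ?Q i = ?Q t" using submodule_chain_stationary[of ?Q n, OF Qs] by blast
      then have t: "?Q (Suc t) = ?Q t" by (rule allE[of _ "Suc t"]) (erule impE, simp)
      let ?X = "(\<lambda>x. (r [^] t) \<odot>\<^bsub>F n\<^esub> x) ` carrier (F n)"
      have Xs: "submodule ?X R (F n)" by (rule smult_image_submodule(1)[OF F_module rt F.carrier_is_submodule])
      note D1 = submodule_sum[OF F_module Ds(1) Xs]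
      \<comment> \<open>For b = d + r^t y in B, r b lies in C and hence in D, so r^(t+1) y is in D.
        By stability of the colon submodules r^t y is already in D, hence b is in D \<inter> B. So D
        + r^t F competes with D and equals it.\<close>
      have "(D <+>\<^bsub>F n\<^esub> ?X) \<inter> ?B \<subseteq> C"
      proof
        fix b assume b: "b \<in> (D <+>\<^bsub>F n\<^esub> ?X) \<inter> ?B"
        then obtain d y where d: "d \<in> D" "y \<in> carrier (F n)" "b = d \<oplus>\<^bsub>F n\<^esub> (r [^] t) \<odot>\<^bsub>F n\<^esub> y"
          unfolding set_add_def' by blast
        have dc: "d \<in> carrier (F n)" using d(1) E(1) by blast
        have yc: "(r [^] t) \<odot>\<^bsub>F n\<^esub> y \<in> carrier (F n)" by (rule F.smult_closed[OF rt d(2)])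
        have "r \<odot>\<^bsub>F n\<^esub> b \<in> D" using b C(3)[OF r] Ds(2) by blast
        then have rb: "r \<odot>\<^bsub>F n\<^esub> d \<oplus>\<^bsub>F n\<^esub> r \<odot>\<^bsub>F n\<^esub> ((r [^] t) \<odot>\<^bsub>F n\<^esub> y) \<in> D"
          unfolding d(3) using F.smult_r_distr[OF rc dc yc] by simp
        have rd: "r \<odot>\<^bsub>F n\<^esub> d \<in> D" by (rule E(4)[OF rc d(1)])
        have "r \<odot>\<^bsub>F n\<^esub> ((r [^] t) \<odot>\<^bsub>F n\<^esub> y) = \<ominus>\<^bsub>F n\<^esub> (r \<odot>\<^bsub>F n\<^esub> d) \<oplus>\<^bsub>F n\<^esub> (r \<odot>\<^bsub>F n\<^esub> d \<oplus>\<^bsub>F n\<^esub> r \<odot>\<^bsub>F n\<^esub> ((r [^] t) \<odot>\<^bsub>F n\<^esub> y))"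
          by (rule F.r_neg1[symmetric, OF F.smult_closed[OF rc dc] F.smult_closed[OF rc yc]])
        also have "\<dots> \<in> D" by (rule E(5)[OF E(3)[OF rd] rb])
        finally have "y \<in> ?Q (Suc t)" using Suc_pow[OF d(2)] d(2) by simp
        then have "(r [^] t) \<odot>\<^bsub>F n\<^esub> y \<in> D" unfolding t by blast
        then have "b \<in> D" using d E(5) by blast
        then show "b \<in> C" using b Ds(3) by blast
      qed
      then have "D <+>\<^bsub>F n\<^esub> ?X = D" using max[of "D <+>\<^bsub>F n\<^esub> ?X"] D1(1,2) Ds(2) by blast
      then show "\<exists>t::nat. \<forall>x\<in>carrier (F n). (r [^] t) \<odot>\<^bsub>F n\<^esub> x \<in> D" using D1(3) by blast
    qed
    then obtain j where "filtration R I (F n) j \<subseteq> D" by blast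
    then have "N <+>\<^bsub>F n\<^esub> filtration R I (F n) j \<subseteq> D"
      using C(2) Ds(2) by (intro submodule_sum_least[OF F_module Ds(1)]) auto
    then have "?B \<subseteq> D" by blast
    then show "?B \<subseteq> C" using Ds(3) by blast
  qed
  moreover have "x \<in> ?B" using x unfolding set_add_def' by blast
  ultimately show ?thesis by blast
qed

end

section \<open>Graded free modules and twists\<close>

lemma module_hom_inverse:
  assumes "module R P" "module R Q" "h \<in> module_hom R P Q" "bij_betw h (carrier P) (carrier Q)"
    "\<And>x. x \<in> carrier P \<Longrightarrow> g (h x) = x"
  shows "g \<in> module_hom R Q P"
  using assms(4,5) by (intro module_hom_transport[OF assms(1-3), of "\<lambda>x. x"]) (auto simp: bij_betw_def module_hom_def)

lemma graded_free_simps [simp]: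
  "carrier (graded_free A n b) = carrier (free_module A n)"
  "\<zero>\<^bsub>graded_free A n b\<^esub> = \<zero>\<^bsub>free_module A n\<^esub>"
  "add (graded_free A n b) = add (free_module A n)"
  "smult (graded_free A n b) = smult (free_module A n)"
  "grade (graded_free A n b) j = (\<Pi>\<^sub>E k\<in>{..<n}. ring_grade A (j - b k))"
  by (simp_all add: graded_free_def module.extend_def free_module_def)

lemma module_hom_graded_free:
  "module_hom A (graded_free A n b) L = module_hom A (free_module A n) L"
  "module_hom A L (graded_free A n b) = module_hom A L (free_module A n)"
  by (simp_all add: module_hom_def del: free_module_simps)

lemma graded_free_module:
  assumes "cring A"
  shows "module A (graded_free A n b)"
proof -
  interpret F: module A "free_module A n" by (rule free_module_module[OF assms])
  show ?thesis
  proof (rule moduleI[OF assms])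
    show "abelian_group (graded_free A n b)"
      using abelian_groupE[OF F.abelian_group_axioms] by (intro abelian_groupI) (simp_all del: free_module_simps)
  qed (simp_all add: F.smult_l_distr F.smult_r_distr F.smult_assoc1 del: free_module_simps)
qed

lemma twist_simps [simp]:
  "carrier (twist L n) = carrier L" "\<zero>\<^bsub>twist L n\<^esub> = \<zero>\<^bsub>L\<^esub>" "add (twist L n) = add L"
  "smult (twist L n) = smult L" "grade (twist L n) j = grade L (n + j)"
  by (simp_all add: twist_def)

lemma module_hom_twist:
  "module_hom A (twist L n) N = module_hom A L N" "module_hom A N (twist L n) = module_hom A N L"
  by (simp_all add: module_hom_def)

lemma twist_module:
  assumes "module A L"
  shows "module A (twist L n)"
proof -
  interpret module A L by fact
  show ?thesis
  proof (rule moduleI[OF R.is_cring])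
    show "abelian_group (twist L n)"
      using abelian_groupE[OF abelian_group_axioms] by (intro abelian_groupI) simp_all
  qed (simp_all add: smult_l_distr smult_r_distr smult_assoc1)
qed

context adic
begin

section \<open>Degree zero maps\<close>

lemma grade_finsum:
  assumes "module R L" "finite K" "\<And>k. k \<in> K \<Longrightarrow> u k \<in> grade (gr L) j"
  shows "finsum (gr L) u K \<in> grade (gr L) j"
  using assms(2,3)
proof (induction K)
  case empty
  interpret G: module A "gr L" by (rule gr_module_module[OF assms(1)])
  show ?case using grade_zero[OF assms(1)] by simp
next
  case (insert k K)
  interpret L: module R L by fact
  interpret G: module A "gr L" by (rule gr_module_module[OF assms(1)])
  have c: "u k \<in> carrier (gr L)" "u \<in> K \<rightarrow> carrier (gr L)" using insert.prems grade_closed by blast+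
  have a: "v \<oplus>\<^bsub>gr L\<^esub> w \<in> grade (gr L) j" if vw: "v \<in> grade (gr L) j" "w \<in> grade (gr L) j" for v w
  proof (cases "j < 0")
    case True
    then show ?thesis using vw grade_neg[of v L j] grade_neg[of w L j] grade_zero[OF assms(1)] by simp
  next
    case False
    then obtain t where t: "j = int t" using nonneg_int_cases[of j] by auto
    obtain x where x: "x \<in> filtration R I L t" "v = cl L (single L t x)" by (rule grade_elem[OF assms(1) vw(1)[unfolded t]])
    obtain y where y: "y \<in> filtration R I L t" "w = cl L (single L t y)" by (rule grade_elem[OF assms(1) vw(2)[unfolded t]])
    have "(\<lambda>i. single L t x i \<oplus>\<^bsub>L\<^esub> single L t y i) = single L t (x \<oplus>\<^bsub>L\<^esub> y)"
      by (auto simp: single_def)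
    then have "v \<oplus>\<^bsub>gr L\<^esub> w = cl L (single L t (x \<oplus>\<^bsub>L\<^esub> y))"
      using x y by (simp add: gr_add[OF assms(1)] fin_seq_seq[OF fin_seq_single[OF assms(1)]])
    then show ?thesis
      using single_grade[OF assms(1)] L.submoduleE(5)[OF filt_submodule[OF assms(1)] x(1) y(1)] t by simp
  qed
  show ?case using insert c a by (subst G.finsum_insert) auto
qed

lemma grade_smult:
  assumes "module R L" "a \<in> grade (gr S) i" "u \<in> grade (gr L) j"
  shows "a \<odot>\<^bsub>gr L\<^esub> u \<in> grade (gr L) (i + j)"
proof -
  interpret L: module R L by fact
  interpret G: module A "gr L" by (rule gr_module_module[OF assms(1)])
  have c: "a \<in> carrier (gr S)" "u \<in> carrier (gr L)" using assms grade_closed by blast+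
  show ?thesis
  proof (cases "i < 0 \<or> j < 0")
    case True
    then have "a \<odot>\<^bsub>gr L\<^esub> u = \<zero>\<^bsub>gr L\<^esub>"
      using assms grade_neg[of a S i] grade_neg[of u L j] c G.smult_l_null[of u] G.smult_r_null[of a] by auto
    then show ?thesis using grade_zero[OF assms(1)] by simp
  next
    case False
    then obtain s t where st: "i = int s" "j = int t" using nonneg_int_cases by (metis not_less)
    obtain r where r: "r \<in> filtration R I S s" "a = cl S (single S s r)" by (rule grade_elem[OF S_module assms(2)[unfolded st(1)]])
    obtain y where y: "y \<in> filtration R I L t" "u = cl L (single L t y)" by (rule grade_elem[OF assms(1) assms(3)[unfolded st(2)]])
    have rI: "r \<in> ideal_power R I s" using r(1) by (simp add: filt_self)
    have "conv L (single S s r) (single L t y) = single L (s + t) (r \<odot>\<^bsub>L\<^esub> y)"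
      using conv_single_left[OF assms(1) rI fin_seq_seq[OF fin_seq_single[OF assms(1) y(1)]]] power_carrier[OF rI]
      by (auto simp: single_def fun_eq_iff)
    then have "a \<odot>\<^bsub>gr L\<^esub> u = cl L (single L (s + t) (r \<odot>\<^bsub>L\<^esub> y))"
      using r y by (simp add: gr_smult[OF assms(1)] fin_seq_seq[OF fin_seq_single[OF assms(1)]] fin_seq_seq[OF fin_seq_single[OF S_module]])
    then show ?thesis
      using single_grade[OF assms(1) filt_smult[OF assms(1) rI y(1)]] st by simp
  qed
qed

abbreviation AF :: "nat \<Rightarrow> (nat \<Rightarrow> 'a set, nat \<Rightarrow> nat \<Rightarrow> 'a set) module" where
  "AF \<equiv> free_module A"

text \<open>The component of degree j of A^n with all generators in degree 0. By purity, every term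
  of a pure resolution is of this kind up to one twist.\<close>

abbreviation homog :: "nat \<Rightarrow> int \<Rightarrow> (nat \<Rightarrow> nat \<Rightarrow> 'a set) set" where
  "homog n j \<equiv> \<Pi>\<^sub>E k\<in>{..<n}. grade (gr S) j"

lemma homog_carrier: "v \<in> homog n j \<Longrightarrow> v \<in> carrier (AF n)"
  using grade_closed by (fastforce simp: PiE_iff)

lemma one_grade: "\<one>\<^bsub>A\<^esub> \<in> grade (gr S) 0"
  using single_grade[OF S_module, of \<one> 0] by (simp add: gr_one filt_0[OF S_module])

lemma unit_vec_homog: "unit_vec A n k \<in> homog n 0"
  using one_grade grade_zero[OF S_module] by (auto simp: unit_vec_def)

text \<open>The coefficients are replaced by their components of degree zero.\<close>

lemma lin_comb_degree_zero:
  assumes L: "module R L" and g: "\<And>k. k < n \<Longrightarrow> g k \<in> grade (gr L) (int s)"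
    and v: "v \<in> carrier (AF n)" and vg: "lin_comb (gr L) n g v \<in> grade (gr L) (int s)"
  shows "\<exists>w\<in>homog n 0. lin_comb (gr L) n g w = lin_comb (gr L) n g v"
proof -
  interpret L: module R L by (rule L)
  interpret G: module A "gr L" by (rule gr_module_module[OF L])
  obtain a where a: "\<forall>k<n. fin_seq S (a k)" "\<forall>k<n. seq S (a k)" "v = (\<lambda>k\<in>{..<n}. cl S (a k))"
    by (rule free_A_elem[OF v])
  have "\<forall>k\<in>{..<n}. \<exists>y. y \<in> filtration R I L s \<and> g k = cl L (single L s y)"
    using grade_elem[OF L g] by (metis lessThan_iff)
  then obtain y where y: "\<forall>k\<in>{..<n}. y k \<in> filtration R I L s \<and> g k = cl L (single L s (y k))" by metis
  have y1: "y k \<in> filtration R I L s" and y2: "g k = cl L (single L s (y k))" if "k < n" for k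
    using y that by auto
  have yc: "y k \<in> carrier L" if "k < n" for k using filt_carrier[OF L y1[OF that]] .
  have ac: "a k i \<in> carrier R" if "k < n" for k i using seq_carrier[OF S_module, of "a k"] a(2) that by simp
  have a0: "a k 0 \<in> filtration R I S 0" if "k < n" for k using seqD a(2) that by blast
  define w where "w = (\<lambda>k\<in>{..<n}. cl S (single S 0 (a k 0)))"
  have w: "w \<in> homog n 0" using single_grade[OF S_module a0] by (auto simp: w_def)
  have 1: "v k \<odot>\<^bsub>gr L\<^esub> g k = cl L (\<lambda>i. if i < s then \<zero>\<^bsub>L\<^esub> else a k (i - s) \<odot>\<^bsub>L\<^esub> y k)"
    "fin_seq L (\<lambda>i. if i < s then \<zero>\<^bsub>L\<^esub> else a k (i - s) \<odot>\<^bsub>L\<^esub> y k)" if k: "k < n" for k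
  proof -
    note c = conv_single_right[OF L y1[OF k], of "a k"]
    show "v k \<odot>\<^bsub>gr L\<^esub> g k = cl L (\<lambda>i. if i < s then \<zero>\<^bsub>L\<^esub> else a k (i - s) \<odot>\<^bsub>L\<^esub> y k)"
      using k a c y1 by (simp add: y2 gr_smult[OF L] fin_seq_seq[OF fin_seq_single[OF L]])
    show "fin_seq L (\<lambda>i. if i < s then \<zero>\<^bsub>L\<^esub> else a k (i - s) \<odot>\<^bsub>L\<^esub> y k)"
      using k a c fin_seq_conv[OF L, of "a k" "single L s (y k)"] fin_seq_single[OF L y1[OF k]] by simp
  qed
  have 2: "w k \<odot>\<^bsub>gr L\<^esub> g k = cl L (single L s (a k 0 \<odot>\<^bsub>L\<^esub> y k))"
    "fin_seq L (single L s (a k 0 \<odot>\<^bsub>L\<^esub> y k))" if k: "k < n" for k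
  proof -
    have f0: "fin_seq S (single S 0 (a k 0))" by (rule fin_seq_single[OF S_module a0[OF k]])
    have c: "conv L (single S 0 (a k 0)) (single L s (y k)) = single L s (a k 0 \<odot>\<^bsub>L\<^esub> y k)"
      using conv_single_left[OF L _ fin_seq_seq[OF fin_seq_single[OF L y1[OF k]]], of "a k 0" 0] ac[OF k]
      by (auto simp: single_def fun_eq_iff)
    show "w k \<odot>\<^bsub>gr L\<^esub> g k = cl L (single L s (a k 0 \<odot>\<^bsub>L\<^esub> y k))"
      using k c by (simp add: w_def y2 gr_smult[OF L] fin_seq_seq[OF f0] fin_seq_seq[OF fin_seq_single[OF L y1]])
    show "fin_seq L (single L s (a k 0 \<odot>\<^bsub>L\<^esub> y k))"
      using fin_seq_conv[OF L f0 fin_seq_single[OF L y1[OF k]]] c by simp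
  qed
  have vk: "lin_comb (gr L) n g v = cl L (\<lambda>i. \<Oplus>\<^bsub>L\<^esub>k\<in>{..<n}. if i < s then \<zero>\<^bsub>L\<^esub> else a k (i - s) \<odot>\<^bsub>L\<^esub> y k)"
  proof -
    have "lin_comb (gr L) n g v = (\<Oplus>\<^bsub>gr L\<^esub>k\<in>{..<n}. cl L (\<lambda>i. if i < s then \<zero>\<^bsub>L\<^esub> else a k (i - s) \<odot>\<^bsub>L\<^esub> y k))"
      unfolding lin_comb_def by (rule G.finsum_cong') (use 1 cl_closed[OF L] in auto)
    then show ?thesis using finsum_gr(1)[OF L, of "{..<n}" "\<lambda>k i. if i < s then \<zero>\<^bsub>L\<^esub> else a k (i - s) \<odot>\<^bsub>L\<^esub> y k"] 1(2) by simp
  qed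
  have wk: "lin_comb (gr L) n g w = cl L (\<lambda>i. \<Oplus>\<^bsub>L\<^esub>k\<in>{..<n}. single L s (a k 0 \<odot>\<^bsub>L\<^esub> y k) i)"
  proof -
    have "lin_comb (gr L) n g w = (\<Oplus>\<^bsub>gr L\<^esub>k\<in>{..<n}. cl L (single L s (a k 0 \<odot>\<^bsub>L\<^esub> y k)))"
      unfolding lin_comb_def by (rule G.finsum_cong') (use 2 cl_closed[OF L] in auto)
    then show ?thesis using finsum_gr(1)[OF L, of "{..<n}" "\<lambda>k. single L s (a k 0 \<odot>\<^bsub>L\<^esub> y k)"] 2(2) by simp
  qed
  have "lin_comb (gr L) n g w i = lin_comb (gr L) n g v i" for i
  proof (cases "i = s")
    case True
    have "(\<Oplus>\<^bsub>L\<^esub>k\<in>{..<n}. single L s (a k 0 \<odot>\<^bsub>L\<^esub> y k) i) = (\<Oplus>\<^bsub>L\<^esub>k\<in>{..<n}. if i < s then \<zero>\<^bsub>L\<^esub> else a k (i - s) \<odot>\<^bsub>L\<^esub> y k)"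
      using True ac yc by (intro L.finsum_cong') (auto simp: single_def)
    then show ?thesis unfolding vk wk cl_def by simp
  next
    case False
    have "(\<Oplus>\<^bsub>L\<^esub>k\<in>{..<n}. single L s (a k 0 \<odot>\<^bsub>L\<^esub> y k) i) = \<zero>\<^bsub>L\<^esub>"
      using False by (simp add: single_def)
    then have "lin_comb (gr L) n g w i = filtration R I L (Suc i)"
      using coset_eq_self_iff[OF L L.zero_closed] submodule_zero[OF L filt_submodule[OF L]] by (simp add: wk cl_def)
    then show ?thesis using vg False by (simp add: gr_grade)
  qed
  then show ?thesis using w by blast
qed

text \<open>Each D e_k has a preimage under f. As D e_k and all f e_l have the same degree s, its
  coefficients can be taken in degree 0, so the lift preserves degrees. This is where generation in
  one common degree is exploited.\<close>

lemma degree_zero_lift: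
  assumes L: "module R L" and f: "f \<in> module_hom A (AF n) (gr L)" and D: "D \<in> module_hom A (AF m) (gr L)"
    and fg: "\<And>k. k < n \<Longrightarrow> f (unit_vec A n k) \<in> grade (gr L) (int s)"
    and Dg: "\<And>k. k < m \<Longrightarrow> D (unit_vec A m k) \<in> grade (gr L) (int s)"
    and sub: "D ` carrier (AF m) \<subseteq> f ` carrier (AF n)"
  shows "\<exists>\<theta>. \<theta> \<in> module_hom A (AF m) (AF n) \<and> (\<forall>j. \<theta> ` homog m j \<subseteq> homog n j) \<and> (\<forall>v\<in>carrier (AF m). f (\<theta> v) = D v)"
proof -
  have G: "module A (gr L)" by (rule gr_module_module[OF L])
  have f_eq: "f v = lin_comb (gr L) n (\<lambda>k. f (unit_vec A n k)) v" if "v \<in> carrier (AF n)" for v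
    unfolding lin_comb_def by (rule free_module_hom_expand[OF gr_cring G f that])
  have "\<forall>k\<in>{..<m}. \<exists>w\<in>homog n 0. f w = D (unit_vec A m k)"
  proof
    fix k assume "k \<in> {..<m}"
    then have k: "k < m" by simp
    have "D (unit_vec A m k) \<in> f ` carrier (AF n)"
      using sub unit_vec_closed[OF gr_cring, of m k] by (auto simp: image_subset_iff)
    then obtain v where v: "v \<in> carrier (AF n)" "f v = D (unit_vec A m k)" by (metis imageE)
    then have "lin_comb (gr L) n (\<lambda>k. f (unit_vec A n k)) v \<in> grade (gr L) (int s)" using Dg[OF k] f_eq by simp
    from lin_comb_degree_zero[OF L fg v(1) this]
    obtain w where w: "w \<in> homog n 0" "lin_comb (gr L) n (\<lambda>k. f (unit_vec A n k)) w = lin_comb (gr L) n (\<lambda>k. f (unit_vec A n k)) v"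
      by blast
    then have "f w = D (unit_vec A m k)" using f_eq[OF homog_carrier[OF w(1)]] f_eq[OF v(1)] v(2) by simp
    then show "\<exists>w\<in>homog n 0. f w = D (unit_vec A m k)" using w(1) by blast
  qed
  then obtain w where w: "\<forall>k\<in>{..<m}. w k \<in> homog n 0 \<and> f (w k) = D (unit_vec A m k)" by metis
  have w1: "w k \<in> homog n 0" and w2: "f (w k) = D (unit_vec A m k)" if "k < m" for k using w that by auto
  define \<theta> where "\<theta> = lin_comb (AF n) m w"
  have \<theta>: "\<theta> \<in> module_hom A (AF m) (AF n)"
    unfolding \<theta>_def by (rule lin_comb_hom[OF gr_cring AF_module homog_carrier[OF w1]])
  have \<theta>u: "\<theta> (unit_vec A m k) = w k" if "k < m" for k
    unfolding \<theta>_def by (rule lin_comb_unit_vec[OF gr_cring AF_module homog_carrier[OF w1] that])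
  have "f (\<theta> v) = D v" if v: "v \<in> carrier (AF m)" for v
    using free_module_hom_eqI[OF gr_cring G module_hom_comp[OF \<theta> f] D _ v] \<theta>u w2 by simp
  moreover have "\<theta> v \<in> homog n j" if v: "v \<in> homog m j" for v j
  proof -
    have t: "v k \<odot>\<^bsub>AF n\<^esub> w k \<in> carrier (AF n)" if "k < m" for k
      using homog_carrier[OF v] homog_carrier[OF w1[OF that]] that
      by (intro module.smult_closed[OF AF_module]) auto
    have "\<theta> v = (\<lambda>i\<in>{..<n}. \<Oplus>\<^bsub>A\<^esub>k\<in>{..<m}. (v k \<odot>\<^bsub>AF n\<^esub> w k) i)"
      unfolding \<theta>_def lin_comb_def using t by (intro finsum_free_module[OF gr_cring]) auto
    moreover have "(\<Oplus>\<^bsub>A\<^esub>k\<in>{..<m}. (v k \<odot>\<^bsub>AF n\<^esub> w k) i) \<in> grade (gr S) j" if i: "i < n" for i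
      unfolding finsum_A
    proof (rule grade_finsum[OF S_module])
      fix k assume "k \<in> {..<m}"
      then have "v k \<odot>\<^bsub>gr S\<^esub> w k i \<in> grade (gr S) (j + 0)"
        using v w1[of k] i by (intro grade_smult[OF S_module]) auto
      then show "(v k \<odot>\<^bsub>AF n\<^esub> w k) i \<in> grade (gr S) j" using i by simp
    qed simp
    ultimately show ?thesis by auto
  qed
  ultimately show ?thesis using \<theta> by blast
qed

lemma homog_minus:
  assumes "v \<in> homog n j" "w \<in> homog n j"
  shows "v \<ominus>\<^bsub>AF n\<^esub> w \<in> homog n j"
proof -
  interpret Ac: cring A by (rule gr_cring)
  interpret AFn: module A "AF n" by (rule AF_module)
  have c: "v \<in> carrier (AF n)" "w \<in> carrier (AF n)" using assms homog_carrier by blast+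
  \<comment> \<open>Since -1 is homogeneous of degree 0, closure under differences follows from
    closure under sums and products.\<close>
  have m: "\<ominus>\<^bsub>A\<^esub> \<one>\<^bsub>A\<^esub> \<in> grade (gr S) 0"
  proof -
    have s: "fin_seq S (single S 0 (\<ominus> \<one>))" by (rule fin_seq_single[OF S_module]) (simp add: filt_0[OF S_module])
    have "(\<lambda>i. single S 0 (\<ominus> \<one>) i \<oplus> single S 0 \<one> i) = (\<lambda>i. \<zero>)"
      by (auto simp: single_def l_neg)
    then have "cl S (single S 0 (\<ominus> \<one>)) \<oplus>\<^bsub>A\<^esub> \<one>\<^bsub>A\<^esub> = \<zero>\<^bsub>A\<^esub>"
      using s fin_seq_one by (simp add: gr_one gr_add[OF S_module] gr_zero[OF S_module] fin_seq_seq)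
    then have "\<ominus>\<^bsub>A\<^esub> \<one>\<^bsub>A\<^esub> = cl S (single S 0 (\<ominus> \<one>))"
      using cl_closed[OF S_module s] Ac.one_closed by (intro Ac.minus_equality) simp_all
    then show ?thesis using single_grade[OF S_module, of "\<ominus> \<one>" 0] by (simp add: filt_0[OF S_module])
  qed
  have "(v \<ominus>\<^bsub>AF n\<^esub> w) k \<in> grade (gr S) j" if k: "k < n" for k
  proof -
    have vw: "v k \<in> grade (gr S) j" "w k \<in> grade (gr S) j" using assms k by auto
    have wc: "w k \<in> carrier A" using grade_closed[OF vw(2)] by simp
    have "v k \<ominus>\<^bsub>A\<^esub> w k = v k \<oplus>\<^bsub>A\<^esub> (\<ominus>\<^bsub>A\<^esub> \<one>\<^bsub>A\<^esub>) \<otimes>\<^bsub>A\<^esub> w k"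
      using Ac.l_minus[OF Ac.one_closed wc] Ac.l_one[OF wc] by (simp only: Ac.minus_eq)
    \<comment> \<open>The two summands are written as a sum over {0, 1} so that
      \<open>grade_finsum\<close> applies.\<close>
    also have "\<dots> = (\<Oplus>\<^bsub>gr S\<^esub>i\<in>{0::nat,1}. if i = 0 then v k else (\<ominus>\<^bsub>A\<^esub> \<one>\<^bsub>A\<^esub>) \<otimes>\<^bsub>A\<^esub> w k)"
    proof -
      interpret G: module A "gr S" by (rule gr_module_module[OF S_module])
      show ?thesis using grade_closed[OF vw(1)] grade_closed[OF vw(2)] grade_closed[OF m]
        by (simp add: G.smult_closed)
    qed
    also have "\<dots> \<in> grade (gr S) j"
      using vw grade_smult[OF S_module m vw(2)] by (intro grade_finsum[OF S_module]) auto
    finally show ?thesis using free_module_minus[OF gr_cring c k] by simp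
  qed
  then show ?thesis using AFn.minus_closed[OF c] by (auto simp: PiE_iff)
qed

text \<open>Lifts exist in both directions. Each composite moves a unit vector to a vector of degree
  0 with the same image under D or f, and injectivity in degree 0 forces it to be the unit vector
  itself. So the lifts are mutually inverse, although D and f need not be injective in higher
  degrees.\<close>

lemma degree_zero_iso:
  assumes L: "module R L" and f: "f \<in> module_hom A (AF n) (gr L)" and D: "D \<in> module_hom A (AF m) (gr L)"
    and fg: "\<And>k. k < n \<Longrightarrow> f (unit_vec A n k) \<in> grade (gr L) (int s)"
    and Dg: "\<And>k. k < m \<Longrightarrow> D (unit_vec A m k) \<in> grade (gr L) (int s)"
    and eq: "D ` carrier (AF m) = f ` carrier (AF n)"
    and f0: "\<And>v. v \<in> homog n 0 \<Longrightarrow> f v = \<zero>\<^bsub>gr L\<^esub> \<Longrightarrow> v = \<zero>\<^bsub>AF n\<^esub>"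
    and D0: "\<And>v. v \<in> homog m 0 \<Longrightarrow> D v = \<zero>\<^bsub>gr L\<^esub> \<Longrightarrow> v = \<zero>\<^bsub>AF m\<^esub>"
  shows "\<exists>\<theta>. \<theta> \<in> module_hom A (AF m) (AF n) \<and> bij_betw \<theta> (carrier (AF m)) (carrier (AF n)) \<and>
     (\<forall>j. \<theta> ` homog m j = homog n j) \<and> (\<forall>v\<in>carrier (AF m). f (\<theta> v) = D v)"
proof -
  have G: "module A (gr L)" by (rule gr_module_module[OF L])
  interpret G: module A "gr L" by (rule G)
  have inj: "v = w" if h: "h \<in> module_hom A (AF p) (gr L)" "\<And>v. v \<in> homog p 0 \<Longrightarrow> h v = \<zero>\<^bsub>gr L\<^esub> \<Longrightarrow> v = \<zero>\<^bsub>AF p\<^esub>"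
     and vw: "v \<in> homog p 0" "w \<in> homog p 0" "h v = h w" for h p v w
  proof -
    interpret P: module A "AF p" by (rule AF_module)
    note c = homog_carrier[OF vw(1)] homog_carrier[OF vw(2)]
    have "h (v \<ominus>\<^bsub>AF p\<^esub> w) = \<zero>\<^bsub>gr L\<^esub>"
      using module_hom_minus[OF AF_module G h(1) c] vw(3) module_homD(1)[OF h(1) c(2)] by (simp add: G.minus_eq G.r_neg)
    then have "v \<ominus>\<^bsub>AF p\<^esub> w = \<zero>\<^bsub>AF p\<^esub>" using h(2)[OF homog_minus[OF vw(1,2)]] by blast
    then show ?thesis using c by (metis P.add.inv_closed P.minus_equality P.minus_minus P.minus_eq)
  qed
  obtain \<theta> where \<theta>: "\<theta> \<in> module_hom A (AF m) (AF n)" "\<And>j. \<theta> ` homog m j \<subseteq> homog n j" "\<And>v. v \<in> carrier (AF m) \<Longrightarrow> f (\<theta> v) = D v"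
    using degree_zero_lift[OF L f D fg Dg] eq by blast
  obtain \<psi> where \<psi>: "\<psi> \<in> module_hom A (AF n) (AF m)" "\<And>j. \<psi> ` homog n j \<subseteq> homog m j" "\<And>v. v \<in> carrier (AF n) \<Longrightarrow> D (\<psi> v) = f v"
    using degree_zero_lift[OF L D f Dg fg] eq by blast
  have id: "(\<lambda>v. v) \<in> module_hom A (AF p) (AF p)" for p by (simp add: module_hom_def)
  have 1: "\<psi> (\<theta> v) = v" if v: "v \<in> carrier (AF m)" for v
  proof -
    have "\<psi> (\<theta> (unit_vec A m k)) = unit_vec A m k" for k
    proof (rule inj[OF D D0 _ unit_vec_homog])
      show "\<psi> (\<theta> (unit_vec A m k)) \<in> homog m 0" by (rule subsetD[OF \<psi>(2) imageI[OF subsetD[OF \<theta>(2) imageI[OF unit_vec_homog]]]])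
      show "D (\<psi> (\<theta> (unit_vec A m k))) = D (unit_vec A m k)"
        using homog_carrier[OF unit_vec_homog] by (simp add: \<psi>(3) \<theta>(3) module_homD(1)[OF \<theta>(1)] del: free_module_simps)
    qed
    then show ?thesis using free_module_hom_eqI[OF gr_cring AF_module module_hom_comp[OF \<theta>(1) \<psi>(1)] id _ v] by simp
  qed
  have 2: "\<theta> (\<psi> v) = v" if v: "v \<in> carrier (AF n)" for v
  proof -
    have "\<theta> (\<psi> (unit_vec A n k)) = unit_vec A n k" for k
    proof (rule inj[OF f f0 _ unit_vec_homog])
      show "\<theta> (\<psi> (unit_vec A n k)) \<in> homog n 0" by (rule subsetD[OF \<theta>(2) imageI[OF subsetD[OF \<psi>(2) imageI[OF unit_vec_homog]]]])
      show "f (\<theta> (\<psi> (unit_vec A n k))) = f (unit_vec A n k)"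
        using homog_carrier[OF unit_vec_homog] by (simp add: \<psi>(3) \<theta>(3) module_homD(1)[OF \<psi>(1)] del: free_module_simps)
    qed
    then show ?thesis using free_module_hom_eqI[OF gr_cring AF_module module_hom_comp[OF \<psi>(1) \<theta>(1)] id _ v] by simp
  qed
  have "bij_betw \<theta> (carrier (AF m)) (carrier (AF n))"
    using 1 2 module_homD(1)[OF \<theta>(1)] module_homD(1)[OF \<psi>(1)] by (intro bij_betwI[where g = \<psi>]) auto
  moreover have "\<theta> ` homog m j = homog n j" for j
  proof (intro antisym[OF \<theta>(2)] subsetI)
    fix v assume v: "v \<in> homog n j"
    then have "\<psi> v \<in> homog m j" using \<psi>(2) by blast
    then show "v \<in> \<theta> ` homog m j" using 2[OF homog_carrier[OF v]] by (metis imageI)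
  qed
  ultimately show ?thesis using \<theta>(1,3) by blast
qed

section \<open>The irrelevant ideal\<close>

lemma irrelevant_ideal_carrier: "irrelevant_ideal A \<subseteq> carrier A"
  and irrelevant_ideal_ideal: "ideal (irrelevant_ideal A) A"
  and irrelevant_ideal_zero: "a \<in> irrelevant_ideal A \<Longrightarrow> a 0 = filtration R I S (Suc 0)"
proof -
  interpret Ac: cring A by (rule gr_cring)
  have sub: "(\<Union>j\<in>{0<..}. ring_grade A j) \<subseteq> carrier A" using grade_closed by auto
  show id: "ideal (irrelevant_ideal A) A" unfolding irrelevant_ideal_def by (rule Ac.genideal_ideal[OF sub])
  show "irrelevant_ideal A \<subseteq> carrier A" using ideal.Icarr[OF id] by (rule subsetI)
  \<comment> \<open>The elements without component of degree 0. They form an ideal containing all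
    components of positive degree, hence containing the irrelevant ideal.\<close>
  let ?J = "{a \<in> carrier (gr S). a 0 = filtration R I S (Suc 0)}"
  interpret SM: module R S by (rule S_module)
  have rep: "\<exists>x. fin_seq S x \<and> seq S x \<and> u = cl S x \<and> x 0 \<in> filtration R I S (Suc 0)" if "u \<in> ?J" for u
  proof -
    obtain x where x: "fin_seq S x" "seq S x" "u = cl S x" using gr_elem[OF S_module] \<open>u \<in> ?J\<close> by blast
    then show ?thesis using coset_eq_self_iff[OF S_module seq_carrier[OF S_module x(2)], of "Suc 0" 0] that by (auto simp: cl_def)
  qed
  have memI: "cl S x \<in> ?J" if "fin_seq S x" "x 0 \<in> filtration R I S (Suc 0)" for x
    using that cl_closed[OF S_module that(1)] coset_eq_self_iff[OF S_module seq_carrier[OF S_module fin_seq_seq[OF that(1)]], of "Suc 0" 0]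
    by (simp add: cl_def)
  have J: "ideal ?J A"
  proof (rule idealI)
    show "ring A" by (rule Ac.ring_axioms)
    have mult: "a \<odot>\<^bsub>gr S\<^esub> u \<in> ?J" if a: "a \<in> carrier (gr S)" and u: "u \<in> ?J" for a u
    proof -
      obtain x where x: "fin_seq S x" "seq S x" "u = cl S x" "x 0 \<in> filtration R I S (Suc 0)" using rep[OF u] by blast
      obtain r where r: "fin_seq S r" "seq S r" "a = cl S r" by (rule gr_elem[OF S_module a])
      have rc: "r 0 \<in> carrier R" using seq_carrier[OF S_module r(2)] by simp
      have "x 0 \<in> carrier R" using seq_carrier[OF S_module x(2)] by simp
      then have "conv S r x 0 = r 0 \<odot>\<^bsub>S\<^esub> x 0" using rc by (simp add: conv_def)
      then have "conv S r x 0 \<in> filtration R I S (Suc 0)"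
        using SM.submoduleE(4)[OF filt_submodule[OF S_module] rc x(4)] by simp
      then show ?thesis using memI[OF fin_seq_conv[OF S_module r(1) x(1)]] x r by (simp add: gr_smult[OF S_module])
    qed
    fix a x assume ax: "a \<in> ?J" "x \<in> carrier A"
    then show "x \<otimes>\<^bsub>A\<^esub> a \<in> ?J" using mult[of x a] by simp
    then show "a \<otimes>\<^bsub>A\<^esub> x \<in> ?J" using ax gr_smult_comm[of a x] by simp
  next
    show "subgroup ?J (add_monoid A)"
    proof (rule Ac.add.subgroupI)
      show "?J \<subseteq> carrier A" by auto
      show "?J \<noteq> {}" using gr_zero_apply[of S 0] Ac.zero_closed by auto
      fix u assume u: "u \<in> ?J"
      then obtain x where x: "fin_seq S x" "seq S x" "u = cl S x" "x 0 \<in> filtration R I S (Suc 0)" using rep by blast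
      { fix v assume "v \<in> ?J"
        then obtain y where y: "fin_seq S y" "seq S y" "v = cl S y" "y 0 \<in> filtration R I S (Suc 0)" using rep by blast
        show "u \<oplus>\<^bsub>A\<^esub> v \<in> ?J"
          using x y memI[OF fin_seq_add[OF S_module x(1) y(1)]] SM.submoduleE(5)[OF filt_submodule[OF S_module] x(4) y(4)]
          by (simp add: gr_add[OF S_module]) }
      have uc: "u \<in> carrier A" using u by simp
      obtain y where y: "fin_seq S y" "seq S y" "\<ominus>\<^bsub>A\<^esub> u = cl S y" using gr_elem[OF S_module, of "\<ominus>\<^bsub>A\<^esub> u"] Ac.a_inv_closed[OF uc] by auto
      have "cl S y \<oplus>\<^bsub>gr S\<^esub> cl S x = \<zero>\<^bsub>gr S\<^esub>" using Ac.l_neg[OF uc] y x by simp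
      then have "cl S (\<lambda>i. y i \<oplus> x i) 0 = filtration R I S (Suc 0)"
        using x y gr_zero_apply[of S 0] by (simp add: gr_add[OF S_module])
      then have "y 0 \<oplus> x 0 \<in> filtration R I S (Suc 0)"
        using coset_eq_self_iff[OF S_module, of "y 0 \<oplus> x 0" "Suc 0"] seq_carrier[OF S_module y(2)] seq_carrier[OF S_module x(2)] by (simp add: cl_def)
      then have "(y 0 \<oplus>\<^bsub>S\<^esub> x 0) \<ominus>\<^bsub>S\<^esub> x 0 \<in> filtration R I S (Suc 0)"
        using submodule_minus[OF S_module filt_submodule[OF S_module] _ x(4)] by simp
      moreover have "(y 0 \<oplus>\<^bsub>S\<^esub> x 0) \<ominus>\<^bsub>S\<^esub> x 0 = y 0"
        using seq_carrier[OF S_module y(2), of 0] seq_carrier[OF S_module x(2), of 0] by (simp only: SM.minus_eq SM.a_assoc SM.a_inv_closed SM.r_neg SM.r_zero)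
      ultimately show "\<ominus>\<^bsub>A\<^esub> u \<in> ?J" using memI[OF y(1)] y(3) by simp
    qed
  qed
  have "(\<Union>j\<in>{0<..}. ring_grade A j) \<subseteq> ?J" by (auto simp: gr_grade)
  then have "irrelevant_ideal A \<subseteq> ?J" unfolding irrelevant_ideal_def by (rule Ac.genideal_minimal[OF J])
  then show "a \<in> irrelevant_ideal A \<Longrightarrow> a 0 = filtration R I S (Suc 0)" by blast
qed

lemma irrelevant_smult_zero:
  assumes "v \<in> ideal_smult A (irrelevant_ideal A) (AF n)" "k < n"
  shows "v k 0 = filtration R I S (Suc 0)"
  using assms irrelevant_ideal_zero cring.ideal_smult_free[OF gr_cring irrelevant_ideal_ideal, of n]
  by (auto simp: PiE_iff)

text \<open>Minimality over A: coordinates in the irrelevant ideal have no part of degree 0, and a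
  vector of degree 0 has no other part. It shows that D in \<open>strict_hom_lift\<close> is
  injective in degree 0.\<close>

lemma irrelevant_smult_homog:
  assumes "v \<in> ideal_smult A (irrelevant_ideal A) (AF n)" "v \<in> homog n 0"
  shows "v = \<zero>\<^bsub>AF n\<^esub>"
proof (rule PiE_ext[of _ "{..<n}" "\<lambda>_. carrier A"])
  show "v \<in> {..<n} \<rightarrow>\<^sub>E carrier A" using homog_carrier[OF assms(2)] by simp
  show "\<zero>\<^bsub>AF n\<^esub> \<in> {..<n} \<rightarrow>\<^sub>E carrier A" using abelian_groupE(2)[OF module.axioms(2)[OF AF_module[of n]]] by simp
  fix k assume "k \<in> {..<n}"
  then have k: "k < n" by simp
  then have "v k \<in> grade (gr S) 0" using assms(2) by auto
  then have "v k i = filtration R I S (Suc i)" for i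
    using irrelevant_smult_zero[OF assms(1) k] by (cases "i = 0") (auto simp: gr_grade)
  then show "v k = \<zero>\<^bsub>AF n\<^esub> k" using k gr_zeroI[of "v k" S] by simp
qed

text \<open>One stage of the comparison. D and the map induced by f cover the same graded module,
  both with generators placed in degree s, and minimality on either side makes both injective on the
  degree 0 part of their source, so \<open>degree_zero_iso\<close> applies.\<close>

theorem strict_hom_lift:
  assumes L: "module R L" and f: "strict_hom (F n) L s f"
    and kf: "{x \<in> carrier (F n). f x = \<zero>\<^bsub>L\<^esub>} \<subseteq> filtration R I (F n) 1"
    and D: "D \<in> module_hom A (AF m) (gr L)" and Dg: "\<And>k. k < m \<Longrightarrow> D (unit_vec A m k) \<in> grade (gr L) (int s)"
    and img: "D ` carrier (AF m) = gr_shift L s f ` carrier (gr (F n))"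
    and kD: "{v \<in> carrier (AF m). D v = \<zero>\<^bsub>gr L\<^esub>} \<subseteq> ideal_smult A (irrelevant_ideal A) (AF m)"
  shows "\<exists>h. h \<in> module_hom A (AF m) (gr (F n)) \<and> bij_betw h (carrier (AF m)) (carrier (gr (F n))) \<and>
     (\<forall>j. h ` homog m j = grade (gr (F n)) j) \<and> (\<forall>v\<in>carrier (AF m). gr_shift L s f (h v) = D v)"
proof -
  have fh: "f \<in> module_hom R (F n) L" and fs: "f ` carrier (F n) \<subseteq> filtration R I L s"
    using f by (auto simp: strict_hom_def)
  note gh = gr_shift_hom[OF F_module L fh fs] and gg = gr_shift_grade[OF F_module L fh fs]
  \<comment> \<open>The induced map read in coordinates, so that both covers have a free module A^k
    as source.\<close>
  define f' where "f' = gr_shift L s f \<circ> gr_of_coords n"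
  have f'h: "f' \<in> module_hom A (AF n) (gr L)" unfolding f'_def by (rule module_hom_comp[OF gr_of_coords_hom gh])
  have cg: "gr_of_coords n v \<in> grade (gr (F n)) j" if "v \<in> homog n j" for v j
    using gr_of_coords_grade[of n j] that by blast
  have f'g: "f' (unit_vec A n k) \<in> grade (gr L) (int s)" for k
    using gg[OF cg[OF unit_vec_homog[of n k]]] by (simp add: f'_def)
  have img': "f' ` carrier (AF n) = gr_shift L s f ` carrier (gr (F n))"
    using gr_of_coords_bij[of n] by (metis bij_betw_def f'_def image_comp)
  have f0: "v = \<zero>\<^bsub>AF n\<^esub>" if v: "v \<in> homog n 0" "f' v = \<zero>\<^bsub>gr L\<^esub>" for v
  proof -
    have g: "gr_of_coords n v \<in> grade (gr (F n)) 0" by (rule cg[OF v(1)])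
    then have "gr_of_coords n v \<in> initial_module (F n) {x \<in> carrier (F n). f x = \<zero>\<^bsub>L\<^esub>}"
      using gr_shift_kernel[OF F_module L f] v(2) grade_closed[OF g] by (auto simp: f'_def)
    then have "gr_of_coords n v = \<zero>\<^bsub>gr (F n)\<^esub>" by (rule initial_module_grade_0[OF F_module kf _ g])
    then have "gr_of_coords n v = gr_of_coords n \<zero>\<^bsub>AF n\<^esub>"
      using module_hom_zero[OF AF_module gr_module_module[OF F_module] gr_of_coords_hom] by simp
    then show ?thesis
      by (rule inj_onD[OF bij_betw_imp_inj_on[OF gr_of_coords_bij] _ homog_carrier[OF v(1)] abelian_groupE(2)[OF module.axioms(2)[OF AF_module[of n]]]])
  qed
  have D0: "v = \<zero>\<^bsub>AF m\<^esub>" if "v \<in> homog m 0" "D v = \<zero>\<^bsub>gr L\<^esub>" for v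
    using irrelevant_smult_homog[of v m] kD that homog_carrier[OF that(1)] by blast
  obtain \<theta> where \<theta>: "\<theta> \<in> module_hom A (AF m) (AF n)" "bij_betw \<theta> (carrier (AF m)) (carrier (AF n))"
     "\<And>j. \<theta> ` homog m j = homog n j" "\<And>v. v \<in> carrier (AF m) \<Longrightarrow> f' (\<theta> v) = D v"
    using degree_zero_iso[OF L f'h D f'g Dg _ f0 D0] img img' by metis
  have "(gr_of_coords n \<circ> \<theta>) ` homog m j = grade (gr (F n)) j" for j
    using \<theta>(3)[of j] gr_of_coords_grade[of n j] by (metis image_comp)
  moreover have "gr_shift L s f ((gr_of_coords n \<circ> \<theta>) v) = D v" if "v \<in> carrier (AF m)" for v
    using \<theta>(4)[OF that] by (simp add: f'_def)
  ultimately show ?thesis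
    using module_hom_comp[OF \<theta>(1) gr_of_coords_hom] bij_betw_trans[OF \<theta>(2) gr_of_coords_bij] by blast
qed

end

section \<open>Orders of matrices and degrees of generators\<close>

lemma matrix_map_unit_vec:
  assumes "cring R" "\<And>i j. i < n \<Longrightarrow> j < m \<Longrightarrow> a i j \<in> carrier R" "j < m"
  shows "matrix_map R n m a (unit_vec R m j) = (\<lambda>i\<in>{..<n}. a i j)"
proof -
  interpret cring R by fact
  have "(\<Oplus>\<^bsub>R\<^esub>k\<in>{..<m}. a i k \<otimes>\<^bsub>R\<^esub> unit_vec R m j k) = a i j" if i: "i < n" for i
  proof -
    have "(\<Oplus>\<^bsub>R\<^esub>k\<in>{..<m}. a i k \<otimes>\<^bsub>R\<^esub> unit_vec R m j k) = (\<Oplus>\<^bsub>R\<^esub>k\<in>{..<m}. if j = k then a i k else \<zero>\<^bsub>R\<^esub>)"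
      using assms(2)[OF i] assms(3) by (intro finsum_cong') (auto simp: unit_vec_def)
    also have "\<dots> = a i j" using assms(2)[OF i] assms(3) by (intro finsum_singleton) auto
    finally show ?thesis .
  qed
  then show ?thesis by (auto simp: matrix_map_def)
qed

context adic
begin

text \<open>The columns are the images of the unit vectors. Hence the order of a matrix can be read
  off from the image of its map.\<close>

lemma matrix_map_filtration_iff:
  assumes "\<And>i j. i < n \<Longrightarrow> j < m \<Longrightarrow> a i j \<in> carrier R"
  shows "matrix_map R n m a ` carrier (F m) \<subseteq> filtration R I (F n) s \<longleftrightarrow> (\<forall>i<n. \<forall>j<m. a i j \<in> ideal_power R I s)"
proof
  assume sub: "matrix_map R n m a ` carrier (F m) \<subseteq> filtration R I (F n) s"
  show "\<forall>i<n. \<forall>j<m. a i j \<in> ideal_power R I s"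
  proof (intro allI impI)
    fix i j assume ij: "i < n" "j < m"
    have "matrix_map R n m a (unit_vec R m j) \<in> filtration R I (F n) s"
      using sub unit_vec_closed[OF is_cring, of m j] by (auto simp: image_subset_iff)
    then show "a i j \<in> ideal_power R I s"
      using ij matrix_map_unit_vec[OF is_cring assms ij(2)] by (auto simp: filt_free PiE_iff)
  qed
next
  assume a: "\<forall>i<n. \<forall>j<m. a i j \<in> ideal_power R I s"
  show "matrix_map R n m a ` carrier (F m) \<subseteq> filtration R I (F n) s"
  proof
    fix y assume "y \<in> matrix_map R n m a ` carrier (F m)"
    then obtain x where x: "x \<in> carrier (F m)" "y = matrix_map R n m a x" by auto
    have "(\<Oplus>j\<in>{..<m}. a i j \<otimes> x j) \<in> ideal_power R I s" if i: "i < n" for i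
    proof -
      have S: "submodule (ideal_power R I s) R S" using submodule_self_module_iff[OF is_cring] power_ideal by blast
      have "a i j \<otimes> x j \<in> ideal_power R I s" if "j < m" for j
        using a i that x(1) by (intro ideal.I_r_closed[OF power_ideal]) auto
      then show ?thesis using submodule_finsum[OF S_module S, of "{..<m}" "\<lambda>j. a i j \<otimes> x j"] by (simp add: finsum_S)
    qed
    then show "y \<in> filtration R I (F n) s" using x(2) by (auto simp: matrix_map_def filt_free)
  qed
qed

lemma matrix_order_eq:
  assumes "\<And>i j. i < n \<Longrightarrow> j < m \<Longrightarrow> a i j \<in> carrier R"
    "matrix_map R n m a ` carrier (F m) \<subseteq> filtration R I (F n) s"
    "\<not> matrix_map R n m a ` carrier (F m) \<subseteq> filtration R I (F n) (Suc s)"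
  shows "matrix_order R I n m a = s"
  unfolding matrix_order_def
proof (rule Greatest_equality)
  show "\<forall>i<n. \<forall>j<m. a i j \<in> ideal_power R I s"
    using assms(2) matrix_map_filtration_iff[of n m a s, OF assms(1)] by blast
  fix t assume t: "\<forall>i<n. \<forall>j<m. a i j \<in> ideal_power R I t"
  show "t \<le> s"
  proof (rule ccontr)
    assume "\<not> t \<le> s"
    then have "\<forall>i<n. \<forall>j<m. a i j \<in> ideal_power R I (Suc s)" using t power_antimono[of "Suc s" t] by auto
    then show False using assms(3) matrix_map_filtration_iff[of n m a "Suc s", OF assms(1)] by blast
  qed
qed

text \<open>A has no negative degrees, so nothing below degree t can be produced from generators of
  degree t. The degree t is an integer because it will be a difference of twists, whose sign is not
  known beforehand.\<close>

lemma lin_comb_below_degree: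
  assumes L: "module R L" and D: "D \<in> module_hom A (AF m) (gr L)"
    and Dg: "\<And>k. k < m \<Longrightarrow> D (unit_vec A m k) \<in> grade (gr L) t" and x: "x \<in> carrier (AF m)" and i: "int i < t"
  shows "D x i = filtration R I L (Suc i)"
proof -
  interpret G: module A "gr L" by (rule gr_module_module[OF L])
  have t: "t = int (nat t)" using i by simp
  let ?Y = "{u \<in> carrier (gr L). u i = filtration R I L (Suc i)}"
  obtain a where a: "\<forall>k<m. fin_seq S (a k)" "\<forall>k<m. seq S (a k)" "x = (\<lambda>k\<in>{..<m}. cl S (a k))"
    by (rule free_A_elem[OF x])
  have "D x = (\<Oplus>\<^bsub>gr L\<^esub>k\<in>{..<m}. x k \<odot>\<^bsub>gr L\<^esub> D (unit_vec A m k))"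
    by (rule free_module_hom_expand[OF gr_cring G.module_axioms D x])
  moreover have "(\<Oplus>\<^bsub>gr L\<^esub>k\<in>K. x k \<odot>\<^bsub>gr L\<^esub> D (unit_vec A m k)) \<in> ?Y" if "finite K" "K \<subseteq> {..<m}" for K
    using that
  proof (induction K)
    case empty
    have "\<zero>\<^bsub>gr L\<^esub> \<in> ?Y" using G.zero_closed gr_zero_apply[of L i] by blast
    then show ?case by (simp only: G.finsum_empty)
  next
    case (insert k K)
    have k: "k < m" using insert.prems by auto
    have xc: "x j \<odot>\<^bsub>gr L\<^esub> D (unit_vec A m j) \<in> carrier (gr L)" if "j < m" for j
      using x that grade_closed[OF Dg[OF that]] by (intro G.smult_closed) auto
    obtain y where y: "y \<in> filtration R I L (nat t)" "D (unit_vec A m k) = cl L (single L (nat t) y)"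
      using grade_elem[OF L, of "D (unit_vec A m k)" "nat t"] Dg[OF k] t by metis
    have "x k \<odot>\<^bsub>gr L\<^esub> D (unit_vec A m k) = cl L (conv L (a k) (single L (nat t) y))"
      using k a(2) y(2) by (simp add: a(3) gr_smult[OF L] fin_seq_seq[OF fin_seq_single[OF L y(1)]])
    moreover have "i < nat t" using i by linarith
    ultimately have xi: "(x k \<odot>\<^bsub>gr L\<^esub> D (unit_vec A m k)) i = filtration R I L (Suc i) +>\<^bsub>L\<^esub> \<zero>\<^bsub>L\<^esub>"
      using conv_single_right[OF L y(1), of "a k"] a(2) k by (simp add: cl_def)
    have IH: "(\<Oplus>\<^bsub>gr L\<^esub>k\<in>K. x k \<odot>\<^bsub>gr L\<^esub> D (unit_vec A m k)) \<in> ?Y" using insert by auto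
    obtain p where p: "seq L p" "x k \<odot>\<^bsub>gr L\<^esub> D (unit_vec A m k) = cl L p" using gr_elem[OF L xc[OF k]] by metis
    obtain q where q: "seq L q" "(\<Oplus>\<^bsub>gr L\<^esub>k\<in>K. x k \<odot>\<^bsub>gr L\<^esub> D (unit_vec A m k)) = cl L q" using gr_elem[OF L] IH by blast
    interpret L: module R L by (rule L)
    have "p i \<in> filtration R I L (Suc i)" "q i \<in> filtration R I L (Suc i)"
      using xi p(2) q(2) IH coset_eq_self_iff[OF L seq_carrier[OF L p(1)], of "Suc i" i] coset_eq_self_iff[OF L seq_carrier[OF L q(1)], of "Suc i" i]
        coset_eq_self_iff[OF L L.zero_closed, of "Suc i"] submodule_zero[OF L filt_submodule[OF L]] by (auto simp: cl_def)
    then have pq: "p i \<oplus>\<^bsub>L\<^esub> q i \<in> filtration R I L (Suc i)" by (rule L.submoduleE(5)[OF filt_submodule[OF L]])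
    have sum: "(\<Oplus>\<^bsub>gr L\<^esub>k\<in>insert k K. x k \<odot>\<^bsub>gr L\<^esub> D (unit_vec A m k)) = cl L p \<oplus>\<^bsub>gr L\<^esub> cl L q"
      unfolding p(2)[symmetric] q(2)[symmetric] using insert xc by (intro G.finsum_insert) auto
    have "(cl L p \<oplus>\<^bsub>gr L\<^esub> cl L q) i = filtration R I L (Suc i)"
      using pq coset_eq_self_iff[OF L, of "p i \<oplus>\<^bsub>L\<^esub> q i" "Suc i"] seq_carrier[OF L p(1), of i] seq_carrier[OF L q(1), of i]
      unfolding gr_add[OF L p(1) q(1)] by (simp add: cl_def)
    moreover have "cl L p \<oplus>\<^bsub>gr L\<^esub> cl L q \<in> carrier (gr L)"
      unfolding p(2)[symmetric] using IH q(2) xc[OF k] by (intro G.a_closed) auto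
    ultimately show ?case unfolding sum by blast
  qed
  ultimately show ?thesis by auto
qed

lemma unit_vec_not_filtration:
  assumes "\<one> \<notin> I" "k < n"
  shows "unit_vec R n k \<notin> filtration R I (F n) (Suc 0)"
proof
  assume "unit_vec R n k \<in> filtration R I (F n) (Suc 0)"
  then have "unit_vec R n k k \<in> ideal_power R I (Suc 0)" using assms(2) by (auto simp: filt_free simp del: ideal_power.simps)
  then show False using assms power_one by (simp add: unit_vec_def del: ideal_power.simps)
qed

text \<open>In a minimal resolution the kernels lie in the irrelevant multiples of the free modules,
  so no basis element is mapped to zero.\<close>

lemma unit_vec_not_irrelevant:
  assumes "\<one> \<notin> I" "k < n"
  shows "unit_vec A n k \<notin> ideal_smult A (irrelevant_ideal A) (AF n)"
proof
  assume "unit_vec A n k \<in> ideal_smult A (irrelevant_ideal A) (AF n)"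
  then have "unit_vec A n k k 0 = filtration R I S (Suc 0)" by (rule irrelevant_smult_zero[OF _ assms(2)])
  then have "filtration R I S (Suc 0) +>\<^bsub>S\<^esub> \<one> = filtration R I S (Suc 0)" using assms(2) by (simp add: unit_vec_def gr_one cl_def single_def)
  then have "\<one> \<in> ideal_power R I (Suc 0)" using coset_eq_self_iff[OF S_module, of \<one> "Suc 0"] by (simp add: filt_self del: ideal_power.simps)
  then show False using assms(1) power_one by (simp del: ideal_power.simps)
qed

lemma initial_module_mem_single:
  assumes "module R L" "submodule Z R L" "z \<in> Z" "z \<in> filtration R I L i"
  shows "cl L (single L i z) \<in> initial_module L Z"
  using assms fin_seq_single[OF assms(1,4)] submodule_zero[OF assms(1,2)] by (auto simp: initial_module_def single_def)

end

section \<open>Strictness from generation in one degree\<close>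

context noetherian_local
begin

lemma one_notin: "\<one> \<notin> I"
  using maximalideal.I_notcarr[OF maximal] one_imp_carrier by auto

text \<open>The generating degree t comes from the pure resolution and is an integer, so that it is
  nonnegative is part of the claim. The last conclusion says that the image of f has order exactly
  t, which later identifies t with \<open>matrix_order\<close>.\<close>

theorem strict_hom_of_generation:
  assumes f: "f \<in> module_hom R (F n) (F l)" and n: "n > 0"
    and kf: "{x \<in> carrier (F n). f x = \<zero>\<^bsub>F l\<^esub>} \<subseteq> filtration R I (F n) 1"
    and D: "D \<in> module_hom A (AF m) (gr (F l))" and Dg: "\<And>k. k < m \<Longrightarrow> D (unit_vec A m k) \<in> grade (gr (F l)) t"
    and img: "D ` carrier (AF m) = initial_module (F l) (f ` carrier (F n))"
  shows "t \<ge> 0" "strict_hom (F n) (F l) (nat t) f" "\<not> f ` carrier (F n) \<subseteq> filtration R I (F l) (Suc (nat t))"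
proof -
  interpret Fn: module R "F n" by (rule F_module)
  interpret L: module R "F l" by (rule F_module)
  interpret G: module A "gr (F l)" by (rule gr_module_module[OF F_module])
  define Z where "Z = f ` carrier (F n)"
  have Z: "submodule Z R (F l)"
    unfolding Z_def by (rule module_hom_image_submodule[OF F_module F_module f Fn.carrier_is_submodule])
  note EZ = L.submoduleE[OF Z] and EF = L.submoduleE[OF filt_submodule[OF F_module]]
  define g where "g k = D (unit_vec A m k)" for k
  have gg: "g k \<in> grade (gr (F l)) t" if "k < m" for k using Dg[OF that] by (simp add: g_def)
  have D_eq: "D x = (\<Oplus>\<^bsub>gr (F l)\<^esub>k\<in>{..<m}. x k \<odot>\<^bsub>gr (F l)\<^esub> g k)" if "x \<in> carrier (AF m)" for x
    unfolding g_def by (rule free_module_hom_expand[OF gr_cring G.module_axioms D that])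
  \<comment> \<open>If the elements of Z gain one order at each stage below j, then Z lies in I^j F.
    This is used twice: for all j, to find an element with nonzero initial form, and for j = s, to
    bound the order of Z from below.\<close>
  have step_all: "Z \<subseteq> filtration R I (F l) j" if "\<And>i. i < j \<Longrightarrow> Z \<inter> filtration R I (F l) i \<subseteq> filtration R I (F l) (Suc i)" for j
    using that
  proof (induction j)
    case 0
    then show ?case using EZ(1) filt_0[OF F_module] by simp
  next
    case (Suc j)
    then have "Z \<subseteq> filtration R I (F l) j" by simp
    then show ?case using Suc.prems[of j] by blast
  qed
  \<comment> \<open>Z is nonzero because n > 0: a unit vector is not in I F, so it is not in the
    kernel of f.\<close>
  have "\<exists>z\<in>Z. z \<noteq> \<zero>\<^bsub>F l\<^esub>"
  proof (rule bexI[of _ "f (unit_vec R n 0)"])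
    have c: "unit_vec R n 0 \<in> carrier (F n)" using unit_vec_closed[OF is_cring] by simp
    then show "f (unit_vec R n 0) \<in> Z" by (simp add: Z_def)
    show "f (unit_vec R n 0) \<noteq> \<zero>\<^bsub>F l\<^esub>" using kf c unit_vec_not_filtration[OF one_notin n] by auto
  qed
  then obtain z0 where z0: "z0 \<in> Z" "z0 \<noteq> \<zero>\<^bsub>F l\<^esub>" by blast
  \<comment> \<open>Otherwise Z would lie in every I^j F and vanish by Krull's theorem for the zero
    submodule. The element found has a nonzero initial form, so D is not zero and some generator is
    not zero.\<close>
  have "\<exists>i. \<not> Z \<inter> filtration R I (F l) i \<subseteq> filtration R I (F l) (Suc i)"
  proof (rule ccontr)
    assume "\<not> (\<exists>i. \<not> Z \<inter> filtration R I (F l) i \<subseteq> filtration R I (F l) (Suc i))"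
    then have all: "z0 \<in> filtration R I (F l) j" for j using step_all[of j] z0(1) by blast
    have "submodule {\<zero>\<^bsub>F l\<^esub>} R (F l)" by (rule L.submoduleI) (simp_all del: free_module_simps)
    then have "z0 \<in> {\<zero>\<^bsub>F l\<^esub>}"
    proof (rule krull_intersection)
      fix j
      have "z0 = \<zero>\<^bsub>F l\<^esub> \<oplus>\<^bsub>F l\<^esub> z0" using L.l_zero[of z0] EZ(1) z0(1) by auto
      then show "\<exists>y\<in>{\<zero>\<^bsub>F l\<^esub>}. \<exists>z\<in>filtration R I (F l) j. z0 = y \<oplus>\<^bsub>F l\<^esub> z" using all[of j] by blast
    qed
    then show False using z0(2) by simp
  qed
  then obtain i1 z1 where z1: "z1 \<in> Z" "z1 \<in> filtration R I (F l) i1" "z1 \<notin> filtration R I (F l) (Suc i1)" by blast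
  have D_ne: False if "\<And>x. x \<in> carrier (AF m) \<Longrightarrow> D x = \<zero>\<^bsub>gr (F l)\<^esub>"
  proof -
    have "cl (F l) (single (F l) i1 z1) \<in> D ` carrier (AF m)" unfolding img using initial_module_mem_single[OF F_module Z z1(1,2)] by (simp add: Z_def)
    then have "cl (F l) (single (F l) i1 z1) i1 = filtration R I (F l) (Suc i1)" using that by (auto simp: gr_zero_apply)
    then show False using z1(3) coset_eq_self_iff[OF F_module filt_carrier[OF F_module z1(2)]] by (simp add: cl_def single_def)
  qed
  have D0: "D x = \<zero>\<^bsub>gr (F l)\<^esub>" if "\<And>k. k < m \<Longrightarrow> g k = \<zero>\<^bsub>gr (F l)\<^esub>" "x \<in> carrier (AF m)" for x
  proof -
    have "D x = (\<Oplus>\<^bsub>gr (F l)\<^esub>k\<in>{..<m}. \<zero>\<^bsub>gr (F l)\<^esub>)"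
      unfolding D_eq[OF that(2)]
    proof (rule G.finsum_cong')
      fix k assume "k \<in> {..<m}"
      then have "x k \<in> carrier A" "g k = \<zero>\<^bsub>gr (F l)\<^esub>" using that(2) by (auto intro: that(1))
      then show "x k \<odot>\<^bsub>gr (F l)\<^esub> g k = \<zero>\<^bsub>gr (F l)\<^esub>" by (simp only: G.smult_r_null)
    qed simp_all
    then show ?thesis by simp
  qed
  show t0: "t \<ge> 0"
  proof (rule ccontr)
    assume "\<not> t \<ge> 0"
    then have "g k = \<zero>\<^bsub>gr (F l)\<^esub>" if "k < m" for k using grade_neg[OF gg[OF that]] by simp
    then show False using D0 D_ne by blast
  qed
  define s where "s = nat t"
  have ts: "t = int s" using t0 by (simp add: s_def)
  \<comment> \<open>The generator is homogeneous of degree s, so of a representative with entries in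
    Z only the entry at s matters.\<close>
  have "\<exists>y. y \<in> Z \<and> y \<in> filtration R I (F l) s \<and> g k = cl (F l) (single (F l) s y)" if k: "k < m" for k
  proof -
    have "g k \<in> initial_module (F l) Z"
      unfolding g_def Z_def using img unit_vec_closed[OF gr_cring, of m k] by (auto simp: image_subset_iff)
    then obtain x where x: "fin_seq (F l) x" "\<And>i. x i \<in> Z" "g k = cl (F l) x" by (auto simp: initial_module_def)
    have "g k = cl (F l) (single (F l) s (x s))"
    proof
      fix i show "g k i = cl (F l) (single (F l) s (x s)) i"
        using gg[OF k] x(3) ts coset_eq_self_iff[OF F_module L.zero_closed, of "Suc i"] submodule_zero[OF F_module filt_submodule[OF F_module]]
        by (cases "i = s") (auto simp: gr_grade cl_def single_def simp del: free_module_simps)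
    qed
    then show ?thesis using x(2) seqD[OF fin_seq_seq[OF x(1)]] by blast
  qed
  then have "\<forall>k\<in>{..<m}. \<exists>y. y \<in> Z \<and> y \<in> filtration R I (F l) s \<and> g k = cl (F l) (single (F l) s y)" by simp
  then obtain y where y: "\<forall>k\<in>{..<m}. y k \<in> Z \<and> y k \<in> filtration R I (F l) s \<and> g k = cl (F l) (single (F l) s (y k))" by metis
  have y1: "y k \<in> Z" and y2: "y k \<in> filtration R I (F l) s" and y3: "g k = cl (F l) (single (F l) s (y k))" if "k < m" for k
    using y that by auto
  show "\<not> f ` carrier (F n) \<subseteq> filtration R I (F l) (Suc (nat t))"
  proof
    assume "f ` carrier (F n) \<subseteq> filtration R I (F l) (Suc (nat t))"
    then have sub: "Z \<subseteq> filtration R I (F l) (Suc s)" by (simp add: s_def Z_def)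
    have "g k = \<zero>\<^bsub>gr (F l)\<^esub>" if k: "k < m" for k
    proof (rule gr_zeroI)
      fix i
      have "y k \<in> filtration R I (F l) (Suc s)" using sub y1[OF k] by blast
      then show "g k i = filtration R I (F l) (Suc i)"
        using y3[OF k] coset_eq_self_iff[OF F_module filt_carrier[OF F_module y2[OF k]], of "Suc s"]
          coset_eq_self_iff[OF F_module L.zero_closed, of "Suc i"] submodule_zero[OF F_module filt_submodule[OF F_module], of l "Suc i"]
        by (simp add: cl_def single_def del: free_module_simps)
    qed
    then show False using D0 D_ne by blast
  qed
  have Zs: "Z \<subseteq> filtration R I (F l) s"
  proof (rule step_all)
    fix i assume i: "i < s"
    show "Z \<inter> filtration R I (F l) i \<subseteq> filtration R I (F l) (Suc i)"
    proof
      fix z assume z: "z \<in> Z \<inter> filtration R I (F l) i"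
      then have "cl (F l) (single (F l) i z) \<in> D ` carrier (AF m)" unfolding img using initial_module_mem_single[OF F_module Z] by (simp add: Z_def)
      then obtain x where x: "x \<in> carrier (AF m)" "cl (F l) (single (F l) i z) = D x" by blast
      have "D x i = filtration R I (F l) (Suc i)" using lin_comb_below_degree[OF F_module D Dg x(1)] i ts by simp
      then have "filtration R I (F l) (Suc i) +>\<^bsub>F l\<^esub> z = filtration R I (F l) (Suc i)" unfolding x(2)[symmetric] by (simp add: cl_def single_def)
      then show "z \<in> filtration R I (F l) (Suc i)" using z coset_eq_self_iff[OF F_module filt_carrier[OF F_module]] by blast
    qed
  qed
  \<comment> \<open>This is I^i Z, written as an image because Z is a subset and not a module
    record.\<close>
  define W where "W i = f ` filtration R I (F n) i" for i
  have Ws: "submodule (W i) R (F l)" for i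
    unfolding W_def by (rule module_hom_image_submodule[OF F_module F_module f filt_submodule[OF F_module]])
  have WZ: "W i \<subseteq> Z" for i using filt_carrier[OF F_module] by (auto simp: W_def Z_def simp del: free_module_simps)
  have W_mono: "i \<le> j \<Longrightarrow> W j \<subseteq> W i" for i j unfolding W_def by (rule image_mono[OF filt_antimono])
  have one_step: "\<exists>w\<in>W i. z \<ominus>\<^bsub>F l\<^esub> w \<in> filtration R I (F l) (Suc (s + i))" if z: "z \<in> Z" "z \<in> filtration R I (F l) (s + i)" for z i
  proof -
    have "cl (F l) (single (F l) (s + i) z) \<in> D ` carrier (AF m)" unfolding img using initial_module_mem_single[OF F_module Z z] by (simp add: Z_def)
    then obtain x where x: "x \<in> carrier (AF m)" "cl (F l) (single (F l) (s + i) z) = D x" by blast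
    obtain a where a: "\<forall>k<m. fin_seq S (a k)" "\<forall>k<m. seq S (a k)" "x = (\<lambda>k\<in>{..<m}. cl S (a k))"
      by (rule free_A_elem[OF x(1)])
    let ?c = "\<lambda>k i. if i < s then \<zero>\<^bsub>F l\<^esub> else a k (i - s) \<odot>\<^bsub>F l\<^esub> y k"
    have c: "x k \<odot>\<^bsub>gr (F l)\<^esub> g k = cl (F l) (?c k) \<and> fin_seq (F l) (?c k)" if k: "k < m" for k
    proof -
      have cv: "conv (F l) (a k) (single (F l) s (y k)) = ?c k"
        using conv_single_right[OF F_module y2[OF k], of "a k"] a(2) k by blast
      have "x k \<odot>\<^bsub>gr (F l)\<^esub> g k = cl (F l) (conv (F l) (a k) (single (F l) s (y k)))"
        using k a by (simp add: y3 gr_smult[OF F_module] fin_seq_seq[OF fin_seq_single[OF F_module y2]])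
      moreover have "fin_seq (F l) (conv (F l) (a k) (single (F l) s (y k)))"
        using a(1) k by (intro fin_seq_conv[OF F_module] fin_seq_single[OF F_module y2]) auto
      ultimately show ?thesis unfolding cv by blast
    qed
    \<comment> \<open>The part of D x in degree s + i: the generators have degree s, so only the
      coefficients a k i, which lie in I^i, contribute.\<close>
    define w where "w = (\<Oplus>\<^bsub>F l\<^esub>k\<in>{..<m}. a k i \<odot>\<^bsub>F l\<^esub> y k)"
    have "D x = (\<Oplus>\<^bsub>gr (F l)\<^esub>k\<in>{..<m}. cl (F l) (?c k))"
      unfolding D_eq[OF x(1)] using c cl_closed[OF F_module] by (intro G.finsum_cong') auto
    also have "\<dots> = cl (F l) (\<lambda>i. \<Oplus>\<^bsub>F l\<^esub>k\<in>{..<m}. ?c k i)"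
      using finsum_gr(1)[OF F_module[of l], of "{..<m}" ?c] c by simp
    finally have "D x (s + i) = filtration R I (F l) (Suc (s + i)) +>\<^bsub>F l\<^esub> w"
      by (simp add: cl_def w_def del: free_module_simps)
    then have eq: "filtration R I (F l) (Suc (s + i)) +>\<^bsub>F l\<^esub> z = filtration R I (F l) (Suc (s + i)) +>\<^bsub>F l\<^esub> w"
      unfolding x(2)[symmetric] by (simp add: cl_def single_def)
    have w: "w \<in> W i" unfolding w_def
    proof (rule submodule_finsum[OF F_module Ws])
      fix k assume "k \<in> {..<m}"
      then have k: "k < m" by simp
      obtain u where u: "u \<in> carrier (F n)" "y k = f u" using y1[OF k] by (auto simp: Z_def)
      have ai: "a k i \<in> ideal_power R I i" using a(2) k by (simp add: seq_S_iff)
      have "a k i \<odot>\<^bsub>F n\<^esub> u \<in> filtration R I (F n) i" unfolding filtration_def using ai u(1) by (rule ideal_smultI)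
      then have "f (a k i \<odot>\<^bsub>F n\<^esub> u) \<in> W i" unfolding W_def by (rule imageI)
      then show "a k i \<odot>\<^bsub>F l\<^esub> y k \<in> W i" using module_homD(3)[OF f power_carrier[OF ai] u(1)] u(2) by simp
    qed simp
    have "w \<in> carrier (F l)" using w WZ EZ(1) by blast
    then have "z \<ominus>\<^bsub>F l\<^esub> w \<in> filtration R I (F l) (Suc (s + i))"
      using eq coset_eq_iff[OF F_module filt_carrier[OF F_module z(2)]] by blast
    then show ?thesis using w by blast
  qed
  \<comment> \<open>The error is pushed to higher and higher order; the correction at stage j lies
    in W (i + j), hence in W i, so the approximants never leave I^i Z.\<close>
  have approx: "\<exists>w\<in>W i. z \<ominus>\<^bsub>F l\<^esub> w \<in> filtration R I (F l) (s + i + j)" if z: "z \<in> Z" "z \<in> filtration R I (F l) (s + i)" for z i j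
  proof (induction j)
    case 0
    have "\<ominus>\<^bsub>F l\<^esub> \<zero>\<^bsub>F l\<^esub> = \<zero>\<^bsub>F l\<^esub>"
      by (rule L.minus_equality[OF L.r_zero[OF L.zero_closed] L.zero_closed L.zero_closed])
    then have "z \<ominus>\<^bsub>F l\<^esub> \<zero>\<^bsub>F l\<^esub> = z"
      using filt_carrier[OF F_module z(2)] by (simp only: L.minus_eq L.r_zero)
    then show ?case using submodule_zero[OF F_module Ws] z(2) by (intro bexI[of _ "\<zero>\<^bsub>F l\<^esub>"]) (simp_all del: free_module_simps)
  next
    case (Suc j)
    then obtain w where w: "w \<in> W i" "z \<ominus>\<^bsub>F l\<^esub> w \<in> filtration R I (F l) (s + (i + j))" by (auto simp: add.assoc)
    have "z \<ominus>\<^bsub>F l\<^esub> w \<in> Z" using submodule_minus[OF F_module Z z(1)] w(1) WZ by blast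
    from one_step[OF this w(2)] obtain w' where w': "w' \<in> W (i + j)" "(z \<ominus>\<^bsub>F l\<^esub> w) \<ominus>\<^bsub>F l\<^esub> w' \<in> filtration R I (F l) (Suc (s + (i + j)))" by blast
    have c: "z \<in> carrier (F l)" "w \<in> carrier (F l)" "w' \<in> carrier (F l)" using z(1) w(1) w'(1) WZ EZ(1) by blast+
    have "w' \<in> W i" using w'(1) W_mono[of i "i + j"] by auto
    then have "w \<oplus>\<^bsub>F l\<^esub> w' \<in> W i" using w(1) L.submoduleE(5)[OF Ws] by blast
    moreover have "z \<ominus>\<^bsub>F l\<^esub> (w \<oplus>\<^bsub>F l\<^esub> w') = (z \<ominus>\<^bsub>F l\<^esub> w) \<ominus>\<^bsub>F l\<^esub> w'"
      using c by (simp only: L.minus_eq L.minus_add L.a_assoc L.a_inv_closed L.a_closed)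
    ultimately show ?case using w'(2) by (intro bexI[of _ "w \<oplus>\<^bsub>F l\<^esub> w'"]) (simp_all add: add.assoc del: free_module_simps)
  qed
  show "strict_hom (F n) (F l) (nat t) f"
    unfolding strict_hom_def s_def[symmetric]
  proof (intro conjI allI f subsetI)
    show "x \<in> filtration R I (F l) s" if "x \<in> f ` carrier (F n)" for x using that Zs by (auto simp: Z_def)
    fix i z assume "z \<in> f ` carrier (F n) \<inter> filtration R I (F l) (s + i)"
    then have z: "z \<in> Z" "z \<in> filtration R I (F l) (s + i)" by (auto simp: Z_def)
    have "z \<in> W i"
    \<comment> \<open>Krull's theorem is applied to I^i Z, turning the approximations of every order
      into membership.\<close>
    proof (rule krull_intersection[OF Ws])
      fix j
      obtain w where w: "w \<in> W i" "z \<ominus>\<^bsub>F l\<^esub> w \<in> filtration R I (F l) (s + i + j)" using approx[OF z] by blast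
      have c: "z \<in> carrier (F l)" "w \<in> carrier (F l)" using z(1) w(1) WZ EZ(1) by blast+
      have "z \<ominus>\<^bsub>F l\<^esub> w \<in> filtration R I (F l) j" using w(2) filt_antimono[of j "s + i + j" "F l"] by auto
      moreover have "z = w \<oplus>\<^bsub>F l\<^esub> (z \<ominus>\<^bsub>F l\<^esub> w)"
        using L.r_neg2[OF c(2,1)] L.a_comm[OF c(1) L.a_inv_closed[OF c(2)]] by (simp only: L.minus_eq)
      ultimately show "\<exists>y\<in>W i. \<exists>x\<in>filtration R I (F l) j. z = y \<oplus>\<^bsub>F l\<^esub> x" using w(1) by blast
    qed
    then show "z \<in> f ` filtration R I (F n) i" by (simp add: W_def)
  qed
qed

end

lemma image_kernel_eq:
  assumes "h ` A = B" "\<And>v. v \<in> A \<Longrightarrow> g (h v) = e v"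
  shows "h ` {v \<in> A. e v = z} = {u \<in> B. g u = z}"
  using assms by force

context adic
begin

section \<open>The complex of initial forms\<close>

abbreviation term_module :: "(nat \<Rightarrow> nat) \<Rightarrow> (nat \<Rightarrow> nat \<Rightarrow> int) \<Rightarrow> nat \<Rightarrow> (nat \<Rightarrow> 'a set, nat \<Rightarrow> nat \<Rightarrow> 'a set) graded_module" where
  "term_module r b p \<equiv> graded_free A (r p) (b p)"

lemma initial_complex_module: "module A (initial_complex R I n \<phi> p)"
  unfolding initial_complex_def by (rule twist_module[OF gr_module_module[OF F_module]])

lemma initial_complex_simps [simp]:
  "carrier (initial_complex R I n \<phi> p) = carrier (gr (F (n p)))"
  "\<zero>\<^bsub>initial_complex R I n \<phi> p\<^esub> = \<zero>\<^bsub>gr (F (n p))\<^esub>"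
  "grade (initial_complex R I n \<phi> p) j = grade (gr (F (n p))) (j - int (initial_shift R I n \<phi> p))"
  by (simp_all add: initial_complex_def)

lemma module_hom_initial_complex:
  "module_hom A (initial_complex R I n \<phi> p) N = module_hom A (gr (F (n p))) N"
  "module_hom A N (initial_complex R I n \<phi> p) = module_hom A N (gr (F (n p)))"
  by (simp_all add: initial_complex_def module_hom_twist)

theorem pure_if_initial_complex_resolution:
  assumes res: "minimal_graded_free_resolution A L (initial_complex R I n \<phi>) d e"
  shows "has_pure_resolution A L"
proof -
  \<comment> \<open>All basis elements of the p-th term get the degree of its twist. The coordinate
    maps bring the complex into the shape \<open>graded_free\<close> in which
    \<open>has_pure_resolution\<close> is phrased.\<close>
  let ?b = "\<lambda>p (k::nat). int (initial_shift R I n \<phi> p)"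
  let ?P = "initial_complex R I n \<phi>"
  let ?Q = "\<lambda>p. graded_free A (n p) (?b p)"
  let ?h = "\<lambda>p. gr_coords (n p)"
  let ?d = "\<lambda>p x. ?h (p - 1) (d p (gr_of_coords (n p) x))"
  let ?e = "\<lambda>x. e (gr_of_coords (n 0) x)"
  have hom: "?h p \<in> module_hom A (gr (F (n p))) (AF (n p))" for p
    by (rule module_hom_inverse[OF AF_module gr_module_module[OF F_module] gr_of_coords_hom gr_of_coords_bij]) (rule gr_coords_of_coords)
  have bij: "bij_betw (?h p) (carrier (gr (F (n p)))) (carrier (AF (n p)))" for p
    using gr_of_coords_coords gr_coords_of_coords bij_betwE[OF gr_of_coords_bij]
    by (intro bij_betwI[where g = "gr_of_coords (n p)"]) blast+
  have grd: "?h p ` grade (gr (F (n p))) j = homog (n p) j" for p j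
  proof -
    have "?h p ` gr_of_coords (n p) ` homog (n p) j = (\<lambda>x. x) ` homog (n p) j"
      unfolding image_image by (rule image_cong[OF refl gr_coords_of_coords[OF homog_carrier]])
    then show ?thesis unfolding gr_of_coords_grade by simp
  qed
  have 1: "minimal_graded_free_resolution A L ?Q ?d ?e"
  proof (rule minimal_graded_free_resolution_transport[OF res irrelevant_ideal_carrier, where h = ?h])
    show "module A (?Q p)" for p by (rule graded_free_module[OF gr_cring])
    show "?h p \<in> module_hom A (?P p) (?Q p)" for p
      using hom by (simp add: module_hom_initial_complex module_hom_graded_free)
    show "bij_betw (?h p) (carrier (?P p)) (carrier (?Q p))" for p
      using bij by (simp del: free_module_simps)
    show "?h p ` grade (?P p) j = grade (?Q p) j" for p j
      using grd by simp
    show "grade (?P p) j \<subseteq> carrier (?P p)" for p j using grade_closed by auto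
    show "?d (Suc p) (?h (Suc p) x) = ?h p (d (Suc p) x)" if "x \<in> carrier (?P (Suc p))" for p x
      using that gr_of_coords_coords by simp
    show "?e (?h 0 x) = e x" if "x \<in> carrier (?P 0)" for x
      using that gr_of_coords_coords by simp
  qed
  have 2: "\<exists>\<^sub>\<le>\<^sub>1 j. graded_betti n ?b p j \<noteq> 0" for p
    by (rule Uniq_I) (auto simp: graded_betti_def card_eq_0_iff)
  show ?thesis unfolding has_pure_resolution_def
    by (rule exI[of _ n], rule exI[of _ ?b], rule exI[of _ ?d], rule exI[of _ ?e]) (intro conjI allI 1 2)
qed

lemma pure_degree:
  assumes "\<exists>\<^sub>\<le>\<^sub>1 j. graded_betti r b p j \<noteq> 0" "k < r p" "l < r p"
  shows "b p k = b p l"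
proof -
  have "graded_betti r b p (b p i) \<noteq> 0" if "i < r p" for i
    using that by (auto simp: graded_betti_def card_eq_0_iff)
  then show ?thesis using Uniq_D[OF assms(1)] assms(2,3) by blast
qed

end

section \<open>From a pure resolution to the complex of initial forms\<close>

context noetherian_local
begin

text \<open>The isomorphisms \<open>h\<close> from the terms of the pure resolution to the terms of the complex of
  initial forms are constructed by recursion; the invariant says that the image of the next
  differential consists of the initial forms of the next syzygy module.\<close>

theorem initial_complex_resolution_if_pure:
  fixes M :: "('a, 'd, 'o) module_scheme"
  assumes M: "module R M" and F: "minimal_free_resolution R I M n \<phi> \<epsilon>" and pure: "has_pure_resolution A (gr M)"
  shows "minimal_graded_free_resolution A (gr M) (initial_complex R I n \<phi>) (initial_complex_map R I n \<phi>) (gr_map R I M \<epsilon>)"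
proof -
  obtain r b d e where res: "minimal_graded_free_resolution A (gr M) (term_module r b) d e"
    and betti: "\<And>p. \<exists>\<^sub>\<le>\<^sub>1 j. graded_betti r b p j \<noteq> 0"
    using pure unfolding has_pure_resolution_def by blast
  \<comment> \<open>The common degree of the generators of the p-th term. It says nothing when r p =
    0, and therefore the later equations for c are claimed only for terms with a basis
    element.\<close>
  define c where "c p = b p 0" for p
  have bc: "b p k = c p" if k: "k < r p" for p k
    unfolding c_def by (rule pure_degree[OF betti k order.strict_trans1[OF le0 k]])
  let ?P = "term_module r b" and ?Q = "initial_complex R I n \<phi>"
  let ?ord = "\<lambda>p. matrix_order R I (n p) (n (Suc p)) (\<phi> (Suc p))"
  let ?\<delta> = "initial_shift R I n \<phi>"
  have \<delta>: "?\<delta> 0 = 0" "?\<delta> (Suc p) = ?\<delta> p + ?ord p" for p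
    by (simp_all add: initial_shift_def)
  have Pc: "carrier (?P p) = carrier (AF (r p))" and Pg: "grade (?P p) j = homog (r p) (j - c p)"
    and P0: "\<zero>\<^bsub>?P p\<^esub> = \<zero>\<^bsub>AF (r p)\<^esub>" for p j
    using bc[of _ p] by (auto intro!: PiE_cong simp del: free_module_simps)

  define f where "f p = matrix_map R (n p) (n (Suc p)) (\<phi> (Suc p))" for p
  have \<phi>c: "\<phi> (Suc p) i j \<in> carrier R" if "i < n p" "j < n (Suc p)" for p i j
    using F that by (auto simp: minimal_free_resolution_def)
  have Fres: "resolution R M (\<lambda>p. F (n p)) (\<lambda>p. matrix_map R (n (p - 1)) (n p) (\<phi> p)) \<epsilon>"
    and Fmin: "f p ` carrier (F (n (Suc p))) \<subseteq> filtration R I (F (n p)) 1" for p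
    using F by (auto simp: minimal_free_resolution_def filtration_def power_one f_def simp del: ideal_power.simps free_module_simps)
  have fh: "f p \<in> module_hom R (F (n (Suc p))) (F (n p))" for p
    unfolding f_def by (rule matrix_map_hom[OF is_cring \<phi>c])
  have \<epsilon>h: "\<epsilon> \<in> module_hom R (F (n 0)) M" and \<epsilon>s: "\<epsilon> ` carrier (F (n 0)) = carrier M"
    and \<epsilon>k: "{x \<in> carrier (F (n 0)). \<epsilon> x = \<zero>\<^bsub>M\<^esub>} = f 0 ` carrier (F (n (Suc 0)))"
    and fk: "{x \<in> carrier (F (n (Suc p))). f p x = \<zero>\<^bsub>F (n p)\<^esub>} = f (Suc p) ` carrier (F (n (Suc (Suc p))))" for p
    using Fres by (auto simp: resolution_def a_kernel_def' f_def simp del: free_module_simps)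

  have dg: "d (Suc p) \<in> graded_hom A (?P (Suc p)) (?P p)" and eg: "e \<in> graded_hom A (?P 0) (gr M)"
    and Pres: "resolution A (gr M) ?P d e"
    and Pmin: "d (Suc p) ` carrier (?P (Suc p)) \<subseteq> ideal_smult A (irrelevant_ideal A) (?P p)" for p
    using res by (auto simp: minimal_graded_free_resolution_def)
  have dh: "d (Suc p) \<in> module_hom A (AF (r (Suc p))) (AF (r p))" for p
    using dg[of p] by (simp add: graded_hom_def module_hom_graded_free)
  have eh: "e \<in> module_hom A (AF (r 0)) (gr M)"
    using eg by (simp add: graded_hom_def module_hom_graded_free)
  have es: "e ` carrier (AF (r 0)) = carrier (gr M)"
    and ek: "{x \<in> carrier (AF (r 0)). e x = \<zero>\<^bsub>gr M\<^esub>} = d (Suc 0) ` carrier (AF (r (Suc 0)))"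
    and dk: "{x \<in> carrier (AF (r (Suc p))). d (Suc p) x = \<zero>\<^bsub>AF (r p)\<^esub>} = d (Suc (Suc p)) ` carrier (AF (r (Suc (Suc p))))" for p
    using Pres by (auto simp: resolution_def a_kernel_def' Pc P0 simp del: free_module_simps)
  \<comment> \<open>Spans are intersections over submodules of a record. \<open>graded_free\<close>
    and \<open>free_module\<close> are different records with the same operations, so their
    submodules have to be compared first.\<close>
  have smP: "ideal_smult A (irrelevant_ideal A) (?P p) = ideal_smult A (irrelevant_ideal A) (AF (r p))" for p
  proof -
    have "submodule N A (?P p) \<longleftrightarrow> submodule N A (AF (r p))" for N
    proof -
      have "subgroup N (add_monoid (?P p)) \<longleftrightarrow> subgroup N (add_monoid (AF (r p)))"
        by (simp add: subgroup_def m_inv_def del: free_module_simps)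
      then show ?thesis by (simp add: submodule_def submodule_axioms_def del: free_module_simps)
    qed
    then show ?thesis by (simp add: ideal_smult_def submodule_span_def del: free_module_simps)
  qed
  have dmin: "d (Suc p) ` carrier (AF (r (Suc p))) \<subseteq> ideal_smult A (irrelevant_ideal A) (AF (r p))" for p
    using Pmin[of p] unfolding smP Pc .

  let ?inv = "\<lambda>p h. h \<in> module_hom A (AF (r p)) (gr (F (n p))) \<and> bij_betw h (carrier (AF (r p))) (carrier (gr (F (n p)))) \<and>
     (\<forall>j. h ` grade (?P p) j = grade (?Q p) j) \<and>
     h ` d (Suc p) ` carrier (AF (r (Suc p))) = initial_module (F (n p)) (f p ` carrier (F (n (Suc p))))"

  have uP: "unit_vec A (r p) k \<in> grade (?P p) (c p)" for p k
    unfolding Pg using unit_vec_homog by simp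

  have base: "\<exists>h. ?inv 0 h \<and> (\<forall>v\<in>carrier (AF (r 0)). gr_shift M 0 \<epsilon> (h v) = e v)"
  proof -
    \<comment> \<open>A surjection is strict with s = 0, since it maps I^i F onto I^i M.\<close>
    have st: "strict_hom (F (n 0)) M 0 \<epsilon>"
      using \<epsilon>h \<epsilon>s filt_0[OF M] filt_hom_surj[OF F_module M \<epsilon>h \<epsilon>s] by (simp add: strict_hom_def del: free_module_simps)
    have eu: "e (unit_vec A (r 0) k) \<in> grade (gr M) (c 0)" for k
      using eg uP[of 0 k] by (auto simp: graded_hom_def simp del: free_module_simps graded_free_simps)
    \<comment> \<open>A negative c 0 would make e vanish on a basis element, against minimality. If
      c 0 were positive, the graded module of M would have no degree 0 part, so M = I M. Minimality
      of the given resolution then forces n 0 = 0 and M = 0, and e would again vanish on a basis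
      element.\<close>
    have c0: "c 0 = 0" if k: "k < r 0" for k
    proof (rule ccontr)
      assume ne: "c 0 \<noteq> 0"
      have uc: "unit_vec A (r 0) k \<in> carrier (AF (r 0))" using unit_vec_closed[OF gr_cring] by simp
      have nz: "e (unit_vec A (r 0) k) \<noteq> \<zero>\<^bsub>gr M\<^esub>"
      proof
        assume "e (unit_vec A (r 0) k) = \<zero>\<^bsub>gr M\<^esub>"
        then have "unit_vec A (r 0) k \<in> ideal_smult A (irrelevant_ideal A) (AF (r 0))" using ek uc dmin[of 0] by blast
        then show False using unit_vec_not_irrelevant[OF one_notin k] by blast
      qed
      have "c 0 > 0" using nz grade_neg[OF eu] ne by force
      then have low: "u 0 = filtration R I M (Suc 0)" if u: "u \<in> carrier (gr M)" for u
      proof -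
        obtain v where v: "v \<in> carrier (AF (r 0))" "u = e v" using u unfolding es[symmetric] by blast
        show ?thesis unfolding v(2) by (rule lin_comb_below_degree[OF M eh eu v(1)]) (use \<open>c 0 > 0\<close> in simp)
      qed
      have M1: "carrier M \<subseteq> filtration R I M (Suc 0)"
      proof
        fix x assume x: "x \<in> carrier M"
        have "cl M (single M 0 x) 0 = filtration R I M (Suc 0)"
          using x by (intro low cl_closed[OF M] fin_seq_single[OF M]) (simp add: filt_0[OF M])
        then show "x \<in> filtration R I M (Suc 0)" using coset_eq_self_iff[OF M x] by (simp add: cl_def single_def)
      qed
      \<comment> \<open>From M = I M, a unit vector u has the same image as some y in I F. Then u -
        y lies in the kernel of the augmentation, hence in I F by minimality, and so does u, which
        is impossible.\<close>
      have n0: "n 0 = 0"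
      proof (rule ccontr)
        assume "n 0 \<noteq> 0"
        let ?u = "unit_vec R (n 0) 0"
        interpret F0: module R "F (n 0)" by (rule F_module)
        have u: "?u \<in> carrier (F (n 0))" using unit_vec_closed[OF is_cring] by simp
        then have "\<epsilon> ?u \<in> \<epsilon> ` filtration R I (F (n 0)) (Suc 0)"
          using M1 filt_hom_surj[OF F_module M \<epsilon>h \<epsilon>s, of "Suc 0"] module_homD(1)[OF \<epsilon>h u] by blast
        then obtain y where y: "y \<in> filtration R I (F (n 0)) (Suc 0)" "\<epsilon> ?u = \<epsilon> y" by blast
        have yc: "y \<in> carrier (F (n 0))" by (rule filt_carrier[OF F_module y(1)])
        interpret MM: module R M by (rule M)
        have "\<epsilon> (?u \<ominus>\<^bsub>F (n 0)\<^esub> y) = \<zero>\<^bsub>M\<^esub>"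
          using module_hom_minus[OF F_module M \<epsilon>h u yc] y(2) module_homD(1)[OF \<epsilon>h yc] by (simp add: MM.minus_eq MM.r_neg)
        then have "?u \<ominus>\<^bsub>F (n 0)\<^esub> y \<in> {x \<in> carrier (F (n 0)). \<epsilon> x = \<zero>\<^bsub>M\<^esub>}"
          using F0.minus_closed[OF u yc] by blast
        then have "?u \<ominus>\<^bsub>F (n 0)\<^esub> y \<in> filtration R I (F (n 0)) (Suc 0)"
          unfolding \<epsilon>k using Fmin[of 0] unfolding One_nat_def by (rule rev_subsetD)
        then have "(?u \<ominus>\<^bsub>F (n 0)\<^esub> y) \<oplus>\<^bsub>F (n 0)\<^esub> y \<in> filtration R I (F (n 0)) (Suc 0)"
          by (rule F0.submoduleE(5)[OF filt_submodule[OF F_module] _ y(1)])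
        moreover have "(?u \<ominus>\<^bsub>F (n 0)\<^esub> y) \<oplus>\<^bsub>F (n 0)\<^esub> y = ?u"
          using u yc by (simp only: F0.minus_eq F0.a_assoc F0.a_inv_closed F0.l_neg F0.r_zero)
        ultimately show False using unit_vec_not_filtration[OF one_notin, of 0 "n 0"] \<open>n 0 \<noteq> 0\<close> by simp
      qed
      have M0: "x = \<zero>\<^bsub>M\<^esub>" if x: "x \<in> carrier M" for x
      proof -
        obtain y where y: "y \<in> carrier (F (n 0))" "x = \<epsilon> y" using x unfolding \<epsilon>s[symmetric] by blast
        have "carrier (F (n 0)) = {\<zero>\<^bsub>F (n 0)\<^esub>}" unfolding n0 by auto
        then have "y = \<zero>\<^bsub>F (n 0)\<^esub>" using y(1) by blast
        then show ?thesis using y(2) module_hom_zero[OF F_module M \<epsilon>h] by simp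
      qed
      obtain x where x: "seq M x" "e (unit_vec A (r 0) k) = cl M x"
        using gr_elem[OF M module_homD(1)[OF eh uc]] by metis
      have "x = (\<lambda>i. \<zero>\<^bsub>M\<^esub>)" using M0 seq_carrier[OF M x(1)] by auto
      then show False using nz x(2) gr_zero[OF M] by simp
    qed
    have "\<exists>h. h \<in> module_hom A (AF (r 0)) (gr (F (n 0))) \<and> bij_betw h (carrier (AF (r 0))) (carrier (gr (F (n 0)))) \<and>
       (\<forall>j. h ` homog (r 0) j = grade (gr (F (n 0))) j) \<and> (\<forall>v\<in>carrier (AF (r 0)). gr_shift M 0 \<epsilon> (h v) = e v)"
    proof (rule strict_hom_lift[OF M st _ eh])
      show "{x \<in> carrier (F (n 0)). \<epsilon> x = \<zero>\<^bsub>M\<^esub>} \<subseteq> filtration R I (F (n 0)) 1" unfolding \<epsilon>k by (rule Fmin)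
      show "e (unit_vec A (r 0) k) \<in> grade (gr M) (int 0)" if "k < r 0" for k using eu[of k] c0[OF that] by simp
      show "e ` carrier (AF (r 0)) = gr_shift M 0 \<epsilon> ` carrier (gr (F (n 0)))"
        unfolding es gr_shift_image[OF F_module M st] \<epsilon>s gr_carrier[OF M] initial_module_def
        using seq_carrier[OF M] fin_seq_seq by (intro image_cong) auto
      show "{v \<in> carrier (AF (r 0)). e v = \<zero>\<^bsub>gr M\<^esub>} \<subseteq> ideal_smult A (irrelevant_ideal A) (AF (r 0))"
        unfolding ek by (rule dmin)
    qed
    then obtain h where h: "h \<in> module_hom A (AF (r 0)) (gr (F (n 0)))" "bij_betw h (carrier (AF (r 0))) (carrier (gr (F (n 0))))"
       "\<And>j. h ` homog (r 0) j = grade (gr (F (n 0))) j" "\<And>v. v \<in> carrier (AF (r 0)) \<Longrightarrow> gr_shift M 0 \<epsilon> (h v) = e v" by blast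
    have "h ` grade (?P 0) j = grade (?Q 0) j" for j
    proof -
      have "homog (r 0) (j - c 0) = homog (r 0) j" using c0 by (cases "r 0 = 0") auto
      then show ?thesis unfolding Pg using h(3)[of j] by (simp add: \<delta>)
    qed
    moreover have "h ` d (Suc 0) ` carrier (AF (r (Suc 0))) = initial_module (F (n 0)) (f 0 ` carrier (F (n (Suc 0))))"
    proof -
      have "h ` d (Suc 0) ` carrier (AF (r (Suc 0))) = {u \<in> carrier (gr (F (n 0))). gr_shift M 0 \<epsilon> u = \<zero>\<^bsub>gr M\<^esub>}"
        unfolding ek[symmetric] by (rule image_kernel_eq[where g = "gr_shift M 0 \<epsilon>", OF bij_betw_imp_surj_on[OF h(2)] h(4)])
      then show ?thesis using gr_shift_kernel[OF F_module M st] \<epsilon>k by simp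
    qed
    ultimately show ?thesis using h(1,2,4) by blast
  qed

  have step: "\<exists>h'. ?inv (Suc p) h' \<and> (\<forall>v\<in>carrier (AF (r (Suc p))). initial_complex_map R I n \<phi> (Suc p) (h' v) = h (d (Suc p) v))"
    if "?inv p h" for p h
  proof -
    from that have h: "h \<in> module_hom A (AF (r p)) (gr (F (n p)))" "bij_betw h (carrier (AF (r p))) (carrier (gr (F (n p))))"
     "\<And>j. h ` grade (?P p) j = grade (?Q p) j"
     "h ` d (Suc p) ` carrier (AF (r (Suc p))) = initial_module (F (n p)) (f p ` carrier (F (n (Suc p))))" by blast+
    \<comment> \<open>The p-th term of the complex is twisted by -\<delta> p, so a generator of
      degree c (Suc p) lands in degree c (Suc p) - \<delta> p of the untwisted associated graded
      module.\<close>
    let ?s = "?ord p" and ?D = "h \<circ> d (Suc p)" and ?t = "c (Suc p) - int (?\<delta> p)"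
    have D: "?D \<in> module_hom A (AF (r (Suc p))) (gr (F (n p)))" by (rule module_hom_comp[OF dh h(1)])
    have h0: "h x = \<zero>\<^bsub>gr (F (n p))\<^esub> \<longleftrightarrow> x = \<zero>\<^bsub>AF (r p)\<^esub>" if "x \<in> carrier (AF (r p))" for x
      using module_hom_zero[OF AF_module gr_module_module[OF F_module] h(1)]
        inj_onD[OF bij_betw_imp_inj_on[OF h(2)] _ that abelian_groupE(2)[OF module.axioms(2)[OF AF_module]]] by metis
    have kD: "{v \<in> carrier (AF (r (Suc p))). ?D v = \<zero>\<^bsub>gr (F (n p))\<^esub>} = d (Suc (Suc p)) ` carrier (AF (r (Suc (Suc p))))"
      unfolding dk[symmetric] using h0 module_homD(1)[OF dh] by auto
    have kf: "{x \<in> carrier (F (n (Suc p))). f p x = \<zero>\<^bsub>F (n p)\<^esub>} \<subseteq> filtration R I (F (n (Suc p))) 1"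
      unfolding fk by (rule Fmin)
    have Du: "?D (unit_vec A (r (Suc p)) k) \<in> grade (gr (F (n p))) ?t" for k
    proof -
      have "d (Suc p) (unit_vec A (r (Suc p)) k) \<in> grade (?P p) (c (Suc p))"
        using dg[of p] uP[of "Suc p" k] unfolding graded_hom_def by blast
      then have "h (d (Suc p) (unit_vec A (r (Suc p)) k)) \<in> grade (?Q p) (c (Suc p))" using h(3) by blast
      then show ?thesis by simp
    qed
    have img: "?D ` carrier (AF (r (Suc p))) = initial_module (F (n p)) (f p ` carrier (F (n (Suc p))))"
      using h(4) by (simp only: image_comp)
    \<comment> \<open>The goal is that ?t is the order of the differential. The alternative r (Suc
      p) = 0 covers the case without basis elements, where the degree c (Suc p) carries no
      information.\<close>
    have st: "strict_hom (F (n (Suc p))) (F (n p)) ?s (f p) \<and> (r (Suc p) = 0 \<or> ?t = int ?s)"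
    proof (cases "n (Suc p) = 0")
      case False
      note sg = strict_hom_of_generation[OF fh _ kf D Du img]
      have "?s = nat ?t"
        using False sg(2,3) \<phi>c unfolding f_def strict_hom_def by (intro matrix_order_eq) auto
      then show ?thesis using sg(1,2) False by simp
    next
      \<comment> \<open>For a source of rank 0 the order is unspecified. The image is zero, so the
        map is strict for any value of ?s, and minimality of the pure resolution forces its term to
        have rank 0 as well.\<close>
      case True
      have im0: "f p ` carrier (F (n (Suc p))) = {\<zero>\<^bsub>F (n p)\<^esub>}"
      proof -
        have "carrier (F (n (Suc p))) = {\<zero>\<^bsub>F (n (Suc p))\<^esub>}" by (auto simp: True)
        then show ?thesis using module_hom_zero[OF F_module F_module fh] by simp
      qed
      have "r (Suc p) = 0"
      proof (rule ccontr)
        assume r: "r (Suc p) \<noteq> 0"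
        let ?u = "unit_vec A (r (Suc p)) 0"
        have uc: "?u \<in> carrier (AF (r (Suc p)))" using unit_vec_closed[OF gr_cring] by simp
        then have "?D ?u \<in> initial_module (F (n p)) {\<zero>\<^bsub>F (n p)\<^esub>}" using img im0 by (metis imageI)
        then obtain x where "?D ?u = cl (F (n p)) x" "\<And>i. x i = \<zero>\<^bsub>F (n p)\<^esub>" by (auto simp: initial_module_def simp del: free_module_simps)
        moreover from this have "x = (\<lambda>i. \<zero>\<^bsub>F (n p)\<^esub>)" by blast
        ultimately have "?D ?u = \<zero>\<^bsub>gr (F (n p))\<^esub>" using gr_zero[OF F_module] by simp
        then have "?u \<in> ideal_smult A (irrelevant_ideal A) (AF (r (Suc p)))" using kD uc dmin[of "Suc p"] by blast
        then show False using unit_vec_not_irrelevant[OF one_notin, of 0 "r (Suc p)"] r by simp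
      qed
      moreover have "strict_hom (F (n (Suc p))) (F (n p)) ?s (f p)"
      proof -
        have "\<zero>\<^bsub>F (n p)\<^esub> \<in> f p ` filtration R I (F (n (Suc p))) i" for i
          using submodule_zero[OF F_module filt_submodule[OF F_module]] module_hom_zero[OF F_module F_module fh] by (metis imageI)
        then show ?thesis unfolding strict_hom_def im0 using fh submodule_zero[OF F_module filt_submodule[OF F_module]] by blast
      qed
      ultimately show ?thesis by blast
    qed
    \<comment> \<open>Strictness includes that the image has order at least ?s, which is the
      hypothesis needed to identify the initial form map with the induced map.\<close>
    have entries: "\<phi> (Suc p) i j \<in> ideal_power R I ?s" if "i < n p" "j < n (Suc p)" for i j
      using st matrix_map_filtration_iff[of "n p" "n (Suc p)" "\<phi> (Suc p)" ?s, OF \<phi>c] that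
      unfolding strict_hom_def f_def by blast
    have "\<exists>h'. h' \<in> module_hom A (AF (r (Suc p))) (gr (F (n (Suc p)))) \<and> bij_betw h' (carrier (AF (r (Suc p)))) (carrier (gr (F (n (Suc p))))) \<and>
       (\<forall>j. h' ` homog (r (Suc p)) j = grade (gr (F (n (Suc p)))) j) \<and> (\<forall>v\<in>carrier (AF (r (Suc p))). gr_shift (F (n p)) ?s (f p) (h' v) = ?D v)"
    proof (rule strict_hom_lift[OF F_module conjunct1[OF st] kf D])
      show "?D (unit_vec A (r (Suc p)) k) \<in> grade (gr (F (n p))) (int ?s)" if "k < r (Suc p)" for k
        using Du[of k] st that by auto
      show "?D ` carrier (AF (r (Suc p))) = gr_shift (F (n p)) ?s (f p) ` carrier (gr (F (n (Suc p))))"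
        unfolding img gr_shift_image[OF F_module F_module conjunct1[OF st]] ..
      show "{v \<in> carrier (AF (r (Suc p))). ?D v = \<zero>\<^bsub>gr (F (n p))\<^esub>} \<subseteq> ideal_smult A (irrelevant_ideal A) (AF (r (Suc p)))"
        unfolding kD by (rule dmin)
    qed
    then obtain h' where h': "h' \<in> module_hom A (AF (r (Suc p))) (gr (F (n (Suc p))))" "bij_betw h' (carrier (AF (r (Suc p)))) (carrier (gr (F (n (Suc p)))))"
       "\<And>j. h' ` homog (r (Suc p)) j = grade (gr (F (n (Suc p)))) j" "\<And>v. v \<in> carrier (AF (r (Suc p))) \<Longrightarrow> gr_shift (F (n p)) ?s (f p) (h' v) = ?D v" by blast
    have "h' ` grade (?P (Suc p)) j = grade (?Q (Suc p)) j" for j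
    proof -
      \<comment> \<open>The generators have degree c (Suc p) = \<delta> p + ?s = \<delta> (Suc p),
        the twist of the complex of initial forms. For rank 0 every component is the same
        singleton.\<close>
      have "homog (r (Suc p)) (j - c (Suc p)) = homog (r (Suc p)) (j - int (?\<delta> (Suc p)))"
      proof (cases "r (Suc p) = 0")
        case True
        then show ?thesis by simp
      next
        case False
        from conjunct2[OF st] have "?t = int ?s"
        proof (rule disjE)
          assume "r (Suc p) = 0"
          then show ?thesis using False by contradiction
        qed
        then have "c (Suc p) = int (?\<delta> (Suc p))" unfolding \<delta>(2) by linarith
        then show ?thesis by (rule arg_cong)
      qed
      then show ?thesis unfolding Pg using h'(3)[of "j - int (?\<delta> (Suc p))"] by simp
    qed
    moreover have "h' ` d (Suc (Suc p)) ` carrier (AF (r (Suc (Suc p)))) = initial_module (F (n (Suc p))) (f (Suc p) ` carrier (F (n (Suc (Suc p)))))"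
    proof -
      have "h' ` d (Suc (Suc p)) ` carrier (AF (r (Suc (Suc p)))) = {u \<in> carrier (gr (F (n (Suc p)))). gr_shift (F (n p)) ?s (f p) u = \<zero>\<^bsub>gr (F (n p))\<^esub>}"
        unfolding kD[symmetric] by (rule image_kernel_eq[where g = "gr_shift (F (n p)) ?s (f p)", OF bij_betw_imp_surj_on[OF h'(2)] h'(4)])
      then show ?thesis using gr_shift_kernel[OF F_module F_module conjunct1[OF st]] fk by simp
    qed
    moreover have "initial_complex_map R I n \<phi> (Suc p) (h' v) = h (d (Suc p) v)" if v: "v \<in> carrier (AF (r (Suc p)))" for v
      using h'(4)[OF v] initial_form_map_eq[of "n p" "n (Suc p)" "\<phi> (Suc p)", OF entries module_homD(1)[OF h'(1) v]]
      by (simp add: initial_complex_map_def f_def)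
    ultimately show ?thesis using h'(1,2) by blast
  qed

  obtain h0 where h0: "?inv 0 h0" "\<forall>v\<in>carrier (AF (r 0)). gr_shift M 0 \<epsilon> (h0 v) = e v" using base by blast
  \<comment> \<open>The next isomorphism has to lift the one already chosen, so the family is built
    by dependent choice and not term by term.\<close>
  define next_h where "next_h p h = (SOME h'. ?inv (Suc p) h' \<and>
     (\<forall>v\<in>carrier (AF (r (Suc p))). initial_complex_map R I n \<phi> (Suc p) (h' v) = h (d (Suc p) v)))" for p h
  define h where "h = rec_nat h0 next_h"
  have h_0: "h 0 = h0" and h_Suc: "h (Suc p) = next_h p (h p)" for p by (simp_all add: h_def)
  have next_h: "?inv (Suc p) (next_h p h) \<and>
     (\<forall>v\<in>carrier (AF (r (Suc p))). initial_complex_map R I n \<phi> (Suc p) (next_h p h v) = h (d (Suc p) v))"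
    if "?inv p h" for p h
    unfolding next_h_def by (rule someI_ex[OF step[OF that]])
  have inv: "?inv p (h p)" for p
  proof (induction p)
    case 0
    show ?case unfolding h_0 by (rule h0(1))
  next
    case (Suc p)
    show ?case unfolding h_Suc by (rule conjunct1[OF next_h[OF Suc]])
  qed
  have comm: "initial_complex_map R I n \<phi> (Suc p) (h (Suc p) v) = h p (d (Suc p) v)" if v: "v \<in> carrier (AF (r (Suc p)))" for p v
    unfolding h_Suc by (rule bspec[OF conjunct2[OF next_h[OF inv]] v])
  show ?thesis
  proof (rule minimal_graded_free_resolution_transport[OF res irrelevant_ideal_carrier initial_complex_module, where h = h])
    show "h p \<in> module_hom A (?P p) (?Q p)" for p
      using inv[of p] by (simp only: module_hom_graded_free module_hom_initial_complex)
    show "bij_betw (h p) (carrier (?P p)) (carrier (?Q p))" for p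
      using inv[of p] by (simp only: Pc initial_complex_simps)
    show "h p ` grade (?P p) j = grade (?Q p) j" for p j using inv[of p] by blast
    show "grade (?P p) j \<subseteq> carrier (?P p)" for p j unfolding Pc Pg using homog_carrier by blast
    show "initial_complex_map R I n \<phi> (Suc p) (h (Suc p) x) = h p (d (Suc p) x)" if "x \<in> carrier (?P (Suc p))" for p x
      using comm that unfolding Pc by blast
    show "gr_map R I M \<epsilon> (h 0 x) = e x" if "x \<in> carrier (?P 0)" for x
      using h0(2) that unfolding Pc h_0 gr_shift_0 by (rule bspec)
  qed
qed

end

theorem theorem4p5:
  fixes R :: "('a, 'm) ring_scheme" and \<mm> :: "'a set"
    and M :: "('a, 'b, 'n) module_scheme"
    and n :: "nat \<Rightarrow> nat" and \<phi> :: "nat \<Rightarrow> nat \<Rightarrow> nat \<Rightarrow> 'a" and \<epsilon> :: "(nat \<Rightarrow> 'a) \<Rightarrow> 'b"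
  assumes "noetherian_local_ring R \<mm>"
    and "fin_gen_module R M"
    and "minimal_free_resolution R \<mm> M n \<phi> \<epsilon>"
  shows "has_pure_resolution (gr_ring R \<mm>) (gr_module R \<mm> M) \<longleftrightarrow>
    minimal_graded_free_resolution (gr_ring R \<mm>) (gr_module R \<mm> M)
      (initial_complex R \<mm> n \<phi>) (initial_complex_map R \<mm> n \<phi>) (gr_map R \<mm> M \<epsilon>)"
proof -
  have "cring R" "noetherian_ring R" "ideal \<mm> R" "maximalideal \<mm> R" "\<And>J. maximalideal J R \<Longrightarrow> J = \<mm>"
    using assms(1) by (auto simp: noetherian_local_ring_def maximalideal_def)
  then interpret noetherian_local R \<mm>
    by (intro noetherian_local.intro noetherian_cring.intro adic.intro noetherian_local_axioms.intro)
  have "module R M" using assms(2) by (simp add: fin_gen_module_def)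
  then show ?thesis
    using initial_complex_resolution_if_pure[OF _ assms(3)] pure_if_initial_complex_resolution by blast
qed

end
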